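(* Let $X=G/\Gamma$ be a nilmanifold with $G$ a 2-step nilpotent group (i.e. $[G,[G,G]]=\{1\}$), fix $u\in G$, let $T(g\Gamma)=ug\Gamma$, and suppose $(X,T)$ is transitive. Then for every Borel probability measure $\mu$ on $X$ that projects to Haar measure on the maximal torus factor $X_1$, and every $f\in C(X)$, $\lim_{n\to\infty}\int_X f\circ T^n\,d\mu=\int_X f\,dm$, i.e. $T^n_*\mu\to m$ in the weak$^*$ topology.
   Context: A nilmanifold is $X=G/\Gamma$ with $G$ a connected nilpotent Lie group and $\Gamma$ a discrete cocompact subgroup; $m$ is the unique $G$-invariant (Haar) probability measure on $X$. With lower central series $G_0=G$, $G_{n+1}=[G,G_n]$, the maximal torus factor is $X_1=G/G_1\Gamma$ with projection $\pi:X\to X_1$; "$\mu$ projects to Haar measure on $X_1$" means $\pi_*\mu$ is Haar measure on $X_1$. $T^n_*\mu$ denotes the push-forward, $\int f\,dT^n_*\mu=\int f\circ T^n\,d\mu$. *)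

theory Defs
  imports "HOL-Algebra.Coset" "HOL-Algebra.Generated_Groups" "HOL-Probability.Probability"
begin

fun lower_central :: "('g, 'b) monoid_scheme \<Rightarrow> nat \<Rightarrow> 'g set" where
  "lower_central G 0 = carrier G"
| "lower_central G (Suc n) =
     generate G {x \<otimes>\<^bsub>G\<^esub> y \<otimes>\<^bsub>G\<^esub> inv\<^bsub>G\<^esub> x \<otimes>\<^bsub>G\<^esub> inv\<^bsub>G\<^esub> y
                  | x y. x \<in> carrier G \<and> y \<in> lower_central G n}"

definition topological_group :: "('g::t2_space, 'b) monoid_scheme \<Rightarrow> bool" where
  "topological_group G \<longleftrightarrow> group G \<and> carrier G = UNIV \<and>
     continuous_on UNIV (\<lambda>p::'g \<times> 'g. fst p \<otimes>\<^bsub>G\<^esub> snd p) \<and>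
     continuous_on UNIV (\<lambda>x. inv\<^bsub>G\<^esub> x)"

text \<open>Lie group, rendered as a topological group that is a topological manifold
  (locally homeomorphic to open subsets of the Euclidean space 'e); by the solution of
  Hilbert's fifth problem (Gleason--Montgomery--Zippin) this is equivalent.\<close>
definition lie_group :: "('g::t2_space, 'b) monoid_scheme \<Rightarrow> 'e::euclidean_space itself \<Rightarrow> bool" where
  "lie_group G E \<longleftrightarrow> topological_group G \<and>
     (\<forall>x::'g. \<exists>U (V::'e set). open U \<and> x \<in> U \<and> open V \<and> U homeomorphic V)"

definition coset_quotient_map ::
    "('g::topological_space, 'b) monoid_scheme \<Rightarrow> 'g set \<Rightarrow> ('g \<Rightarrow> 'y::topological_space) \<Rightarrow> bool" where
  "coset_quotient_map G H q \<longleftrightarrow> surj q \<and>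
     (\<forall>S. open S \<longleftrightarrow> open (q -` S)) \<and>
     (\<forall>g h. q g = q h \<longleftrightarrow> inv\<^bsub>G\<^esub> g \<otimes>\<^bsub>G\<^esub> h \<in> H)"

text \<open>Left translation by a on G/H (well defined when q is the quotient map).\<close>
definition left_transl :: "('g, 'b) monoid_scheme \<Rightarrow> ('g \<Rightarrow> 'y) \<Rightarrow> 'g \<Rightarrow> 'y \<Rightarrow> 'y" where
  "left_transl G q a x = q (a \<otimes>\<^bsub>G\<^esub> (SOME g. q g = x))"

text \<open>Haar measure on G/H: a G-invariant Borel probability measure (it is unique).\<close>
definition haar_on_quotient ::
    "('g, 'b) monoid_scheme \<Rightarrow> ('g \<Rightarrow> 'y::topological_space) \<Rightarrow> 'y measure \<Rightarrow> bool" where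
  "haar_on_quotient G q m \<longleftrightarrow> sets m = sets borel \<and> prob_space m \<and>
     (\<forall>a \<in> carrier G. distr m borel (left_transl G q a) = m)"

definition top_transitive :: "('x::topological_space \<Rightarrow> 'x) \<Rightarrow> bool" where
  "top_transitive T \<longleftrightarrow> (\<exists>x. closure {(T ^^ n) x | n. True} = UNIV)"

end

theory Submission
  imports Defs "HOL-Complex_Analysis.Great_Picard"
begin

text \<open>The commutator subgroup \<open>G\<^sub>1\<close> is central, so it acts on \<open>X\<close> by an equicontinuous commuting
  group of maps preserving \<open>m\<close>.  The continuous functions \<open>e\<close> with \<open>e (z x) = \<chi> z * e x\<close> for
  \<open>z \<in> G\<^sub>1\<close> therefore span a uniformly dense subspace; this is a Peter--Weyl theorem, obtained from
  the spectral theory of the compact operator with the \<open>G\<^sub>1\<close>-invariant kernel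
  \<open>sup\<^sub>z |f (z x) - f (z y)|\<close>, and it needs neither a Haar measure on the fibres nor the
  closedness of \<open>G\<^sub>1 \<Gamma>\<close>.

  If \<open>e\<close> is \<open>G\<^sub>1\<close>-invariant, it factors through \<open>X\<^sub>1\<close> and its integral along \<open>T\<^sup>n\<close> is constant.
  Otherwise \<open>g \<mapsto> \<integral> g d\<mu>\<close> is bounded in \<open>L\<^sup>2(m)\<close> on the functions with character \<open>\<chi>\<close>, since
  \<open>|g|\<close> factors through \<open>X\<^sub>1\<close>, so it suffices that the correlations \<open>\<integral> e (T\<^sup>n x) cnj (e x) dm\<close>
  tend to 0.  Replacing \<open>x\<close> by \<open>h x\<close> multiplies them by \<open>\<chi> [u, h]\<^sup>n\<close>, up to a small error when \<open>h\<close>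
  is close to \<open>1\<close>.  Transitivity makes \<open>h \<mapsto> \<chi> [u, h]\<close> nontrivial, and by connectedness a given
  neighbourhood of \<open>1\<close> contains, for all large \<open>n\<close>, some \<open>h\<close> with \<open>\<chi> [u, h]\<^sup>n = -1\<close>.\<close>

subsection \<open>Continuous functions on compact spaces\<close>

lemma continuous_on_UNIV_iff_tendsto_nhds:
  "continuous_on UNIV f \<longleftrightarrow> (\<forall>x. (f \<longlongrightarrow> f x) (nhds x))"
  by (simp add: continuous_on_def tendsto_at_iff_tendsto_nhds)

lemma continuous_on_UNIV_bounded:
  fixes f :: "'x::topological_space \<Rightarrow> 'b::real_normed_vector"
  assumes "compact (UNIV :: 'x set)" "continuous_on UNIV f"
  obtains B where "B > 0" "\<And>x. norm (f x) \<le> B"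
proof -
  have "bounded (range f)"
    using compact_continuous_image[OF assms(2,1)] compact_imp_bounded by blast
  then show thesis
    using that by (auto simp: bounded_pos)
qed

lemma continuous_imp_uniform_limit_nhds:
  fixes K :: "'a::topological_space \<Rightarrow> 'x::topological_space \<Rightarrow> 'b::metric_space"
  assumes "compact (UNIV :: 'x set)" "continuous_on UNIV (\<lambda>p. K (fst p) (snd p))"
  shows "uniform_limit UNIV K (K a) (nhds a)"
proof (rule uniform_limitI)
  fix e :: real assume "e > 0"
  then have half_pos: "e / 2 > 0" by simp
  have cont: "continuous_on (UNIV \<times> UNIV) (\<lambda>p. K (fst p) (snd p))"
    using assms(2) by simp
  obtain A where A_nbhd: "a \<in> A" "open A"
    and close: "\<forall>b\<in>A \<inter> UNIV. \<forall>x\<in>UNIV.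
      dist (K (fst (b, x)) (snd (b, x))) (K (fst (a, x)) (snd (a, x))) \<le> e / 2"
    by (rule continuous_on_prod_compactE[OF cont assms(1) UNIV_I half_pos])
  have "dist (K b x) (K a x) < e" if "b \<in> A" for b x
  proof -
    have "dist (K b x) (K a x) \<le> e / 2" using close that by force
    then show ?thesis using \<open>e > 0\<close> by simp
  qed
  with A_nbhd show "\<forall>\<^sub>F b in nhds a. \<forall>x\<in>UNIV. dist (K b x) (K a x) < e"
    by (auto simp: eventually_nhds)
qed

lemma continuous_real_separates_points:
  fixes x y :: "'x::t2_space"
  assumes "compact (UNIV :: 'x set)" "x \<noteq> y"
  obtains f :: "'x \<Rightarrow> real" where "continuous_on UNIV f" "f x \<noteq> f y"
proof -
  have "compact_space (euclidean :: 'x topology)"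
    using assms(1) by (simp add: compact_space_def)
  moreover have "Hausdorff_space (euclidean :: 'x topology)"
    unfolding Hausdorff_space_def using separation_t2 by (auto simp: disjnt_def)
  ultimately have "normal_space (euclidean :: 'x topology)"
    by (intro compact_Hausdorff_or_regular_imp_normal_space) auto
  then obtain f where "continuous_map euclidean euclideanreal f" "f ` {x} \<subseteq> {0}" "f ` {y} \<subseteq> {1}"
    using Urysohn_lemma_alt[of "euclidean :: 'x topology" "{x}" "{y}" 0 1] assms(2) by auto
  then show thesis
    using that[of f] by simp
qed

lemma continuous_on_open_surj_lift:
  assumes "surj p" "\<And>S. open S \<Longrightarrow> open (p ` S)" "continuous_on UNIV (\<lambda>a. F (p a))"
  shows "continuous_on UNIV F"
proof -
  have "open (F -` B)" if "open B" for B
  proof -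
    have "F -` B = p ` ((\<lambda>a. F (p a)) -` B)"
      using surj_image_vimage_eq[OF assms(1), of "F -` B"] by (simp add: vimage_def)
    with assms(2) open_vimage[OF that assms(3)] show ?thesis by simp
  qed
  then show ?thesis by (simp add: continuous_on_open_vimage)
qed

lemma open_image_map_prod:
  assumes "\<And>A. open A \<Longrightarrow> open (f ` A)" "\<And>B. open B \<Longrightarrow> open (g ` B)" "open S"
  shows "open (map_prod f g ` S)"
proof (subst open_subopen, intro ballI)
  fix p assume "p \<in> map_prod f g ` S"
  then obtain s where s_in_S: "s \<in> S" "p = map_prod f g s" by (rule imageE)
  obtain A B where "open A" "open B" "s \<in> A \<times> B" "A \<times> B \<subseteq> S"
    using open_prod_elim[OF assms(3) s_in_S(1)] by blast
  then show "\<exists>T. open T \<and> p \<in> T \<and> T \<subseteq> map_prod f g ` S"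
    using assms(1,2) s_in_S(2)
    by (intro exI[of _ "map_prod f g ` (A \<times> B)"])
      (auto simp: map_prod_surj_on[OF refl refl] intro!: open_Times)
qed

definition equicontinuous :: "'i set \<Rightarrow> ('i \<Rightarrow> 'x::topological_space \<Rightarrow> 'b::metric_space) \<Rightarrow> bool" where
  "equicontinuous I F \<longleftrightarrow> (\<forall>x. \<forall>e>0. \<forall>\<^sub>F y in nhds x. \<forall>i\<in>I. dist (F i y) (F i x) < e)"

lemma equicontinuous_finite_net:
  fixes F :: "'i \<Rightarrow> 'x::topological_space \<Rightarrow> 'b::metric_space"
  assumes "compact (UNIV :: 'x set)" "equicontinuous I F" "e > 0"
  obtains N where "finite N" "\<And>x. \<exists>y\<in>N. \<forall>i\<in>I. dist (F i x) (F i y) < e"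
proof -
  obtain U where U_nbhd: "\<And>x. open (U x)" "\<And>x. x \<in> U x"
    "\<And>x y i. y \<in> U x \<Longrightarrow> i \<in> I \<Longrightarrow> dist (F i y) (F i x) < e"
  proof -
    have "\<exists>U. open U \<and> x \<in> U \<and> (\<forall>y\<in>U. \<forall>i\<in>I. dist (F i y) (F i x) < e)" for x
      using assms(2,3) by (simp add: equicontinuous_def eventually_nhds)
    then show thesis using that by metis
  qed
  obtain N where "finite N" "(UNIV :: 'x set) \<subseteq> (\<Union>x\<in>N. U x)"
  proof (rule compactE_image[OF assms(1), of UNIV U])
    show "UNIV \<subseteq> (\<Union>x. U x)" using U_nbhd(2) by blast
  qed (use U_nbhd(1) that in auto)
  with U_nbhd(3) show thesis
    using that[of N] by blast
qed

lemma equicontinuous_Cauchy_imp_uniformly_Cauchy: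
  fixes F :: "nat \<Rightarrow> 'x::topological_space \<Rightarrow> 'b::metric_space"
  assumes net: "\<And>e. e > 0 \<Longrightarrow> \<exists>N\<subseteq>D. finite N \<and> (\<forall>x. \<exists>y\<in>N. \<forall>n. dist (F n x) (F n y) < e)"
    and Cauchy: "\<And>y. y \<in> D \<Longrightarrow> Cauchy (\<lambda>n. F n y)"
  shows "uniformly_Cauchy_on UNIV F"
proof (rule uniformly_Cauchy_onI)
  fix e :: real assume "e > 0"
  then have third_pos: "e / 3 > 0" by simp
  obtain N where N_net: "N \<subseteq> D" "finite N" "\<And>x. \<exists>y\<in>N. \<forall>n. dist (F n x) (F n y) < e / 3"
    using net[OF third_pos] by blast
  have "\<forall>y\<in>N. \<exists>M. \<forall>a\<ge>M. \<forall>b\<ge>M. dist (F a y) (F b y) < e / 3"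
    using Cauchy N_net(1) third_pos unfolding Cauchy_def by blast
  then obtain M where M_Cauchy: "\<And>y a b. y \<in> N \<Longrightarrow> a \<ge> M y \<Longrightarrow> b \<ge> M y \<Longrightarrow> dist (F a y) (F b y) < e / 3"
    by metis
  have "dist (F a x) (F b x) < e" if ab_ge: "a \<ge> Max (M ` N)" "b \<ge> Max (M ` N)" for a b x
  proof -
    obtain y where y_near: "y \<in> N" "\<And>n. dist (F n x) (F n y) < e / 3" using N_net(3) by blast
    have "M y \<le> Max (M ` N)" using N_net(2) y_near(1) by simp
    then have "dist (F a y) (F b y) < e / 3" using M_Cauchy[OF y_near(1)] ab_ge by simp
    with y_near(2)[of a] y_near(2)[of b] show ?thesis
      using dist_triangle[of "F a x" "F b x" "F a y"] dist_triangle2[of "F a y" "F b x" "F b y"]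
      by (simp add: dist_commute)
  qed
  then show "\<exists>M. \<forall>x\<in>UNIV. \<forall>a\<ge>M. \<forall>b\<ge>M. dist (F a x) (F b x) < e" by blast
qed

lemma equicontinuous_bounded_convergent_subsequence:
  fixes F :: "nat \<Rightarrow> 'x::topological_space \<Rightarrow> 'b::{real_normed_vector,heine_borel}"
  assumes "compact (UNIV :: 'x set)" "equicontinuous UNIV F" and bounded: "\<And>n x. norm (F n x) \<le> B"
  obtains r p where "strict_mono r" "uniform_limit UNIV (\<lambda>n. F (r n)) p sequentially"
proof -
  have "\<exists>N. finite N \<and> (\<forall>x. \<exists>y\<in>N. \<forall>n. dist (F n x) (F n y) < 1 / real (Suc k))" for k
    by (rule equicontinuous_finite_net[OF assms(1,2), of "1 / real (Suc k)"]) auto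
  then obtain N where N_net: "\<And>k. finite (N k)"
    "\<And>k x. \<exists>y\<in>N k. \<forall>n. dist (F n x) (F n y) < 1 / real (Suc k)"
    by metis
  define D where "D = (\<Union>k. N k)"
  have "countable D"
    unfolding D_def using N_net(1) by (simp add: countable_finite)
  then obtain r where r_subseq: "strict_mono r" "\<And>y. y \<in> D \<Longrightarrow> \<exists>l. (\<lambda>n. F (r n) y) \<longlonglongrightarrow> l"
    using function_convergent_subsequence[of D F B] bounded by blast
  have "uniformly_Cauchy_on UNIV (\<lambda>n. F (r n))"
  proof (rule equicontinuous_Cauchy_imp_uniformly_Cauchy[of D])
    fix e :: real assume "e > 0"
    then obtain k where k_less: "1 / real (Suc k) < e" by (rule nat_approx_posE)
    have "\<exists>y\<in>N k. \<forall>n. dist (F (r n) x) (F (r n) y) < e" for x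
      using N_net(2)[of k x] k_less by (meson order.strict_trans)
    then show "\<exists>N\<subseteq>D. finite N \<and> (\<forall>x. \<exists>y\<in>N. \<forall>n. dist (F (r n) x) (F (r n) y) < e)"
      using N_net(1) by (intro exI[of _ "N k"]) (auto simp: D_def)
  qed (use r_subseq(2) LIMSEQ_imp_Cauchy in blast)
  then obtain p where "uniform_limit UNIV (\<lambda>n. F (r n)) p sequentially"
    using Cauchy_uniformly_convergent unfolding uniformly_convergent_on_def by blast
  with r_subseq(1) show thesis by (rule that)
qed

lemma uniform_limit_sum:
  fixes f :: "'i \<Rightarrow> 'n \<Rightarrow> 'a \<Rightarrow> 'b::real_normed_vector"
  assumes "\<And>i. i \<in> I \<Longrightarrow> uniform_limit X (f i) (l i) F"
  shows "uniform_limit X (\<lambda>n x. \<Sum>i\<in>I. f i n x) (\<lambda>x. \<Sum>i\<in>I. l i x) F"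
  using assms
proof (induction I rule: infinite_finite_induct)
  case (insert i I)
  then show ?case by (simp add: uniform_limit_add)
qed (simp_all add: uniform_limit_const)

lemma tendsto_uniform_approximation:
  fixes a :: "nat \<Rightarrow> 'b::metric_space"
  assumes "\<And>e. e > 0 \<Longrightarrow> \<exists>b l'. b \<longlonglongrightarrow> l' \<and> (\<forall>n. dist (a n) (b n) \<le> e) \<and> dist l l' \<le> e"
  shows "a \<longlonglongrightarrow> l"
proof (rule tendstoI)
  fix e :: real assume "e > 0"
  then have third_pos: "e / 3 > 0" by simp
  obtain b l' where b_approx: "b \<longlonglongrightarrow> l'" "\<And>n. dist (a n) (b n) \<le> e / 3" "dist l l' \<le> e / 3"
    using assms[OF third_pos] by blast
  have "\<forall>\<^sub>F n in sequentially. dist (b n) l' < e / 3"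
    using b_approx(1) third_pos by (rule tendstoD)
  then show "\<forall>\<^sub>F n in sequentially. dist (a n) l < e"
  proof eventually_elim
    case (elim n)
    with b_approx(2)[of n] b_approx(3) show ?case
      using dist_triangle[of "a n" l "b n"] dist_triangle2[of "b n" l l'] by linarith
  qed
qed

lemma exists_separated_finite_set:
  fixes P :: "nat \<Rightarrow> bool"
  assumes "\<exists>\<^sub>F n in sequentially. P n"
  shows "\<exists>I. finite I \<and> card I = K \<and> (\<forall>i\<in>I. P i) \<and> (\<forall>i\<in>I. \<forall>j\<in>I. j < i \<longrightarrow> j + M \<le> i)"
proof (induction K)
  case 0
  show ?case by (intro exI[of _ "{}"]) simp
next
  case (Suc K)
  then obtain I where separated: "finite I" "card I = K" "\<forall>i\<in>I. P i" "\<forall>i\<in>I. \<forall>j\<in>I. j < i \<longrightarrow> j + M \<le> i"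
    by blast
  obtain n where n_large: "Suc (Max (insert 0 I) + M) \<le> n" "P n"
    using assms unfolding frequently_sequentially by blast
  have above: "i + M < n" if "i \<in> I" for i
  proof -
    have "i \<le> Max (insert 0 I)" using separated(1) that by (intro Max_ge) auto
    with n_large(1) show ?thesis by linarith
  qed
  then have "n \<notin> I" by force
  moreover have "j + M \<le> i" if "i \<in> insert n I" "j \<in> insert n I" "j < i" for i j
    using that separated(4) above by force
  ultimately show ?case
    using separated n_large(2) by (intro exI[of _ "insert n I"]) auto
qed

subsection \<open>Integration on compact spaces\<close>

locale compact_prob_space =
  fixes m :: "'x::topological_space measure"
  assumes compact_UNIV: "compact (UNIV :: 'x set)"
    and sets_m: "sets m = sets borel"
    and prob_space_m: "prob_space m"
begin

lemma space_m [simp]: "space m = UNIV"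
  using sets_eq_imp_space_eq[OF sets_m] by simp

lemma measure_UNIV [simp]: "measure m UNIV = 1"
  using prob_space.prob_space[OF prob_space_m] by simp

lemma finite_m: "finite_measure m"
  using prob_space_m by (simp add: prob_space_def)

lemma measurable_continuous:
  fixes f :: "'x \<Rightarrow> 'b::topological_space"
  shows "continuous_on UNIV f \<Longrightarrow> f \<in> borel_measurable m"
  using borel_measurable_continuous_onI measurable_cong_sets[OF sets_m refl] by blast

lemma integrable_continuous:
  fixes f :: "'x \<Rightarrow> 'b::{banach,second_countable_topology}"
  assumes "continuous_on UNIV f"
  shows "integrable m f"
proof -
  obtain B where "\<And>x. norm (f x) \<le> B"
    using continuous_on_UNIV_bounded[OF compact_UNIV assms] by blast
  then show ?thesis
    by (intro finite_measure.integrable_const_bound[OF finite_m, of _ B]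
        measurable_continuous assms) auto
qed

lemma integral_const [simp]: "(\<integral>x. c \<partial>m) = (c :: 'b::{banach,second_countable_topology})"
  using integrable_continuous[of "\<lambda>_. c"] by simp

lemma integral_norm_le:
  fixes f :: "'x \<Rightarrow> 'b::{banach,second_countable_topology}"
  assumes "integrable m f" "\<And>x. norm (f x) \<le> B"
  shows "norm (\<integral>x. f x \<partial>m) \<le> B"
proof -
  have "norm (\<integral>x. f x \<partial>m) \<le> (\<integral>x. norm (f x) \<partial>m)"
    by (rule integral_norm_bound)
  also have "\<dots> \<le> (\<integral>x. B \<partial>m)"
    using assms integrable_continuous[of "\<lambda>_. B"] by (intro integral_mono) auto
  finally show ?thesis by simp
qed

lemma dist_integral_le:
  fixes f g :: "'x \<Rightarrow> 'b::{banach,second_countable_topology}"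
  assumes "integrable m f" "integrable m g" "\<And>x. dist (f x) (g x) \<le> B"
  shows "dist (\<integral>x. f x \<partial>m) (\<integral>x. g x \<partial>m) \<le> B"
  using integral_norm_le[of "\<lambda>x. f x - g x" B] assms by (simp add: dist_norm)

lemma tendsto_integral_uniform_limit:
  fixes f :: "'i \<Rightarrow> 'x \<Rightarrow> 'b::{banach,second_countable_topology}"
  assumes lim: "uniform_limit UNIV f g F" and "\<And>i. integrable m (f i)" "integrable m g"
  shows "((\<lambda>i. \<integral>x. f i x \<partial>m) \<longlongrightarrow> (\<integral>x. g x \<partial>m)) F"
proof (rule tendstoI)
  fix e :: real assume "e > 0"
  then have "e / 2 > 0" by simp
  with lim have "\<forall>\<^sub>F i in F. \<forall>x\<in>UNIV. dist (f i x) (g x) < e / 2"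
    by (rule uniform_limitD)
  then show "\<forall>\<^sub>F i in F. dist (\<integral>x. f i x \<partial>m) (\<integral>x. g x \<partial>m) < e"
  proof eventually_elim
    case (elim i)
    then have "dist (\<integral>x. f i x \<partial>m) (\<integral>x. g x \<partial>m) \<le> e / 2"
      using assms(2,3) by (intro dist_integral_le) (auto simp: less_imp_le)
    with \<open>e > 0\<close> show ?case by simp
  qed
qed

lemma continuous_on_integral_parameter:
  fixes K :: "'y::topological_space \<Rightarrow> 'x \<Rightarrow> 'b::{banach,second_countable_topology}"
  assumes K_continuous: "continuous_on UNIV (\<lambda>p. K (fst p) (snd p))"
  shows "continuous_on UNIV (\<lambda>y. \<integral>x. K y x \<partial>m)"
proof -
  have "integrable m (K y)" for y
    using continuous_on_compose2[OF K_continuous, of UNIV "\<lambda>x. (y, x)"]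
    by (intro integrable_continuous) (simp add: continuous_on_Pair)
  then show ?thesis
    unfolding continuous_on_UNIV_iff_tendsto_nhds
    by (intro allI tendsto_integral_uniform_limit
      continuous_imp_uniform_limit_nhds[OF compact_UNIV K_continuous])
qed

end

text \<open>The product of two Borel algebras need not contain the open sets of the product space, so
  Tonelli--Fubini does not apply; instead the kernel is approximated uniformly by finite sums of
  products \<open>g x * h y\<close>.\<close>

inductive_set tensor_span :: "('x::topological_space \<times> 'y::topological_space \<Rightarrow> real) set" where
  tensor: "continuous_on UNIV g \<Longrightarrow> continuous_on UNIV h \<Longrightarrow> (\<lambda>p. g (fst p) * h (snd p)) \<in> tensor_span"
| add: "s \<in> tensor_span \<Longrightarrow> t \<in> tensor_span \<Longrightarrow> (\<lambda>p. s p + t p) \<in> tensor_span"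

lemma tensor_span_continuous: "s \<in> tensor_span \<Longrightarrow> continuous_on UNIV s"
proof (induction rule: tensor_span.induct)
  case (tensor g h)
  then have "continuous_on UNIV (\<lambda>p. g (fst p))" "continuous_on UNIV (\<lambda>p. h (snd p))"
    by (auto intro!: continuous_on_compose2[of UNIV g] continuous_on_compose2[of UNIV h]
        continuous_intros)
  then show ?case by (rule continuous_on_mult)
qed (rule continuous_on_add)

lemma tensor_span_mult: "s \<in> tensor_span \<Longrightarrow> t \<in> tensor_span \<Longrightarrow> (\<lambda>p. s p * t p) \<in> tensor_span"
proof (induction rule: tensor_span.induct)
  case (tensor g h)
  from tensor(3) show ?case
  proof (induction rule: tensor_span.induct)
    case (tensor g' h')
    then have "(\<lambda>p. (g (fst p) * g' (fst p)) * (h (snd p) * h' (snd p))) \<in> tensor_span"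
      using \<open>continuous_on UNIV g\<close> \<open>continuous_on UNIV h\<close>
      by (intro tensor_span.tensor continuous_on_mult)
    then show ?case by (simp add: mult_ac)
  next
    case (add s t)
    from tensor_span.add[OF add.IH] show ?case by (simp add: distrib_left)
  qed
next
  case (add s s')
  from tensor_span.add[OF add.IH(1)[OF add.prems] add.IH(2)[OF add.prems]] show ?case
    by (simp add: distrib_right)
qed

lemma tensor_span_dense:
  fixes K :: "'x::t2_space \<times> 'y::t2_space \<Rightarrow> real"
  assumes compact_UNIV: "compact (UNIV :: 'x set)" "compact (UNIV :: 'y set)"
    and K_continuous: "continuous_on UNIV K" and "e > 0"
  obtains s where "s \<in> tensor_span" "\<And>p. \<bar>K p - s p\<bar> < e"
proof -
  have fst: "(\<lambda>p. g (fst p)) \<in> tensor_span" if "continuous_on UNIV g" for g :: "'x \<Rightarrow> real"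
    using tensor_span.tensor[OF that continuous_on_const[of _ 1]] by simp
  have snd: "(\<lambda>p. h (snd p)) \<in> tensor_span" if "continuous_on UNIV h" for h :: "'y \<Rightarrow> real"
    using tensor_span.tensor[OF continuous_on_const[of _ 1] that] by simp
  interpret function_ring_on "tensor_span :: ('x \<times> 'y \<Rightarrow> real) set" UNIV
  proof
    show "compact (UNIV :: ('x \<times> 'y) set)"
      using compact_Times[OF compact_UNIV] by simp
    fix p p' :: "'x \<times> 'y" assume "p \<noteq> p'"
    then consider "fst p \<noteq> fst p'" | "snd p \<noteq> snd p'"
      using prod_eqI by blast
    then show "\<exists>s\<in>tensor_span. s p \<noteq> s p'"
    proof cases
      case 1
      then show ?thesis
        using continuous_real_separates_points[OF compact_UNIV(1)] fst by metis
    next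
      case 2
      then show ?thesis
        using continuous_real_separates_points[OF compact_UNIV(2)] snd by metis
    qed
  next
    show "(\<lambda>_. c) \<in> (tensor_span :: ('x \<times> 'y \<Rightarrow> real) set)" for c
      using fst[of "\<lambda>_. c"] by simp
  qed (auto intro: tensor_span_continuous tensor_span_mult tensor_span.add)
  show thesis
    using Stone_Weierstrass_basic[OF K_continuous \<open>e > 0\<close>] that by auto
qed

context
  fixes m :: "'x::t2_space measure" and n :: "'y::t2_space measure"
  assumes m_compact_prob: "compact_prob_space m" and n_compact_prob: "compact_prob_space n"
begin

interpretation m: compact_prob_space m by (rule m_compact_prob)
interpretation n: compact_prob_space n by (rule n_compact_prob)

lemma continuous_iterated_integrable:
  fixes K :: "'x \<times> 'y \<Rightarrow> 'b::{banach,second_countable_topology}"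
  assumes K_continuous: "continuous_on UNIV K"
  shows "integrable n (\<lambda>y. K (x, y))" "integrable m (\<lambda>x. K (x, y))"
    "integrable m (\<lambda>x. \<integral>y. K (x, y) \<partial>n)" "integrable n (\<lambda>y. \<integral>x. K (x, y) \<partial>m)"
proof -
  have K_swap: "continuous_on UNIV (\<lambda>p. K (snd p, fst p))"
    by (rule continuous_on_compose2[OF K_continuous]) (auto intro!: continuous_intros)
  show "integrable m (\<lambda>x. \<integral>y. K (x, y) \<partial>n)" "integrable n (\<lambda>y. \<integral>x. K (x, y) \<partial>m)"
    using n.continuous_on_integral_parameter[of "\<lambda>x y. K (x, y)"]
      m.continuous_on_integral_parameter[of "\<lambda>y x. K (x, y)"] K_continuous K_swap
    by (auto intro: m.integrable_continuous n.integrable_continuous)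
  show "integrable n (\<lambda>y. K (x, y))" "integrable m (\<lambda>x. K (x, y))"
    by (intro m.integrable_continuous n.integrable_continuous
      continuous_on_compose2[OF K_continuous],
        auto intro!: continuous_intros)+
qed

lemma tensor_span_Fubini:
  "s \<in> tensor_span \<Longrightarrow> (\<integral>x. \<integral>y. s (x, y) \<partial>n \<partial>m) = (\<integral>y. \<integral>x. s (x, y) \<partial>m \<partial>n)"
proof (induction rule: tensor_span.induct)
  case (add s t)
  note int = continuous_iterated_integrable[OF tensor_span_continuous[OF add.hyps(1)]]
    continuous_iterated_integrable[OF tensor_span_continuous[OF add.hyps(2)]]
  from add.IH show ?case by (simp add: int)
qed simp

lemma continuous_Fubini_real:
  fixes K :: "'x \<times> 'y \<Rightarrow> real"
  assumes K_continuous: "continuous_on UNIV K"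
  shows "(\<integral>x. \<integral>y. K (x, y) \<partial>n \<partial>m) = (\<integral>y. \<integral>x. K (x, y) \<partial>m \<partial>n)"
proof -
  let ?I = "\<integral>x. \<integral>y. K (x, y) \<partial>n \<partial>m" and ?J = "\<integral>y. \<integral>x. K (x, y) \<partial>m \<partial>n"
  have "dist ?I ?J \<le> 0"
  proof (rule field_le_epsilon)
    fix e :: real assume "e > 0"
    then have "e / 2 > 0" by simp
    then obtain s where s_approx: "s \<in> tensor_span" "\<And>p. \<bar>K p - s p\<bar> < e / 2"
      using tensor_span_dense[OF m.compact_UNIV n.compact_UNIV K_continuous] by blast
    note int = continuous_iterated_integrable[OF K_continuous]
      continuous_iterated_integrable[OF tensor_span_continuous[OF s_approx(1)]]
    have close: "dist (K p) (s p) \<le> e / 2" for p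
      using s_approx(2)[of p] by (simp add: dist_real_def)
    have "dist ?I (\<integral>x. \<integral>y. s (x, y) \<partial>n \<partial>m) \<le> e / 2"
      by (intro m.dist_integral_le n.dist_integral_le int close)
    moreover have "dist ?J (\<integral>y. \<integral>x. s (x, y) \<partial>m \<partial>n) \<le> e / 2"
      by (intro m.dist_integral_le n.dist_integral_le int close)
    ultimately show "dist ?I ?J \<le> 0 + e"
      using tensor_span_Fubini[OF s_approx(1)] dist_triangle2[of ?I ?J "\<integral>y. \<integral>x. s (x, y) \<partial>m \<partial>n"]
      by simp
  qed
  then show ?thesis by simp
qed

lemma continuous_Fubini:
  fixes K :: "'x \<times> 'y \<Rightarrow> complex"
  assumes K_continuous: "continuous_on UNIV K"
  shows "(\<integral>x. \<integral>y. K (x, y) \<partial>n \<partial>m) = (\<integral>y. \<integral>x. K (x, y) \<partial>m \<partial>n)"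
proof -
  note int = continuous_iterated_integrable[OF K_continuous]
  have "(\<integral>x. \<integral>y. Re (K (x, y)) \<partial>n \<partial>m) = (\<integral>y. \<integral>x. Re (K (x, y)) \<partial>m \<partial>n)"
    "(\<integral>x. \<integral>y. Im (K (x, y)) \<partial>n \<partial>m) = (\<integral>y. \<integral>x. Im (K (x, y)) \<partial>m \<partial>n)"
    using K_continuous by (auto intro!: continuous_Fubini_real continuous_on_Re continuous_on_Im)
  then show ?thesis
    using int by (simp add: complex_eq_iff)
qed

end

subsection \<open>The inner product of continuous functions\<close>

abbreviation ccont :: "('x::topological_space \<Rightarrow> complex) \<Rightarrow> bool" where
  "ccont g \<equiv> continuous_on UNIV g"

locale full_support_space = compact_prob_space m for m :: "'x::topological_space measure" +
  assumes full_support: "open S \<Longrightarrow> S \<noteq> {} \<Longrightarrow> measure m S > 0"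
begin

definition cinner :: "('x \<Rightarrow> complex) \<Rightarrow> ('x \<Rightarrow> complex) \<Rightarrow> complex" where
  "cinner f g = (\<integral>x. f x * cnj (g x) \<partial>m)"

definition sqnorm :: "('x \<Rightarrow> complex) \<Rightarrow> real" where
  "sqnorm f = (\<integral>x. (cmod (f x))\<^sup>2 \<partial>m)"

lemma cinner_integrable: "ccont f \<Longrightarrow> ccont g \<Longrightarrow> integrable m (\<lambda>x. f x * cnj (g x))"
  by (intro integrable_continuous continuous_intros)

lemma sqnorm_integrable: "ccont f \<Longrightarrow> integrable m (\<lambda>x. (cmod (f x))\<^sup>2)"
  by (intro integrable_continuous continuous_intros)

lemma cinner_commute: "cinner g f = cnj (cinner f g)"
proof -
  have "cinner g f = (\<integral>x. cnj (f x * cnj (g x)) \<partial>m)"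
    by (simp add: cinner_def mult.commute)
  also have "\<dots> = cnj (cinner f g)"
    unfolding cinner_def
    by (rule integral_bounded_linear'[OF bounded_linear_cnj bounded_linear_cnj]) simp
  finally show ?thesis .
qed

lemma cinner_self: "cinner f f = of_real (sqnorm f)"
proof -
  have "(\<lambda>x. f x * cnj (f x)) = (\<lambda>x. complex_of_real ((cmod (f x))\<^sup>2))"
    by (simp add: complex_norm_square del: of_real_power)
  then show ?thesis
    unfolding cinner_def sqnorm_def by (simp only: integral_complex_of_real)
qed

lemma cinner_add_left:
  "ccont f \<Longrightarrow> ccont g \<Longrightarrow> ccont h \<Longrightarrow> cinner (\<lambda>x. f x + g x) h = cinner f h + cinner g h"
  by (simp add: cinner_def distrib_right cinner_integrable)

lemma cinner_diff_left:
  "ccont f \<Longrightarrow> ccont g \<Longrightarrow> ccont h \<Longrightarrow> cinner (\<lambda>x. f x - g x) h = cinner f h - cinner g h"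
  by (simp add: cinner_def left_diff_distrib cinner_integrable)

lemma cinner_scale_left: "cinner (\<lambda>x. c * f x) h = c * cinner f h"
  by (simp add: cinner_def mult.assoc)

lemma cinner_add_right:
  "ccont f \<Longrightarrow> ccont g \<Longrightarrow> ccont h \<Longrightarrow> cinner h (\<lambda>x. f x + g x) = cinner h f + cinner h g"
  by (simp add: cinner_commute[of h] cinner_add_left)

lemma cinner_scale_right: "cinner h (\<lambda>x. c * f x) = cnj c * cinner h f"
  by (simp add: cinner_commute[of h] cinner_scale_left)

lemma cinner_zero_left [simp]: "cinner (\<lambda>_. 0) h = 0"
  by (simp add: cinner_def)

lemma cinner_sum_left:
  assumes "finite I" "\<And>i. i \<in> I \<Longrightarrow> ccont (f i)" "ccont h"
  shows "cinner (\<lambda>x. \<Sum>i\<in>I. c i * f i x) h = (\<Sum>i\<in>I. c i * cinner (f i) h)"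
  using assms(1,2)
proof (induction I rule: finite_induct)
  case (insert i I)
  then show ?case
    using assms(3) cinner_scale_left[of "c i" "f i" h]
    by (simp add: cinner_add_left continuous_on_sum continuous_on_mult_left)
qed simp

lemma sqnorm_nonneg [simp]: "sqnorm f \<ge> 0"
  unfolding sqnorm_def by (intro integral_nonneg_AE) auto

lemma sqnorm_zero [simp]: "sqnorm (\<lambda>_. 0) = 0"
  by (simp add: sqnorm_def)

lemma sqnorm_scale: "sqnorm (\<lambda>x. c * f x) = (cmod c)\<^sup>2 * sqnorm f"
  by (simp add: sqnorm_def norm_mult power_mult_distrib)

lemma sqnorm_le:
  assumes "ccont f" "\<And>x. cmod (f x) \<le> B"
  shows "sqnorm f \<le> B\<^sup>2"
proof -
  have "sqnorm f \<le> (\<integral>x. B\<^sup>2 \<partial>m)"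
    unfolding sqnorm_def using assms sqnorm_integrable integrable_continuous[of "\<lambda>_. B\<^sup>2"]
    by (intro integral_mono) (auto intro: power_mono)
  then show ?thesis by simp
qed

lemma sqnorm_diff:
  assumes "ccont f" "ccont g"
  shows "sqnorm (\<lambda>x. f x - g x) = sqnorm f - 2 * Re (cinner f g) + sqnorm g"
proof -
  define R where "R x = Re (f x * cnj (g x))" for x
  have R_integral: "integrable m R" "(\<integral>x. R x \<partial>m) = Re (cinner f g)"
    unfolding R_def cinner_def using cinner_integrable[OF assms]
    by (rule integrable_Re, rule integral_Re)
  have "(cmod (a - b))\<^sup>2 = (cmod a)\<^sup>2 - 2 * Re (a * cnj b) + (cmod b)\<^sup>2" for a b
    by (simp add: cmod_power2) (simp add: power2_eq_square algebra_simps)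
  then have "sqnorm (\<lambda>x. f x - g x) = (\<integral>x. (cmod (f x))\<^sup>2 - 2 * R x + (cmod (g x))\<^sup>2 \<partial>m)"
    by (simp add: sqnorm_def R_def)
  also have "\<dots> = sqnorm f - 2 * Re (cinner f g) + sqnorm g"
    using assms sqnorm_integrable by (simp add: R_integral sqnorm_def)
  finally show ?thesis .
qed

lemma sqnorm_add_le:
  assumes "ccont f" "ccont g"
  shows "sqnorm (\<lambda>x. f x + g x) \<le> 2 * sqnorm f + 2 * sqnorm g"
proof -
  have neg: "ccont (\<lambda>x. - g x)" using assms(2) by (intro continuous_intros)
  have "sqnorm (\<lambda>x. - g x) = sqnorm g" "cinner f (\<lambda>x. - g x) = - cinner f g"
    by (simp_all add: sqnorm_def cinner_def)
  then have "sqnorm (\<lambda>x. f x + g x) = sqnorm f + 2 * Re (cinner f g) + sqnorm g"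
    using sqnorm_diff[OF assms(1) neg] by simp
  moreover have "0 \<le> sqnorm f - 2 * Re (cinner f g) + sqnorm g"
    unfolding sqnorm_diff[OF assms, symmetric] by simp
  ultimately show ?thesis by simp
qed

lemma sqnorm_diff_le:
  assumes "ccont f" "ccont g"
  shows "sqnorm (\<lambda>x. f x - g x) \<le> 2 * sqnorm f + 2 * sqnorm g"
proof -
  have "ccont (\<lambda>x. - g x)" using assms by (intro continuous_intros)
  from sqnorm_add_le[OF assms(1) this] show ?thesis by (simp add: sqnorm_def)
qed

lemma dist_cinner_le:
  assumes cont: "ccont f" "ccont g" "ccont f'" "ccont g'"
    and close: "\<And>x. dist (f x) (f' x) \<le> d" "\<And>x. dist (g x) (g' x) \<le> d"
    and bound: "\<And>x. cmod (g x) \<le> B" "\<And>x. cmod (f' x) \<le> B"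
  shows "dist (cinner f g) (cinner f' g') \<le> 2 * B * d"
  unfolding cinner_def
proof (rule dist_integral_le)
  show "integrable m (\<lambda>x. f x * cnj (g x))" "integrable m (\<lambda>x. f' x * cnj (g' x))"
    using cont by (auto intro: cinner_integrable)
  fix x
  have "f x * cnj (g x) - f' x * cnj (g' x) = (f x - f' x) * cnj (g x) + f' x * cnj (g x - g' x)"
    by (simp add: algebra_simps)
  then have "dist (f x * cnj (g x)) (f' x * cnj (g' x))
      \<le> cmod ((f x - f' x) * cnj (g x)) + cmod (f' x * cnj (g x - g' x))"
    unfolding dist_norm by (simp only: norm_triangle_ineq)
  also have "\<dots> = dist (f x) (f' x) * cmod (g x) + cmod (f' x) * dist (g x) (g' x)"
    by (simp add: dist_norm norm_mult del: complex_cnj_diff)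
  also have "\<dots> \<le> d * B + B * d"
    using close bound order_trans[OF zero_le_dist close(1)] order_trans[OF norm_ge_zero bound(2)]
    by (intro add_mono mult_mono) auto
  finally show "dist (f x * cnj (g x)) (f' x * cnj (g' x)) \<le> 2 * B * d"
    by simp
qed

lemma sqnorm_pos:
  assumes "ccont f" "f \<noteq> (\<lambda>_. 0)"
  shows "sqnorm f > 0"
proof -
  obtain x0 where x0_nonzero: "f x0 \<noteq> 0" using assms(2) by auto
  define r where "r = cmod (f x0) / 2"
  define S where "S = (\<lambda>x. cmod (f x)) -` {r<..}"
  have S_open: "open S" "x0 \<in> S" "r > 0"
    using assms(1) x0_nonzero by (auto simp: S_def r_def intro!: open_vimage continuous_intros)
  have S_measurable: "S \<in> sets m" using S_open(1) sets_m by simp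
  have "0 < r\<^sup>2 * measure m S"
    using full_support[OF S_open(1)] S_open(2,3) by (intro mult_pos_pos) auto
  also have "\<dots> = (\<integral>x. r\<^sup>2 * indicator S x \<partial>m)"
    using S_measurable by simp
  also have "\<dots> \<le> sqnorm f"
    unfolding sqnorm_def
  proof (rule integral_mono)
    show "integrable m (\<lambda>x. r\<^sup>2 * indicator S x)"
      using S_measurable finite_measure.emeasure_finite[OF finite_m]
      by (intro integrable_mult_right integrable_real_indicator) (auto simp: less_top)
    show "integrable m (\<lambda>x. (cmod (f x))\<^sup>2)" by (rule sqnorm_integrable[OF assms(1)])
    show "r\<^sup>2 * indicator S x \<le> (cmod (f x))\<^sup>2" for x
      using S_open(3) by (auto simp: S_def indicator_def intro!: power_mono)
  qed
  finally show ?thesis .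
qed

lemma sqnorm_le_0_imp_zero: "ccont f \<Longrightarrow> sqnorm f \<le> 0 \<Longrightarrow> f = (\<lambda>_. 0)"
  using sqnorm_pos[of f] by (auto simp: not_less[symmetric])

lemma zero_if_sqnorm_le_null_sequence:
  assumes "ccont f" "\<And>n. sqnorm f \<le> X n" "X \<longlonglongrightarrow> 0"
  shows "f = (\<lambda>_. 0)"
  using assms(2,3) by (intro sqnorm_le_0_imp_zero[OF assms(1)] LIMSEQ_le_const) auto

lemma normalize:
  assumes "ccont f" "f \<noteq> (\<lambda>_. 0)"
  obtains c where "c > 0" "sqnorm (\<lambda>x. of_real c * f x) = 1" "c\<^sup>2 * sqnorm f = 1"
proof (rule that[of "1 / sqrt (sqnorm f)"])
  show "sqnorm (\<lambda>x. complex_of_real (1 / sqrt (sqnorm f)) * f x) = 1"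
    unfolding sqnorm_scale using sqnorm_pos[OF assms] by (simp add: norm_divide power_divide)
qed (use sqnorm_pos[OF assms] in \<open>auto simp: power_divide\<close>)

lemma sqnorm_uniform_limit:
  assumes lim: "uniform_limit UNIV h p sequentially" and "\<And>n. ccont (h n)" "ccont p"
  shows "(\<lambda>n. sqnorm (\<lambda>x. p x - h n x)) \<longlonglongrightarrow> 0"
proof (rule tendstoI)
  fix e :: real assume "e > 0"
  then have "sqrt (e / 2) > 0" by simp
  with lim have "\<forall>\<^sub>F n in sequentially. \<forall>x\<in>UNIV. dist (h n x) (p x) < sqrt (e / 2)"
    by (rule uniform_limitD)
  then show "\<forall>\<^sub>F n in sequentially. dist (sqnorm (\<lambda>x. p x - h n x)) 0 < e"
  proof eventually_elim
    case (elim n)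
    then have "sqnorm (\<lambda>x. p x - h n x) \<le> (sqrt (e / 2))\<^sup>2"
      using assms(2,3)
      by (intro sqnorm_le continuous_intros) (auto simp: dist_norm norm_minus_commute less_imp_le)
    then show ?case using \<open>e > 0\<close> by simp
  qed
qed

subsection \<open>Orthonormal sets and closed subspaces\<close>

definition orthonormal :: "('x \<Rightarrow> complex) set \<Rightarrow> bool" where
  "orthonormal B \<longleftrightarrow> finite B \<and> (\<forall>e\<in>B. ccont e \<and> sqnorm e = 1) \<and> pairwise (\<lambda>e e'. cinner e e' = 0) B"

definition projection :: "('x \<Rightarrow> complex) set \<Rightarrow> ('x \<Rightarrow> complex) \<Rightarrow> 'x \<Rightarrow> complex" where
  "projection B g = (\<lambda>x. \<Sum>e\<in>B. cinner g e * e x)"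

lemma orthonormalD:
  assumes "orthonormal B"
  shows "finite B" "e \<in> B \<Longrightarrow> ccont e" "e \<in> B \<Longrightarrow> sqnorm e = 1"
    "e \<in> B \<Longrightarrow> e' \<in> B \<Longrightarrow> e \<noteq> e' \<Longrightarrow> cinner e e' = 0"
  using assms by (auto simp: orthonormal_def pairwise_def)

lemma projection_continuous: "orthonormal B \<Longrightarrow> ccont (projection B g)"
  unfolding projection_def using orthonormalD(2) by (intro continuous_intros)

lemma cinner_projection:
  "orthonormal B \<Longrightarrow> ccont h \<Longrightarrow> cinner (projection B g) h = (\<Sum>e\<in>B. cinner g e * cinner e h)"
  unfolding projection_def using orthonormalD(1,2) by (intro cinner_sum_left)

lemma residual_continuous: "orthonormal B \<Longrightarrow> ccont g \<Longrightarrow> ccont (\<lambda>x. g x - projection B g x)"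
  by (intro continuous_on_diff projection_continuous)

lemma cinner_residual:
  assumes orthonormal: "orthonormal B" and g_continuous: "ccont g" and e_in_B: "e \<in> B"
  shows "cinner (\<lambda>x. g x - projection B g x) e = 0"
proof -
  have "(\<Sum>e'\<in>B. cinner g e' * cinner e' e) = (\<Sum>e'\<in>B. if e' = e then cinner g e else 0)"
    using e_in_B orthonormalD[OF orthonormal] by (intro sum.cong) (auto simp: cinner_self)
  then show ?thesis
    using e_in_B orthonormalD[OF orthonormal] g_continuous projection_continuous[OF orthonormal]
    by (simp add: cinner_diff_left cinner_projection[OF orthonormal])
qed

lemma sqnorm_residual:
  assumes orthonormal: "orthonormal B" and g_continuous: "ccont g"
  shows "sqnorm (\<lambda>x. g x - projection B g x) = sqnorm g - (\<Sum>e\<in>B. (cmod (cinner g e))\<^sup>2)"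
proof -
  let ?r = "\<lambda>x. g x - projection B g x"
  have r_continuous: "ccont ?r" by (rule residual_continuous[OF orthonormal g_continuous])
  have p_continuous: "ccont (projection B g)"
    by (rule projection_continuous[OF orthonormal])
  have "cinner (projection B g) ?r = 0"
    unfolding cinner_projection[OF orthonormal r_continuous]
    using cinner_residual[OF orthonormal g_continuous]
    by (intro sum.neutral) (simp add: cinner_commute[of _ ?r])
  then have "cinner ?r ?r = cinner g ?r"
    using cinner_diff_left[OF g_continuous p_continuous r_continuous] by simp
  also have "\<dots> = cnj (cinner ?r g)" by (rule cinner_commute)
  also have "cinner ?r g = cinner g g - (\<Sum>e\<in>B. cinner g e * cinner e g)"
    using cinner_diff_left[OF g_continuous p_continuous g_continuous]
      cinner_projection[OF orthonormal g_continuous] by simp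
  also have "(\<Sum>e\<in>B. cinner g e * cinner e g) = (\<Sum>e\<in>B. of_real ((cmod (cinner g e))\<^sup>2))"
    unfolding complex_norm_square by (intro sum.cong) (auto simp: cinner_commute[of _ g])
  finally have "complex_of_real (sqnorm ?r) = of_real (sqnorm g - (\<Sum>e\<in>B. (cmod (cinner g e))\<^sup>2))"
    by (simp add: cinner_self)
  then show ?thesis
    unfolding of_real_eq_iff .
qed

lemma Bessel_inequality:
  assumes "orthonormal B" "ccont g"
  shows "(\<Sum>e\<in>B. (cmod (cinner g e))\<^sup>2) \<le> sqnorm g"
  using sqnorm_residual[OF assms] sqnorm_nonneg[of "\<lambda>x. g x - projection B g x"] by simp

lemma cinner_Cauchy_Schwarz:
  assumes f_continuous: "ccont f" and g_continuous: "ccont g"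
  shows "cmod (cinner f g) \<le> sqrt (sqnorm f) * sqrt (sqnorm g)"
proof (cases "g = (\<lambda>_. 0)")
  case True
  then show ?thesis by (simp add: cinner_def)
next
  case False
  then obtain c where normalized: "c > 0" "sqnorm (\<lambda>x. of_real c * g x) = 1" "c\<^sup>2 * sqnorm g = 1"
    using normalize[OF g_continuous] by blast
  define e where "e = (\<lambda>x. of_real c * g x)"
  have "orthonormal {e}"
    using normalized(2) continuous_on_mult_left[OF g_continuous, of "of_real c"]
    by (simp add: orthonormal_def e_def)
  from Bessel_inequality[OF this f_continuous] have "c\<^sup>2 * (cmod (cinner f g))\<^sup>2 \<le> sqnorm f"
    by (simp add: e_def cinner_scale_right norm_mult power_mult_distrib)
  then have "(c\<^sup>2 * sqnorm g) * (cmod (cinner f g))\<^sup>2 \<le> sqnorm f * sqnorm g"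
    using mult_right_mono[OF _ sqnorm_nonneg, of _ _ g] by (metis mult.assoc mult.commute)
  then show ?thesis
    unfolding normalized(3) real_sqrt_mult[symmetric] by (intro real_le_rsqrt) simp
qed

lemma norm_integral_le_sqrt_sqnorm:
  assumes "ccont g" "continuous_on UNIV k" "\<And>y. \<bar>k y\<bar> \<le> c"
  shows "cmod (\<integral>y. of_real (k y) * g y \<partial>m) \<le> c * sqrt (sqnorm g)"
proof -
  have k_continuous: "ccont (\<lambda>y. of_real (k y))" using assms(2) by (intro continuous_intros)
  have "sqrt (sqnorm (\<lambda>y. of_real (k y))) \<le> c"
    using sqnorm_le[OF k_continuous, of c] assms(3) abs_ge_zero order_trans
    by (intro real_le_lsqrt) force+
  then have "sqrt (sqnorm g) * sqrt (sqnorm (\<lambda>y. of_real (k y))) \<le> sqrt (sqnorm g) * c"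
    by (intro mult_left_mono) auto
  with cinner_Cauchy_Schwarz[OF assms(1) k_continuous] show ?thesis
    by (simp add: cinner_def mult.commute)
qed

lemma norm_integral_le_sqrt_sqnorm_of_norm:
  assumes "ccont v"
  shows "(\<integral>x. cmod (v x) \<partial>m) \<le> sqrt (sqnorm v)"
proof -
  have "ccont (\<lambda>x. of_real (cmod (v x)))" using assms by (intro continuous_intros)
  from norm_integral_le_sqrt_sqnorm[OF this continuous_on_const, of 1 1] show ?thesis
    by (simp add: sqnorm_def)
qed

definition closed_subspace :: "('x \<Rightarrow> complex) set \<Rightarrow> bool" where
  "closed_subspace V \<longleftrightarrow> (\<forall>g\<in>V. ccont g) \<and> (\<lambda>_. 0) \<in> V \<and>
     (\<forall>f\<in>V. \<forall>g\<in>V. (\<lambda>x. f x + g x) \<in> V) \<and> (\<forall>c. \<forall>g\<in>V. (\<lambda>x. c * g x) \<in> V) \<and>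
     (\<forall>h p. (\<forall>n. h n \<in> V) \<longrightarrow> uniform_limit UNIV h p sequentially \<longrightarrow> p \<in> V)"

lemma closed_subspaceI:
  assumes "\<And>g. g \<in> V \<Longrightarrow> ccont g" "(\<lambda>_. 0) \<in> V"
    "\<And>f g. f \<in> V \<Longrightarrow> g \<in> V \<Longrightarrow> (\<lambda>x. f x + g x) \<in> V" "\<And>c g. g \<in> V \<Longrightarrow> (\<lambda>x. c * g x) \<in> V"
    "\<And>h p. (\<And>n. h n \<in> V) \<Longrightarrow> uniform_limit UNIV h p sequentially \<Longrightarrow> p \<in> V"
  shows "closed_subspace V"
  using assms unfolding closed_subspace_def by blast

context
  fixes V
  assumes closed: "closed_subspace V"
begin

lemma closed_subspace_continuous: "g \<in> V \<Longrightarrow> ccont g"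
  using closed unfolding closed_subspace_def by blast

lemma closed_subspace_zero: "(\<lambda>_. 0) \<in> V"
  using closed unfolding closed_subspace_def by blast

lemma closed_subspace_add: "f \<in> V \<Longrightarrow> g \<in> V \<Longrightarrow> (\<lambda>x. f x + g x) \<in> V"
  using closed unfolding closed_subspace_def by blast

lemma closed_subspace_scale: "g \<in> V \<Longrightarrow> (\<lambda>x. c * g x) \<in> V"
  using closed unfolding closed_subspace_def by blast

lemma closed_subspace_limit:
  "(\<And>n. h n \<in> V) \<Longrightarrow> uniform_limit UNIV h p sequentially \<Longrightarrow> p \<in> V"
  using closed unfolding closed_subspace_def by blast

lemma closed_subspace_diff: "f \<in> V \<Longrightarrow> g \<in> V \<Longrightarrow> (\<lambda>x. f x - g x) \<in> V"
  using closed_subspace_add[OF _ closed_subspace_scale[of g "-1"]] by simp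

lemma closed_subspace_projection:
  assumes "finite B" "B \<subseteq> V"
  shows "projection B g \<in> V"
  unfolding projection_def using assms
proof (induction B rule: finite_induct)
  case (insert b B)
  then show ?case by (simp add: closed_subspace_add closed_subspace_scale)
qed (simp add: closed_subspace_zero)

end

definition orthogonal_complement :: "('x \<Rightarrow> complex) set \<Rightarrow> ('x \<Rightarrow> complex) set" where
  "orthogonal_complement A = {g. ccont g \<and> (\<forall>e\<in>A. cinner g e = 0)}"

lemma closed_subspace_orthogonal_complement:
  assumes A_continuous: "\<And>e. e \<in> A \<Longrightarrow> ccont e"
  shows "closed_subspace (orthogonal_complement A)"
proof (rule closed_subspaceI)
  fix h p assume h_orthogonal: "\<And>n. h n \<in> orthogonal_complement A"
    and lim: "uniform_limit UNIV h p sequentially"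
  have h_continuous: "ccont (h n)" for n using h_orthogonal by (simp add: orthogonal_complement_def)
  then have p_continuous: "ccont p" using uniform_limit_theorem[OF _ lim] by simp
  have "cinner p e = 0" if e_in_A: "e \<in> A" for e
  proof -
    have "cmod (cinner p e) \<le> sqrt (sqnorm (\<lambda>x. p x - h n x)) * sqrt (sqnorm e)" for n
      using cinner_Cauchy_Schwarz[OF continuous_on_diff[OF p_continuous h_continuous]
        A_continuous[OF e_in_A], of n] h_orthogonal e_in_A
      by (simp add: cinner_diff_left[OF p_continuous h_continuous A_continuous[OF e_in_A]]
        orthogonal_complement_def)
    moreover have "(\<lambda>n. sqrt (sqnorm (\<lambda>x. p x - h n x)) * sqrt (sqnorm e))
      \<longlonglongrightarrow> sqrt 0 * sqrt (sqnorm e)"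
      using sqnorm_uniform_limit[OF lim h_continuous p_continuous] by (intro tendsto_intros)
    ultimately have "cmod (cinner p e) \<le> sqrt 0 * sqrt (sqnorm e)"
      by (intro LIMSEQ_le_const) auto
    then show ?thesis by simp
  qed
  with p_continuous show "p \<in> orthogonal_complement A" by (simp add: orthogonal_complement_def)
qed (use A_continuous in \<open>auto simp: orthogonal_complement_def cinner_add_left cinner_scale_left
  intro: continuous_intros\<close>)

definition orthonormal_basis :: "('x \<Rightarrow> complex) set \<Rightarrow> ('x \<Rightarrow> complex) set \<Rightarrow> bool" where
  "orthonormal_basis B V \<longleftrightarrow> orthonormal B \<and> B \<subseteq> V \<and> (\<forall>g\<in>V. projection B g = g)"

lemma orthonormal_extend:
  assumes closed: "closed_subspace V" and orthonormal: "orthonormal B" "B \<subseteq> V"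
    and g_outside: "g \<in> V" "projection B g \<noteq> g"
  obtains e where "e \<in> V" "e \<notin> B" "orthonormal (insert e B)"
proof -
  define r where "r = (\<lambda>x. g x - projection B g x)"
  have g_continuous: "ccont g" by (rule closed_subspace_continuous[OF closed g_outside(1)])
  have r_in_V: "r \<in> V" "ccont r"
    unfolding r_def
    using closed_subspace_diff[OF closed g_outside(1)
      closed_subspace_projection[OF closed orthonormalD(1)[OF orthonormal(1)] orthonormal(2)]]
      residual_continuous[OF orthonormal(1) g_continuous] by auto
  have "r \<noteq> (\<lambda>_. 0)"
    using g_outside(2) unfolding r_def fun_eq_iff by (metis eq_iff_diff_eq_0)
  obtain c where normalized: "sqnorm (\<lambda>x. complex_of_real c * r x) = 1"
    using normalize[OF r_in_V(2) \<open>r \<noteq> (\<lambda>_. 0)\<close>] by blast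
  define e where "e = (\<lambda>x. complex_of_real c * r x)"
  have e_unit: "e \<in> V" "ccont e" "sqnorm e = 1"
    using closed_subspace_scale[OF closed r_in_V(1)]
      normalized continuous_on_mult_left[OF r_in_V(2)] by (auto simp: e_def)
  have orth: "cinner e b = 0" if "b \<in> B" for b
    using cinner_residual[OF orthonormal(1) g_continuous that]
    by (simp add: e_def r_def cinner_scale_left)
  show thesis
  proof (rule that[OF e_unit(1)])
    show "e \<notin> B" using orth[of e] e_unit(3) by (auto simp: cinner_self)
    show "orthonormal (insert e B)"
      using orthonormal(1) e_unit orth cinner_commute[of _ e]
      by (auto simp: orthonormal_def pairwise_insert)
  qed
qed

lemma orthonormal_basis_of_maximal:
  assumes closed: "closed_subspace V" and orthonormal: "orthonormal B" "B \<subseteq> V"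
    and max: "\<And>B'. orthonormal B' \<Longrightarrow> B' \<subseteq> V \<Longrightarrow> card B' \<le> card B"
  shows "orthonormal_basis B V"
proof -
  have "projection B g = g" if g_in_V: "g \<in> V" for g
  proof (rule ccontr)
    assume "projection B g \<noteq> g"
    then obtain e where extended: "e \<in> V" "e \<notin> B" "orthonormal (insert e B)"
      using orthonormal_extend[OF closed orthonormal g_in_V] by blast
    with max[of "insert e B"] orthonormal show False
      by (simp add: orthonormalD(1))
  qed
  with orthonormal show ?thesis by (simp add: orthonormal_basis_def)
qed

lemma orthonormal_basis_subset:
  assumes basis: "orthonormal_basis B F" and sub: "B \<subseteq> V" "closed_subspace V"
  shows "F \<subseteq> V"
proof
  fix g assume "g \<in> F"
  then have "projection B g = g" "finite B"
    using basis by (simp_all add: orthonormal_basis_def orthonormal_def)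
  then show "g \<in> V" using closed_subspace_projection[OF sub(2) _ sub(1), of g] by simp
qed

lemma orthonormal_basis_convergent_subsequence:
  assumes basis: "orthonormal_basis B V"
    and g_bounded: "\<And>n::nat. g n \<in> V" "\<And>n. ccont (g n)" "\<And>n. sqnorm (g n) \<le> C"
  obtains r p where "strict_mono r" "uniform_limit UNIV (\<lambda>n. g (r n)) p sequentially"
proof -
  have orthonormal: "orthonormal B" and proj: "projection B (g n) = g n" for n
    using basis g_bounded(1) by (auto simp: orthonormal_basis_def)
  have coeff_le: "norm (cinner (g n) e) \<le> sqrt C" if "e \<in> B" for n e
    using cinner_Cauchy_Schwarz[OF g_bounded(2)[of n] orthonormalD(2)[OF orthonormal that]]
      g_bounded(3)[of n] orthonormalD(3)[OF orthonormal that]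
    by (simp add: order_trans)
  obtain r where r_subseq: "strict_mono r"
    and "\<And>e. e \<in> B \<Longrightarrow> \<exists>l. (\<lambda>n. cinner (g (r n)) e) \<longlonglongrightarrow> l"
    using function_convergent_subsequence[of B "\<lambda>n. cinner (g n)" "sqrt C"]
      countable_finite[OF orthonormalD(1)[OF orthonormal]] coeff_le by blast
  then obtain l where l_limit: "\<And>e. e \<in> B \<Longrightarrow> (\<lambda>n. cinner (g (r n)) e) \<longlonglongrightarrow> l e"
    by metis
  have summand: "uniform_limit UNIV (\<lambda>n x. cinner (g (r n)) e * e x) (\<lambda>x. l e * e x) sequentially"
    if e_in_B: "e \<in> B" for e
  proof (rule uniform_lim_mult)
    show "uniform_limit UNIV (\<lambda>n x. cinner (g (r n)) e) (\<lambda>_. l e) sequentially"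
      using l_limit[OF e_in_B] by (auto intro!: uniform_limitI dest: tendstoD)
    obtain M where "\<And>x. norm (e x) \<le> M"
      using continuous_on_UNIV_bounded[OF compact_UNIV orthonormalD(2)[OF orthonormal e_in_B]]
      by blast
    then show "bounded (range e)" by (auto intro: boundedI)
  qed (auto simp: image_constant_conv uniform_limit_const)
  have "uniform_limit UNIV (\<lambda>n x. \<Sum>e\<in>B. cinner (g (r n)) e * e x)
      (\<lambda>x. \<Sum>e\<in>B. l e * e x) sequentially"
    using summand by (rule uniform_limit_sum)
  then show thesis
    using that[OF r_subseq] proj unfolding projection_def by simp
qed

subsection \<open>Functionals along asymptotically orthogonal sequences\<close>

lemma sqnorm_sum_le:
  assumes finite_I: "finite I" and E_continuous: "\<And>i. i \<in> I \<Longrightarrow> ccont (E i)"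
    and c_le_1: "\<And>i. i \<in> I \<Longrightarrow> cmod (c i) \<le> 1"
    and cinner_le: "\<And>i j. i \<in> I \<Longrightarrow> j \<in> I \<Longrightarrow> cmod (cinner (E i) (E j)) \<le> (if i = j then A else 0) + d"
  shows "sqnorm (\<lambda>x. \<Sum>i\<in>I. c i * E i x) \<le> real (card I) * (A + real (card I) * d)"
proof -
  define v where "v = (\<lambda>x. \<Sum>i\<in>I. c i * E i x)"
  have v_continuous: "ccont v" unfolding v_def using E_continuous by (intro continuous_intros)
  have cinner_v: "cmod (cinner v h) \<le> (\<Sum>i\<in>I. cmod (cinner (E i) h))" if "ccont h" for h
  proof -
    have "cinner v h = (\<Sum>i\<in>I. c i * cinner (E i) h)"
      unfolding v_def by (rule cinner_sum_left[OF finite_I E_continuous that])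
    then have "cmod (cinner v h) \<le> (\<Sum>i\<in>I. cmod (c i * cinner (E i) h))"
      by (simp only: norm_sum)
    also have "\<dots> \<le> (\<Sum>i\<in>I. cmod (cinner (E i) h))"
      using c_le_1 by (intro sum_mono) (simp add: norm_mult mult_left_le_one_le)
    finally show ?thesis .
  qed
  have "cmod (cinner (E i) v) \<le> A + real (card I) * d" if i_in_I: "i \<in> I" for i
  proof -
    have "cmod (cinner (E i) v) = cmod (cinner v (E i))"
      using cinner_commute[of "E i" v] by simp
    also have "\<dots> \<le> (\<Sum>j\<in>I. cmod (cinner (E j) (E i)))" by (rule cinner_v[OF E_continuous[OF i_in_I]])
    also have "\<dots> \<le> (\<Sum>j\<in>I. (if j = i then A else 0) + d)"
      using cinner_le i_in_I by (intro sum_mono) auto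
    also have "\<dots> = A + real (card I) * d" using i_in_I finite_I by (simp add: sum.distrib)
    finally show ?thesis .
  qed
  then have "(\<Sum>i\<in>I. cmod (cinner (E i) v)) \<le> (\<Sum>i\<in>I. A + real (card I) * d)"
    by (rule sum_mono)
  moreover have "sqnorm v = cmod (cinner v v)" by (simp add: cinner_self)
  ultimately show ?thesis using cinner_v[OF v_continuous] by (simp add: v_def)
qed

lemma separated_coefficients_le:
  fixes E :: "nat \<Rightarrow> 'x \<Rightarrow> complex" and a J :: "nat \<Rightarrow> complex"
  assumes E_continuous: "\<And>n. ccont (E n)"
    and stationary: "\<And>i j. j \<le> i \<Longrightarrow> cinner (E i) (E j) = J (i - j)"
    and bounded: "\<And>c. (cmod (\<Sum>i\<in>I. c i * a i))\<^sup>2 \<le> sqnorm (\<lambda>x. \<Sum>i\<in>I. c i * E i x)"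
    and separated: "finite I" "\<And>i j. i \<in> I \<Longrightarrow> j \<in> I \<Longrightarrow> j < i \<Longrightarrow> j + M \<le> i"
    and J_small: "\<And>n. M \<le> n \<Longrightarrow> cmod (J n) \<le> d" "d \<ge> 0"
  shows "(\<Sum>i\<in>I. cmod (a i))\<^sup>2 \<le> real (card I) * (cmod (J 0) + real (card I) * d)"
proof -
  define c where "c i = cnj (sgn (a i))" for i
  have aligned: "c i * a i = of_real (cmod (a i))" "cmod (c i) \<le> 1" for i
    by (simp_all add: c_def sgn_eq norm_divide complex_norm_square[symmetric] power2_eq_square
      mult.commute)
  have off_diagonal: "cmod (cinner (E i) (E j)) \<le> d" if ij_in_I: "i \<in> I" "j \<in> I" "j < i" for i j
    using stationary[of j i] J_small(1)[of "i - j"] separated(2)[OF ij_in_I] ij_in_I(3) by simp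
  have "(\<Sum>i\<in>I. cmod (a i))\<^sup>2 = (cmod (\<Sum>i\<in>I. c i * a i))\<^sup>2"
    by (simp add: aligned flip: of_real_sum)
  also have "\<dots> \<le> sqnorm (\<lambda>x. \<Sum>i\<in>I. c i * E i x)" by (rule bounded)
  also have "\<dots> \<le> real (card I) * (cmod (J 0) + real (card I) * d)"
  proof (rule sqnorm_sum_le[OF separated(1) E_continuous aligned(2)])
    fix i j assume ij_in_I: "i \<in> I" "j \<in> I"
    consider "i = j" | "j < i" | "i < j" by linarith
    then show "cmod (cinner (E i) (E j)) \<le> (if i = j then cmod (J 0) else 0) + d"
    proof cases
      case 1
      then show ?thesis using stationary[of i i] J_small(2) by simp
    next
      case 2
      then show ?thesis using off_diagonal ij_in_I by simp
    next
      case 3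
      then show ?thesis using off_diagonal[of j i] ij_in_I cinner_commute[of "E i" "E j"] by simp
    qed
  qed
  finally show ?thesis .
qed

text \<open>If \<open>|a n| \<ge> c\<close> for infinitely many \<open>n\<close>, testing the functional on a sum of \<open>K\<close> vectors with such
  indices far apart gives \<open>K\<^sup>2 c\<^sup>2 \<le> K J(0) + K\<^sup>2 c\<^sup>2 / 2\<close>, which is absurd for large \<open>K\<close>.\<close>

theorem bounded_functional_tendsto_zero:
  fixes E :: "nat \<Rightarrow> 'x \<Rightarrow> complex" and a J :: "nat \<Rightarrow> complex"
  assumes E_continuous: "\<And>n. ccont (E n)"
    and stationary: "\<And>i j. j \<le> i \<Longrightarrow> cinner (E i) (E j) = J (i - j)"
    and J_tendsto: "J \<longlonglongrightarrow> 0"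
    and bounded: "\<And>I c. finite I \<Longrightarrow> (cmod (\<Sum>i\<in>I. c i * a i))\<^sup>2 \<le> sqnorm (\<lambda>x. \<Sum>i\<in>I. c i * E i x)"
  shows "a \<longlonglongrightarrow> 0"
proof (rule ccontr)
  assume "\<not> a \<longlonglongrightarrow> 0"
  then obtain c where c_frequently: "c > 0" "\<exists>\<^sub>F n in sequentially. c \<le> cmod (a n)"
    by (auto simp: tendsto_iff not_eventually not_less)
  have "c\<^sup>2 / 2 > 0" using c_frequently(1) by simp
  with J_tendsto have "\<forall>\<^sub>F n in sequentially. dist (J n) 0 < c\<^sup>2 / 2" by (rule tendstoD)
  then have "\<forall>\<^sub>F n in sequentially. cmod (J n) \<le> c\<^sup>2 / 2" by (rule eventually_mono) simp
  then obtain M where M_small: "\<And>n. M \<le> n \<Longrightarrow> cmod (J n) \<le> c\<^sup>2 / 2"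
    unfolding eventually_sequentially by blast
  obtain K :: nat where K_large: "2 * cmod (J 0) / c\<^sup>2 < real K" using reals_Archimedean2 by blast
  obtain I where separated: "finite I" "card I = K" "\<And>i. i \<in> I \<Longrightarrow> c \<le> cmod (a i)"
    "\<And>i j. i \<in> I \<Longrightarrow> j \<in> I \<Longrightarrow> j < i \<Longrightarrow> j + M \<le> i"
    using exists_separated_finite_set[OF c_frequently(2), of K M] by blast
  have "real K * c \<le> (\<Sum>i\<in>I. cmod (a i))"
    using sum_mono[of I "\<lambda>_. c" "\<lambda>i. cmod (a i)"] separated(2,3) by simp
  then have "(real K * c)\<^sup>2 \<le> (\<Sum>i\<in>I. cmod (a i))\<^sup>2"
    using c_frequently(1) by (intro power_mono) auto
  also have "\<dots> \<le> real K * (cmod (J 0) + real K * (c\<^sup>2 / 2))"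
    using separated_coefficients_le[OF E_continuous stationary bounded[OF separated(1)]
      separated(1) separated(4) M_small] separated(2) by simp
  finally have "real K * (real K * c\<^sup>2) \<le> real K * (cmod (J 0) + real K * (c\<^sup>2 / 2))"
    by (simp add: power_mult_distrib power2_eq_square mult_ac)
  moreover have "real K > 0"
    using K_large c_frequently(1) by (intro le_less_trans[OF _ K_large]) simp
  ultimately have "real K * c\<^sup>2 \<le> 2 * cmod (J 0)" by simp
  with K_large c_frequently(1) show False by (simp add: field_simps)
qed

end

subsection \<open>Compact symmetric operators\<close>

locale bounded_operator = full_support_space m for m :: "'x::topological_space measure" +
  fixes V :: "('x \<Rightarrow> complex) set" and S :: "('x \<Rightarrow> complex) \<Rightarrow> ('x \<Rightarrow> complex)"
  assumes closed_V: "closed_subspace V"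
    and S_in_V: "g \<in> V \<Longrightarrow> S g \<in> V"
    and S_add: "f \<in> V \<Longrightarrow> g \<in> V \<Longrightarrow> S (\<lambda>x. f x + g x) = (\<lambda>x. S f x + S g x)"
    and S_scale: "g \<in> V \<Longrightarrow> S (\<lambda>x. c * g x) = (\<lambda>x. c * S g x)"
    and S_bounded: "\<exists>C. \<forall>g\<in>V. sqnorm (S g) \<le> C * sqnorm g"
begin

lemma S_continuous: "g \<in> V \<Longrightarrow> ccont (S g)"
  using closed_subspace_continuous[OF closed_V S_in_V] .

lemma S_zero [simp]: "S (\<lambda>_. 0) = (\<lambda>_. 0)"
  using S_scale[OF closed_subspace_zero[OF closed_V], of 0] by simp

lemma S_diff: "f \<in> V \<Longrightarrow> g \<in> V \<Longrightarrow> S (\<lambda>x. f x - g x) = (\<lambda>x. S f x - S g x)"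
  using S_add[OF _ closed_subspace_scale[OF closed_V], of f g "-1"] S_scale[of g "-1"] by simp

definition unit_ball_sqnorms :: "real set" where
  "unit_ball_sqnorms = {sqnorm (S g) | g. g \<in> V \<and> sqnorm g \<le> 1}"

definition op_sqnorm :: real where
  "op_sqnorm = Sup unit_ball_sqnorms"

lemma unit_ball_sqnorms_nonempty: "unit_ball_sqnorms \<noteq> {}"
  using closed_subspace_zero[OF closed_V] by (force simp: unit_ball_sqnorms_def)

lemma unit_ball_sqnorms_bdd_above: "bdd_above unit_ball_sqnorms"
proof -
  obtain C where C_bound: "\<And>g. g \<in> V \<Longrightarrow> sqnorm (S g) \<le> C * sqnorm g"
    using S_bounded by blast
  have "sqnorm (S g) \<le> \<bar>C\<bar>" if g_unit_ball: "g \<in> V" "sqnorm g \<le> 1" for g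
  proof -
    have "sqnorm (S g) \<le> \<bar>C\<bar> * sqnorm g"
      using C_bound[OF g_unit_ball(1)] mult_right_mono[OF abs_ge_self sqnorm_nonneg, of C g]
      by linarith
    also have "\<dots> \<le> \<bar>C\<bar> * 1" using g_unit_ball(2) by (intro mult_left_mono) auto
    finally show ?thesis by simp
  qed
  then show ?thesis by (auto simp: bdd_above_def unit_ball_sqnorms_def)
qed

lemma sqnorm_S_le:
  assumes g_in_V: "g \<in> V"
  shows "sqnorm (S g) \<le> op_sqnorm * sqnorm g"
proof (cases "g = (\<lambda>_. 0)")
  case False
  then obtain c where normalized: "c > 0" "sqnorm (\<lambda>x. complex_of_real c * g x) = 1"
    "c\<^sup>2 * sqnorm g = 1"
    using normalize[OF closed_subspace_continuous[OF closed_V g_in_V]] by blast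
  have "sqnorm (S (\<lambda>x. of_real c * g x)) \<in> unit_ball_sqnorms"
    using closed_subspace_scale[OF closed_V g_in_V] normalized(2)
    by (force simp: unit_ball_sqnorms_def)
  then have "c\<^sup>2 * sqnorm (S g) \<le> op_sqnorm"
    unfolding S_scale[OF g_in_V] sqnorm_scale op_sqnorm_def
    using cSup_upper[OF _ unit_ball_sqnorms_bdd_above] by simp
  then have "c\<^sup>2 * sqnorm (S g) \<le> c\<^sup>2 * (op_sqnorm * sqnorm g)"
    using normalized(3) by (simp add: mult.left_commute)
  then show ?thesis using normalized(1) by simp
qed simp

lemma op_sqnorm_nonneg: "op_sqnorm \<ge> 0"
  unfolding op_sqnorm_def
  using closed_subspace_zero[OF closed_V]
  by (intro cSup_upper2[OF _ _ unit_ball_sqnorms_bdd_above, of 0])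
    (force simp: unit_ball_sqnorms_def)+

lemma op_sqnorm_pos:
  assumes "g \<in> V" "S g \<noteq> (\<lambda>_. 0)"
  shows "op_sqnorm > 0"
  using sqnorm_S_le[OF assms(1)] sqnorm_pos[OF S_continuous assms(2)] assms(1) op_sqnorm_nonneg
  by (cases "op_sqnorm = 0") auto

lemma eigenspace_closed: "closed_subspace {g \<in> V. S g = (\<lambda>x. a * g x)}" (is "closed_subspace ?E")
proof (rule closed_subspaceI)
  fix h p assume h_eigen: "\<And>n. h n \<in> ?E" and lim: "uniform_limit UNIV h p sequentially"
  have h_in_V: "h n \<in> V" for n using h_eigen by simp
  have p_in_V: "p \<in> V" using closed_subspace_limit[OF closed_V h_in_V lim] .
  note h_continuous = closed_subspace_continuous[OF closed_V h_in_V]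
    and p_continuous = closed_subspace_continuous[OF closed_V p_in_V]
  define d where "d n = (\<lambda>x. p x - h n x)" for n
  have d_in_V: "d n \<in> V" and d_continuous: "ccont (d n)" for n
    unfolding d_def using closed_subspace_diff[OF closed_V p_in_V h_in_V]
      closed_subspace_continuous[OF closed_V] by auto
  have "(\<lambda>x. S p x - a * p x) = (\<lambda>_. 0)"
  proof (rule zero_if_sqnorm_le_null_sequence)
    show "ccont (\<lambda>x. S p x - a * p x)"
      by (intro continuous_on_diff S_continuous p_in_V continuous_on_mult_left p_continuous)
    fix n
    have "sqnorm (\<lambda>x. S p x - a * p x) = sqnorm (\<lambda>x. S (d n) x - a * d n x)"
      using h_eigen[of n] S_diff[OF p_in_V h_in_V] by (simp add: d_def algebra_simps)
    also have "\<dots> \<le> 2 * sqnorm (S (d n)) + 2 * sqnorm (\<lambda>x. a * d n x)"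
      by (intro sqnorm_diff_le S_continuous d_in_V continuous_on_mult_left d_continuous)
    also have "\<dots> \<le> (2 * op_sqnorm + 2 * (cmod a)\<^sup>2) * sqnorm (d n)"
      using sqnorm_S_le[OF d_in_V, of n] by (simp add: sqnorm_scale algebra_simps)
    finally show "sqnorm (\<lambda>x. S p x - a * p x) \<le> (2 * op_sqnorm + 2 * (cmod a)\<^sup>2) * sqnorm (d n)" .
  next
    show "(\<lambda>n. (2 * op_sqnorm + 2 * (cmod a)\<^sup>2) * sqnorm (d n)) \<longlonglongrightarrow> 0"
      unfolding d_def
      by (intro tendsto_mult_right_zero sqnorm_uniform_limit[OF lim h_continuous p_continuous])
  qed
  with p_in_V show "p \<in> ?E" by (simp add: fun_eq_iff)
qed (auto simp: closed_subspace_continuous[OF closed_V] closed_subspace_zero[OF closed_V]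
    closed_subspace_add[OF closed_V] closed_subspace_scale[OF closed_V] S_add S_scale algebra_simps)

end

locale compact_symmetric_operator = bounded_operator +
  assumes S_symmetric: "f \<in> V \<Longrightarrow> g \<in> V \<Longrightarrow> cinner (S f) g = cinner f (S g)"
    and S_compact: "(\<And>n::nat. h n \<in> V) \<Longrightarrow> (\<And>n. sqnorm (h n) \<le> 1) \<Longrightarrow>
      \<exists>r p. strict_mono r \<and> uniform_limit UNIV (\<lambda>n. S (h (r n))) p sequentially"
begin

lemma maximizing_sequence:
  obtains g p where "\<And>n::nat. g n \<in> V" "\<And>n. sqnorm (g n) \<le> 1"
    "(\<lambda>n. sqnorm (S (g n))) \<longlonglongrightarrow> op_sqnorm" "uniform_limit UNIV (\<lambda>n. S (g n)) p sequentially"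
proof -
  have "op_sqnorm \<in> closure unit_ball_sqnorms"
    unfolding op_sqnorm_def
    by (rule closure_contains_Sup[OF unit_ball_sqnorms_nonempty unit_ball_sqnorms_bdd_above])
  then obtain t where t_tendsto: "\<And>n. t n \<in> unit_ball_sqnorms" "t \<longlonglongrightarrow> op_sqnorm"
    unfolding closure_sequential by blast
  then have "\<exists>g. g \<in> V \<and> sqnorm g \<le> 1 \<and> t n = sqnorm (S g)" for n
    using t_tendsto(1)[of n] by (auto simp: unit_ball_sqnorms_def)
  then obtain g where g_attains: "\<And>n. g n \<in> V" "\<And>n. sqnorm (g n) \<le> 1" "\<And>n. t n = sqnorm (S (g n))"
    by metis
  obtain r p where r_subseq: "strict_mono r"
    and p_limit: "uniform_limit UNIV (\<lambda>n. S (g (r n))) p sequentially"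
    using S_compact[of g, OF g_attains(1,2)] by blast
  show thesis
  proof (rule that[of "\<lambda>n. g (r n)"])
    show "(\<lambda>n. sqnorm (S (g (r n)))) \<longlonglongrightarrow> op_sqnorm"
      using LIMSEQ_subseq_LIMSEQ[OF t_tendsto(2) r_subseq] by (simp add: o_def g_attains(3))
  qed (use g_attains p_limit in auto)
qed

lemma square_residual_le:
  assumes g_unit_ball: "g \<in> V" "sqnorm g \<le> 1"
  shows "sqnorm (\<lambda>x. S (S g) x - of_real op_sqnorm * g x) \<le> op_sqnorm * (op_sqnorm - sqnorm (S g))"
proof -
  let ?s = op_sqnorm
  note g_continuous = closed_subspace_continuous[OF closed_V g_unit_ball(1)]
  have "cinner (S (S g)) (\<lambda>x. of_real ?s * g x) = of_real (?s * sqnorm (S g))"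
    using S_symmetric[OF S_in_V[OF g_unit_ball(1)] g_unit_ball(1)]
    by (simp add: cinner_scale_right cinner_self)
  then have "sqnorm (\<lambda>x. S (S g) x - of_real ?s * g x)
      = sqnorm (S (S g)) - 2 * (?s * sqnorm (S g)) + ?s\<^sup>2 * sqnorm g"
    using sqnorm_diff[OF S_continuous[OF S_in_V[OF g_unit_ball(1)]]
      continuous_on_mult_left[OF g_continuous]]
    by (simp add: sqnorm_scale)
  also have "\<dots> \<le> ?s * sqnorm (S g) - 2 * (?s * sqnorm (S g)) + ?s\<^sup>2 * 1"
    using sqnorm_S_le[OF S_in_V[OF g_unit_ball(1)]] g_unit_ball(2)
    by (intro add_mono diff_right_mono mult_left_mono) auto
  also have "\<dots> = ?s * (?s - sqnorm (S g))"
    by (simp add: power2_eq_square algebra_simps)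
  finally show ?thesis .
qed

lemma square_perturbation_le:
  assumes g_in_V: "g \<in> V" and p_in_V: "p \<in> V"
  shows "sqnorm (\<lambda>x. S (S p) x - of_real op_sqnorm * p x)
    \<le> 8 * op_sqnorm\<^sup>2 * sqnorm (\<lambda>x. p x - S g x)
      + 2 * op_sqnorm * sqnorm (\<lambda>x. S (S g) x - of_real op_sqnorm * g x)"
proof -
  let ?s = op_sqnorm
  define q where "q = (\<lambda>x. p x - S g x)"
  define d where "d = (\<lambda>x. S (S g) x - of_real ?s * g x)"
  define t where "t = (\<lambda>x. S (S q) x - of_real ?s * q x)"
  have q_in_V: "q \<in> V" and d_in_V: "d \<in> V" and t_in_V: "t \<in> V"
    unfolding t_def q_def d_def using p_in_V g_in_V
    by (auto intro!: closed_subspace_diff[OF closed_V] closed_subspace_scale[OF closed_V] S_in_V)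
  note cont = closed_subspace_continuous[OF closed_V]
  have "S d = (\<lambda>x. S (S (S g)) x - of_real ?s * S g x)"
    unfolding d_def using S_diff[OF S_in_V[OF S_in_V[OF g_in_V]]
      closed_subspace_scale[OF closed_V g_in_V]] S_scale[OF g_in_V] by simp
  moreover have "S (S q) = (\<lambda>x. S (S p) x - S (S (S g)) x)"
    unfolding q_def using S_diff p_in_V g_in_V S_in_V by simp
  ultimately have "sqnorm (\<lambda>x. S (S p) x - of_real ?s * p x) = sqnorm (\<lambda>x. t x + S d x)"
    by (simp add: t_def q_def algebra_simps)
  also have "\<dots> \<le> 2 * sqnorm t + 2 * sqnorm (S d)"
    by (intro sqnorm_add_le cont t_in_V S_in_V d_in_V)
  also have "sqnorm t \<le> 2 * sqnorm (S (S q)) + 2 * sqnorm (\<lambda>x. of_real ?s * q x)"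
    unfolding t_def by (intro sqnorm_diff_le cont S_in_V q_in_V closed_subspace_scale[OF closed_V])
  also have "sqnorm (S (S q)) \<le> ?s * (?s * sqnorm q)"
    using sqnorm_S_le[OF S_in_V[OF q_in_V]]
      mult_left_mono[OF sqnorm_S_le[OF q_in_V] op_sqnorm_nonneg]
    by (rule order_trans)
  also have "sqnorm (\<lambda>x. of_real ?s * q x) = ?s\<^sup>2 * sqnorm q"
    by (simp add: sqnorm_scale)
  also have "sqnorm (S d) \<le> ?s * sqnorm d"
    by (rule sqnorm_S_le[OF d_in_V])
  finally show ?thesis
    by (simp add: q_def d_def power2_eq_square algebra_simps)
qed

text \<open>A maximizing sequence for the norm of \<open>S\<close> on the unit ball becomes, after applying the compact
  operator \<open>S\<close>, a sequence with an eigenvector of \<open>S \<circ> S\<close> as limit point.\<close>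

lemma square_eigenvector_exists:
  assumes "g0 \<in> V" "S g0 \<noteq> (\<lambda>_. 0)"
  obtains p where "p \<in> V" "p \<noteq> (\<lambda>_. 0)" "S (S p) = (\<lambda>x. of_real op_sqnorm * p x)"
proof -
  let ?s = op_sqnorm
  obtain g p where maximizing: "\<And>n::nat. g n \<in> V" "\<And>n. sqnorm (g n) \<le> 1"
    "(\<lambda>n. sqnorm (S (g n))) \<longlonglongrightarrow> ?s"
    and lim: "uniform_limit UNIV (\<lambda>n. S (g n)) p sequentially"
    using maximizing_sequence by blast
  have p_in_V: "p \<in> V" using closed_subspace_limit[OF closed_V S_in_V[OF maximizing(1)] lim] .
  note cont = closed_subspace_continuous[OF closed_V]
  have approx: "(\<lambda>n. sqnorm (\<lambda>x. p x - S (g n) x)) \<longlonglongrightarrow> 0"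
    by (rule sqnorm_uniform_limit[OF lim S_continuous[OF maximizing(1)] cont[OF p_in_V]])
  define bound where
    "bound n = 8 * ?s\<^sup>2 * sqnorm (\<lambda>x. p x - S (g n) x) + 2 * ?s * (?s * (?s - sqnorm (S (g n))))" for n
  have "bound \<longlonglongrightarrow> 8 * ?s\<^sup>2 * 0 + 2 * ?s * (?s * (?s - ?s))"
    unfolding bound_def by (intro tendsto_intros approx maximizing(3))
  then have bound_null: "bound \<longlonglongrightarrow> 0" by simp
  have "(\<lambda>x. S (S p) x - of_real ?s * p x) = (\<lambda>_. 0)"
  proof (rule zero_if_sqnorm_le_null_sequence[OF _ _ bound_null])
    show "ccont (\<lambda>x. S (S p) x - of_real ?s * p x)"
      by (intro continuous_on_diff continuous_on_mult_left S_continuous S_in_V cont p_in_V)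
    show "sqnorm (\<lambda>x. S (S p) x - of_real ?s * p x) \<le> bound n" for n
      unfolding bound_def
      using square_perturbation_le[OF maximizing(1) p_in_V, of n] op_sqnorm_nonneg
        mult_left_mono[OF square_residual_le[OF maximizing(1,2), of n], of "2 * ?s"] by linarith
  qed
  then have "S (S p) = (\<lambda>x. of_real ?s * p x)" by (simp add: fun_eq_iff)
  moreover have "p \<noteq> (\<lambda>_. 0)"
  proof
    assume "p = (\<lambda>_. 0)"
    then have "(\<lambda>n. sqnorm (S (g n))) \<longlonglongrightarrow> 0"
      using approx by (simp add: sqnorm_def)
    with maximizing(3) have "op_sqnorm = 0" by (rule LIMSEQ_unique)
    with op_sqnorm_pos[OF assms] show False by simp
  qed
  ultimately show thesis using that p_in_V by blast
qed

theorem eigenvector_exists: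
  assumes "g0 \<in> V" "S g0 \<noteq> (\<lambda>_. 0)"
  obtains a :: real and v where "a \<noteq> 0" "v \<in> V" "v \<noteq> (\<lambda>_. 0)" "S v = (\<lambda>x. of_real a * v x)"
proof -
  obtain p where p_eigen: "p \<in> V" "p \<noteq> (\<lambda>_. 0)" "S (S p) = (\<lambda>x. of_real op_sqnorm * p x)"
    using square_eigenvector_exists[OF assms] .
  define a where "a = sqrt op_sqnorm"
  have a_root: "a > 0" "a * a = op_sqnorm" using op_sqnorm_pos[OF assms] by (auto simp: a_def)
  define v where "v = (\<lambda>x. S p x + of_real a * p x)"
  have v_in_V: "v \<in> V"
    unfolding v_def using closed_subspace_add[OF closed_V S_in_V[OF p_eigen(1)]
      closed_subspace_scale[OF closed_V p_eigen(1)]] .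
  show thesis
  proof (cases "v = (\<lambda>_. 0)")
    case True
    then have "S p x + of_real a * p x = 0" for x
      unfolding v_def by meson
    then have "S p = (\<lambda>x. of_real (-a) * p x)"
      by (simp add: fun_eq_iff eq_neg_iff_add_eq_0)
    then show ?thesis using that[of "-a" p] a_root(1) p_eigen(1,2) by simp
  next
    case False
    have "S v = (\<lambda>x. S (S p) x + of_real a * S p x)"
      unfolding v_def using S_add[OF S_in_V[OF p_eigen(1)]
        closed_subspace_scale[OF closed_V p_eigen(1)]] S_scale[OF p_eigen(1)] by simp
    also have "\<dots> = (\<lambda>x. of_real a * v x)"
      unfolding p_eigen(3) v_def a_root(2)[symmetric] by (simp add: algebra_simps)
    finally show ?thesis using that[of a v] a_root(1) v_in_V False by simp
  qed
qed

end

subsection \<open>Integral operators with continuous symmetric kernel\<close>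

locale symmetric_kernel = full_support_space m for m :: "'x::t2_space measure" +
  fixes k :: "'x \<Rightarrow> 'x \<Rightarrow> real"
  assumes k_continuous: "continuous_on UNIV (\<lambda>p. k (fst p) (snd p))"
    and k_symmetric: "k x y = k y x"
begin

definition kernel_op :: "('x \<Rightarrow> complex) \<Rightarrow> 'x \<Rightarrow> complex" where
  "kernel_op g x = (\<integral>y. of_real (k x y) * g y \<partial>m)"

lemma k_continuous_right: "continuous_on UNIV (k x)"
  using continuous_on_compose2[OF k_continuous, of UNIV "\<lambda>y. (x, y)"]
  by (simp add: continuous_on_Pair)

lemma k_bounded:
  obtains R where "R > 0" "\<And>x y. \<bar>k x y\<bar> \<le> R"
proof -
  have "compact (UNIV :: ('x \<times> 'x) set)"
    using compact_Times[OF compact_UNIV compact_UNIV] by simp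
  then obtain R where "R > 0" "\<And>p. norm (k (fst p) (snd p)) \<le> R"
    using continuous_on_UNIV_bounded[OF _ k_continuous] by blast
  then show thesis
    using that[of R] by (metis fst_conv snd_conv real_norm_def)
qed

lemma kernel_op_integrable: "ccont g \<Longrightarrow> integrable m (\<lambda>y. of_real (k x y) * g y)"
  by (intro integrable_continuous continuous_intros k_continuous_right)

lemma kernel_op_continuous:
  assumes "ccont g"
  shows "ccont (kernel_op g)"
proof -
  have "continuous_on UNIV (\<lambda>p. of_real (k (fst p) (snd p)) * g (snd p))"
    by (intro continuous_on_mult continuous_on_of_real k_continuous
        continuous_on_compose2[OF assms continuous_on_snd]) (auto intro: continuous_on_id)
  then show ?thesis
    unfolding kernel_op_def[abs_def] by (rule continuous_on_integral_parameter)
qed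

lemma kernel_op_eq_cinner: "kernel_op g x = cinner g (\<lambda>y. of_real (k x y))"
  by (simp add: kernel_op_def cinner_def mult.commute)

lemma kernel_op_add:
  "ccont g \<Longrightarrow> ccont h \<Longrightarrow> kernel_op (\<lambda>x. g x + h x) = (\<lambda>x. kernel_op g x + kernel_op h x)"
  using kernel_op_integrable by (auto simp: fun_eq_iff kernel_op_def distrib_left)

lemma kernel_op_scale: "kernel_op (\<lambda>x. c * g x) = (\<lambda>x. c * kernel_op g x)"
  by (simp add: fun_eq_iff kernel_op_def mult.left_commute[of _ c])

lemma norm_kernel_op_le:
  assumes "ccont g" "\<And>x y. \<bar>k x y\<bar> \<le> R"
  shows "cmod (kernel_op g x) \<le> R * sqrt (sqnorm g)"
  unfolding kernel_op_def using assms by (intro norm_integral_le_sqrt_sqnorm k_continuous_right)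

lemma sqnorm_kernel_op_le:
  assumes "ccont g" "\<And>x y. \<bar>k x y\<bar> \<le> R"
  shows "sqnorm (kernel_op g) \<le> R\<^sup>2 * sqnorm g"
  using sqnorm_le[OF kernel_op_continuous norm_kernel_op_le, OF assms(1) assms]
  by (simp add: power_mult_distrib)

lemma dist_kernel_op_le:
  assumes "ccont g" "\<And>y. dist (k x y) (k x' y) \<le> e"
  shows "dist (kernel_op g x) (kernel_op g x') \<le> e * sqrt (sqnorm g)"
proof -
  have "kernel_op g x - kernel_op g x' = (\<integral>y. of_real (k x y - k x' y) * g y \<partial>m)"
    using kernel_op_integrable[OF assms(1)] by (simp add: kernel_op_def left_diff_distrib)
  moreover have "cmod (\<integral>y. of_real (k x y - k x' y) * g y \<partial>m) \<le> e * sqrt (sqnorm g)"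
    using assms(2) by (intro norm_integral_le_sqrt_sqnorm assms(1) continuous_intros
      k_continuous_right)
      (simp add: dist_real_def)
  ultimately show ?thesis by (simp add: dist_norm)
qed

lemma kernel_op_equicontinuous:
  assumes g_bounded: "\<And>i. i \<in> I \<Longrightarrow> ccont (g i)" "\<And>i. i \<in> I \<Longrightarrow> sqnorm (g i) \<le> C"
  shows "equicontinuous I (\<lambda>i. kernel_op (g i))"
  unfolding equicontinuous_def
proof (intro allI impI)
  fix x and e :: real assume "e > 0"
  define d where "d = e / (sqrt \<bar>C\<bar> + 1)"
  have pos: "sqrt \<bar>C\<bar> + 1 > 0" by (simp add: add_nonneg_pos)
  then have "d > 0" "d * (sqrt \<bar>C\<bar> + 1) = e"
    using \<open>e > 0\<close> by (auto simp: d_def)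
  then have d_small: "d > 0" "d * sqrt \<bar>C\<bar> < e" by (auto simp: distrib_left)
  have "\<forall>\<^sub>F y in nhds x. \<forall>z\<in>UNIV. dist (k y z) (k x z) < d"
    using continuous_imp_uniform_limit_nhds[OF compact_UNIV k_continuous] d_small(1)
    by (rule uniform_limitD)
  then show "\<forall>\<^sub>F y in nhds x. \<forall>i\<in>I. dist (kernel_op (g i) y) (kernel_op (g i) x) < e"
  proof eventually_elim
    case (elim y)
    have "dist (kernel_op (g i) y) (kernel_op (g i) x) < e" if i_in_I: "i \<in> I" for i
    proof -
      have "dist (kernel_op (g i) y) (kernel_op (g i) x) \<le> d * sqrt (sqnorm (g i))"
        using elim by (intro dist_kernel_op_le g_bounded(1)[OF i_in_I]) (simp add: less_imp_le)
      also have "\<dots> \<le> d * sqrt \<bar>C\<bar>"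
        using d_small(1) g_bounded(2)[OF i_in_I] by (intro mult_left_mono) auto
      finally show ?thesis using d_small(2) by simp
    qed
    then show ?case by blast
  qed
qed

lemma kernel_op_compact:
  assumes g_bounded: "\<And>n::nat. ccont (g n)" "\<And>n. sqnorm (g n) \<le> C"
  shows "\<exists>r p. strict_mono r \<and> uniform_limit UNIV (\<lambda>n. kernel_op (g (r n))) p sequentially"
proof -
  obtain R where R_bound: "R > 0" "\<And>x y. \<bar>k x y\<bar> \<le> R" using k_bounded by blast
  have bounded: "cmod (kernel_op (g n) x) \<le> R * sqrt C" for n x
    using norm_kernel_op_le[OF g_bounded(1) R_bound(2), of n x]
      mult_left_mono[OF real_sqrt_le_mono[OF g_bounded(2)[of n]], of R] R_bound(1)
    by linarith
  have "equicontinuous UNIV (\<lambda>n. kernel_op (g n))"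
    by (rule kernel_op_equicontinuous[OF g_bounded])
  from equicontinuous_bounded_convergent_subsequence[OF compact_UNIV this bounded] show ?thesis
    by blast
qed

lemma kernel_op_symmetric:
  assumes g_continuous: "ccont g" and h_continuous: "ccont h"
  shows "cinner (kernel_op g) h = cinner g (kernel_op h)"
proof -
  have prob: "compact_prob_space m" by unfold_locales
  define K where "K p = cnj (h (fst p)) * (of_real (k (fst p) (snd p)) * g (snd p))" for p
  have "continuous_on UNIV K"
    unfolding K_def
    by (intro continuous_on_mult continuous_on_cnj continuous_on_of_real k_continuous
        continuous_on_compose2[OF g_continuous continuous_on_snd]
          continuous_on_compose2[OF h_continuous continuous_on_fst])
      (auto intro: continuous_on_id)
  then have "(\<integral>x. \<integral>y. K (x, y) \<partial>m \<partial>m) = (\<integral>y. \<integral>x. K (x, y) \<partial>m \<partial>m)"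
    by (rule continuous_Fubini[OF prob prob])
  moreover have "(\<integral>y. K (x, y) \<partial>m) = kernel_op g x * cnj (h x)" for x
    by (simp add: K_def kernel_op_def)
  moreover have "(\<integral>x. K (x, y) \<partial>m) = g y * cnj (kernel_op h y)" for y
  proof -
    have "(\<integral>x. K (x, y) \<partial>m) = g y * (\<integral>x. of_real (k y x) * cnj (h x) \<partial>m)"
      by (simp add: K_def k_symmetric[of y] mult_ac)
    also have "(\<integral>x. of_real (k y x) * cnj (h x) \<partial>m) = cnj (cinner h (\<lambda>x. of_real (k y x)))"
      unfolding cinner_commute[of "\<lambda>x. of_real (k y x)" h, symmetric] by (simp add: cinner_def)
    finally show ?thesis by (simp add: kernel_op_eq_cinner)
  qed
  ultimately show ?thesis by (simp add: cinner_def)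
qed

lemma kernel_op_compact_symmetric_operator:
  assumes closed: "closed_subspace V" and inv: "\<And>g. g \<in> V \<Longrightarrow> kernel_op g \<in> V"
  shows "compact_symmetric_operator m V kernel_op"
proof unfold_locales
  note cont = closed_subspace_continuous[OF closed]
  show "closed_subspace V" by (rule closed)
  obtain R where "\<And>x y. \<bar>k x y\<bar> \<le> R" using k_bounded by blast
  then show "\<exists>C. \<forall>g\<in>V. sqnorm (kernel_op g) \<le> C * sqnorm g"
    using sqnorm_kernel_op_le[OF cont] by blast
  show "\<exists>r p. strict_mono r \<and> uniform_limit UNIV (\<lambda>n. kernel_op (h (r n))) p sequentially"
    if "\<And>n::nat. h n \<in> V" "\<And>n. sqnorm (h n) \<le> 1" for h
    using kernel_op_compact[of h 1] cont that by blast
qed (use inv kernel_op_add kernel_op_scale kernel_op_symmetric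
  closed_subspace_continuous[OF closed] in auto)

lemma eigenvectors_sum_le:
  fixes a :: real
  assumes eigenvectors: "orthonormal B" "\<And>e. e \<in> B \<Longrightarrow> kernel_op e = (\<lambda>x. of_real a * e x)"
    and R_bound: "\<And>x y. \<bar>k x y\<bar> \<le> R"
  shows "(\<Sum>e\<in>B. a\<^sup>2 * (cmod (e x))\<^sup>2) \<le> R\<^sup>2"
proof -
  define kx where "kx = (\<lambda>y. complex_of_real (k x y))"
  have cont: "ccont kx"
    unfolding kx_def by (intro continuous_intros k_continuous_right)
  have "(cmod (cinner kx e))\<^sup>2 = a\<^sup>2 * (cmod (e x))\<^sup>2" if "e \<in> B" for e
  proof -
    have "cmod (cinner kx e) = cmod (kernel_op e x)"
      using cinner_commute[of kx e] by (simp add: kernel_op_eq_cinner kx_def)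
    also have "\<dots> = \<bar>a\<bar> * cmod (e x)"
      by (simp add: eigenvectors(2)[OF that] norm_mult)
    finally show ?thesis by (simp add: power_mult_distrib)
  qed
  then have "(\<Sum>e\<in>B. a\<^sup>2 * (cmod (e x))\<^sup>2) = (\<Sum>e\<in>B. (cmod (cinner kx e))\<^sup>2)"
    by simp
  also have "\<dots> \<le> sqnorm kx" by (rule Bessel_inequality[OF eigenvectors(1) cont])
  also have "\<dots> \<le> R\<^sup>2" using R_bound by (intro sqnorm_le cont) (simp add: kx_def)
  finally show ?thesis .
qed

lemma eigenvectors_card_le:
  fixes a :: real
  assumes eigenvectors: "orthonormal B" "\<And>e. e \<in> B \<Longrightarrow> kernel_op e = (\<lambda>x. of_real a * e x)"
    and R_bound: "\<And>x y. \<bar>k x y\<bar> \<le> R"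
  shows "real (card B) * a\<^sup>2 \<le> R\<^sup>2"
proof -
  note cont = orthonormalD(2)[OF eigenvectors(1)]
  have "real (card B) * a\<^sup>2 = (\<Sum>e\<in>B. a\<^sup>2 * sqnorm e)"
    using orthonormalD(3)[OF eigenvectors(1)] by simp
  also have "\<dots> = (\<integral>x. (\<Sum>e\<in>B. a\<^sup>2 * (cmod (e x))\<^sup>2) \<partial>m)"
    using sqnorm_integrable cont by (simp add: sqnorm_def Bochner_Integration.integral_sum)
  also have "\<dots> \<le> (\<integral>x. R\<^sup>2 \<partial>m)"
    using eigenvectors_sum_le[OF eigenvectors R_bound] cont
    by (intro integral_mono integrable_continuous continuous_intros)
  finally show ?thesis by simp
qed

lemma eigenspace_finite_dimensional:
  fixes a :: real
  assumes "a \<noteq> 0"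
  obtains n where "\<And>B. orthonormal B \<Longrightarrow> B \<subseteq> {g. kernel_op g = (\<lambda>x. of_real a * g x)} \<Longrightarrow> card B \<le> n"
proof -
  obtain R where R_bound: "\<And>x y. \<bar>k x y\<bar> \<le> R" using k_bounded by blast
  have "card B \<le> nat \<lfloor>R\<^sup>2 / a\<^sup>2\<rfloor>"
    if "orthonormal B" "B \<subseteq> {g. kernel_op g = (\<lambda>x. of_real a * g x)}" for B
  proof -
    have "real (card B) * a\<^sup>2 \<le> R\<^sup>2"
      using that by (intro eigenvectors_card_le R_bound) auto
    then have "real (card B) \<le> R\<^sup>2 / a\<^sup>2"
      using assms by (simp add: field_simps)
    then show ?thesis by (simp add: le_nat_floor)
  qed
  then show thesis by (rule that)
qed

end

subsection \<open>Eigenfunctions of commuting measure-preserving transformations\<close>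

locale commuting_transformations = full_support_space m for m :: "'x::topological_space measure" +
  fixes Z :: "('x \<Rightarrow> 'x) set"
  assumes Z_continuous: "z \<in> Z \<Longrightarrow> continuous_on UNIV z"
    and Z_id: "(\<lambda>x. x) \<in> Z"
    and Z_comp: "z \<in> Z \<Longrightarrow> w \<in> Z \<Longrightarrow> (\<lambda>x. z (w x)) \<in> Z"
    and Z_inverse: "z \<in> Z \<Longrightarrow> \<exists>w\<in>Z. (\<forall>x. z (w x) = x) \<and> (\<forall>x. w (z x) = x)"
    and Z_commute: "z \<in> Z \<Longrightarrow> w \<in> Z \<Longrightarrow> z (w x) = w (z x)"
    and Z_measure_preserving: "\<And>g :: 'x \<Rightarrow> complex. z \<in> Z \<Longrightarrow> ccont g \<Longrightarrow> (\<integral>x. g (z x) \<partial>m)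
      = (\<integral>x. g x \<partial>m)"
begin

definition eigenfunction :: "('x \<Rightarrow> complex) \<Rightarrow> bool" where
  "eigenfunction e \<longleftrightarrow> ccont e \<and> (\<forall>z\<in>Z. \<exists>c. \<forall>x. e (z x) = c * e x)"

definition eigenvalue :: "('x \<Rightarrow> complex) \<Rightarrow> ('x \<Rightarrow> 'x) \<Rightarrow> complex" where
  "eigenvalue e z = (SOME c. \<forall>x. e (z x) = c * e x)"

definition invariant_subspace :: "('x \<Rightarrow> complex) set \<Rightarrow> bool" where
  "invariant_subspace F \<longleftrightarrow> closed_subspace F \<and> (\<forall>z\<in>Z. \<forall>g\<in>F. (\<lambda>x. g (z x)) \<in> F)"

lemma continuous_compose_Z: "z \<in> Z \<Longrightarrow> ccont g \<Longrightarrow> ccont (\<lambda>x. g (z x))"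
  by (rule continuous_on_compose2[of UNIV g UNIV z]) (auto intro: Z_continuous)

lemma cinner_compose_Z:
  assumes inverse: "z \<in> Z" "w \<in> Z" "\<And>x. w (z x) = x" and fg_continuous: "ccont f" "ccont g"
  shows "cinner (\<lambda>x. f (z x)) g = cinner f (\<lambda>x. g (w x))"
proof -
  have "ccont (\<lambda>x. f x * cnj (g (w x)))"
    using fg_continuous(1) continuous_compose_Z[OF inverse(2) fg_continuous(2)]
    by (rule continuous_on_mult[OF _ continuous_on_cnj])
  then have "cinner f (\<lambda>x. g (w x)) = (\<integral>x. f (z x) * cnj (g (w (z x))) \<partial>m)"
    unfolding cinner_def by (rule Z_measure_preserving[OF inverse(1), symmetric])
  then show ?thesis using inverse(3) by (simp add: cinner_def)
qed

lemma sqnorm_compose_Z: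
  assumes z_in_Z: "z \<in> Z" and f_continuous: "ccont f"
  shows "sqnorm (\<lambda>x. f (z x)) = sqnorm f"
proof -
  have "complex_of_real (sqnorm (\<lambda>x. f (z x))) = of_real (sqnorm f)"
    unfolding cinner_self[symmetric] cinner_def
    using Z_measure_preserving[OF z_in_Z, of "\<lambda>x. f x * cnj (f x)"] f_continuous
    by (simp add: continuous_intros)
  then show ?thesis unfolding of_real_eq_iff .
qed

lemma eigenfunction_continuous: "eigenfunction e \<Longrightarrow> ccont e"
  by (simp add: eigenfunction_def)

lemma eigenfunction_apply:
  assumes "eigenfunction e" "z \<in> Z"
  shows "e (z x) = eigenvalue e z * e x"
proof -
  have "\<exists>c. \<forall>x. e (z x) = c * e x"
    using assms unfolding eigenfunction_def by blast
  from someI_ex[OF this] show ?thesis unfolding eigenvalue_def by blast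
qed

lemma norm_eigenvalue:
  assumes eigen: "eigenfunction e" "e \<noteq> (\<lambda>_. 0)" and z_in_Z: "z \<in> Z"
  shows "cmod (eigenvalue e z) = 1"
proof -
  note cont = eigenfunction_continuous[OF eigen(1)]
  have "(cmod (eigenvalue e z))\<^sup>2 * sqnorm e = sqnorm e"
    using sqnorm_compose_Z[OF z_in_Z cont]
    unfolding eigenfunction_apply[OF eigen(1) z_in_Z] sqnorm_scale .
  then have "(cmod (eigenvalue e z))\<^sup>2 = 1\<^sup>2"
    using sqnorm_pos[OF cont eigen(2)] by simp
  then show ?thesis by (rule power2_eq_imp_eq) auto
qed

lemma eigenfunction_cnj: "eigenfunction e \<Longrightarrow> eigenfunction (\<lambda>x. cnj (e x))"
  unfolding eigenfunction_def
  by (metis complex_cnj_mult continuous_on_cnj)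

lemma eigenfunction_mult:
  assumes "eigenfunction e" "eigenfunction e'"
  shows "eigenfunction (\<lambda>x. e x * e' x)"
  unfolding eigenfunction_def
proof (intro conjI ballI)
  show "ccont (\<lambda>x. e x * e' x)"
    using assms by (intro continuous_on_mult eigenfunction_continuous)
  fix z assume "z \<in> Z"
  then have "e (z x) * e' (z x) = (eigenvalue e z * eigenvalue e' z) * (e x * e' x)" for x
    using assms by (simp add: eigenfunction_apply)
  then show "\<exists>c. \<forall>x. e (z x) * e' (z x) = c * (e x * e' x)" by blast
qed

lemma eigenfunction_const: "eigenfunction (\<lambda>_. c)"
  unfolding eigenfunction_def by (auto intro: exI[of _ 1])

lemma invariant_subspace_eigenfunctions_complement:
  "invariant_subspace (orthogonal_complement {e. eigenfunction e})"
  unfolding invariant_subspace_def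
proof (intro conjI ballI)
  show "closed_subspace (orthogonal_complement {e. eigenfunction e})"
    by (rule closed_subspace_orthogonal_complement) (simp add: eigenfunction_continuous)
  fix z g assume z_in_Z: "z \<in> Z" and g_orthogonal: "g \<in> orthogonal_complement {e. eigenfunction e}"
  obtain w where w_inverse: "w \<in> Z" "\<And>x. w (z x) = x" using Z_inverse[OF z_in_Z] by blast
  have g_continuous: "ccont g" using g_orthogonal by (simp add: orthogonal_complement_def)
  have "cinner (\<lambda>x. g (z x)) e = 0" if eigen: "eigenfunction e" for e
  proof -
    have "cinner (\<lambda>x. g (z x)) e = cinner g (\<lambda>x. e (w x))"
      by (rule cinner_compose_Z[OF z_in_Z w_inverse g_continuous
        eigenfunction_continuous[OF eigen]])
    also have "\<dots> = cnj (eigenvalue e w) * cinner g e"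
      unfolding eigenfunction_apply[OF eigen w_inverse(1)] by (rule cinner_scale_right)
    finally show ?thesis using g_orthogonal eigen by (simp add: orthogonal_complement_def)
  qed
  with continuous_compose_Z[OF z_in_Z g_continuous]
    show "(\<lambda>x. g (z x)) \<in> orthogonal_complement {e. eigenfunction e}"
    by (simp add: orthogonal_complement_def)
qed

definition minimal_invariant_subspace :: "('x \<Rightarrow> complex) set \<Rightarrow> bool" where
  "minimal_invariant_subspace F \<longleftrightarrow> invariant_subspace F \<and> F \<noteq> {\<lambda>_. 0} \<and>
     (\<forall>F'\<subseteq>F. invariant_subspace F' \<longrightarrow> F' \<noteq> {\<lambda>_. 0} \<longrightarrow> F' = F)"

lemma minimal_invariant_subspace_exists:
  assumes E_invariant: "invariant_subspace E" "E \<noteq> {\<lambda>_. 0}"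
    and finite_dim: "\<And>B. orthonormal B \<Longrightarrow> B \<subseteq> E \<Longrightarrow> card B \<le> n"
  obtains F B where "F \<subseteq> E" "minimal_invariant_subspace F" "orthonormal_basis B F"
proof -
  define dimension_le where "dimension_le F k \<longleftrightarrow> (\<forall>B. orthonormal B \<longrightarrow> B \<subseteq> F \<longrightarrow> card B \<le> k)"
    for F and k :: nat
  define candidate where "candidate F \<longleftrightarrow> F \<subseteq> E \<and> invariant_subspace F \<and> F \<noteq> {\<lambda>_. 0}" for F
  have "\<exists>F. candidate F \<and> dimension_le F n"
    using E_invariant finite_dim by (auto simp: candidate_def dimension_le_def)
  then obtain k where "\<exists>F. candidate F \<and> dimension_le F k"
    and least: "\<And>j. j < k \<Longrightarrow> \<not> (\<exists>F. candidate F \<and> dimension_le F j)"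
    using exists_least_iff[of "\<lambda>k. \<exists>F. candidate F \<and> dimension_le F k"] by blast
  then obtain F where F_least: "candidate F" "dimension_le F k" by blast
  have basis: "\<exists>B\<subseteq>F'. orthonormal_basis B F" if F'_sub: "F' \<subseteq> F" "candidate F'" for F'
  proof -
    have "\<exists>B\<subseteq>F'. orthonormal B \<and> k \<le> card B"
    proof (cases k)
      case 0
      then show ?thesis by (intro exI[of _ "{}"]) (simp add: orthonormal_def)
    next
      case (Suc j)
      with least[of j] F'_sub(2) have "\<not> dimension_le F' j" by blast
      then show ?thesis using Suc by (auto simp: dimension_le_def not_le)
    qed
    then obtain B where B_sub: "B \<subseteq> F'" "orthonormal B" "k \<le> card B" by blast
    have "orthonormal_basis B F"
      using F_least B_sub F'_sub(1)
      by (intro orthonormal_basis_of_maximal)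
        (auto simp: candidate_def invariant_subspace_def dimension_le_def intro: order_trans)
    with B_sub(1) show ?thesis by blast
  qed
  have "F' = F" if F'_sub: "F' \<subseteq> F" "invariant_subspace F'" "F' \<noteq> {\<lambda>_. 0}" for F'
  proof
    have "candidate F'" using F'_sub F_least(1) by (auto simp: candidate_def)
    then obtain B where "B \<subseteq> F'" "orthonormal_basis B F" using basis[OF F'_sub(1)] by blast
    moreover have "closed_subspace F'" using F'_sub(2) by (simp add: invariant_subspace_def)
    ultimately show "F \<subseteq> F'" using orthonormal_basis_subset by blast
  qed (rule F'_sub(1))
  then have "minimal_invariant_subspace F"
    using F_least(1) by (auto simp: minimal_invariant_subspace_def candidate_def)
  moreover obtain B where "orthonormal_basis B F" using basis F_least(1) by blast
  ultimately show thesis using that F_least(1) by (auto simp: candidate_def)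
qed

text \<open>By minimality, since the eigenspaces of an operator commuting with \<open>Z\<close> are again invariant.\<close>

lemma symmetric_operator_scalar:
  assumes minimal: "minimal_invariant_subspace F"
    and compact_symmetric: "compact_symmetric_operator m F S"
    and commute: "\<And>z g. z \<in> Z \<Longrightarrow> g \<in> F \<Longrightarrow> S (\<lambda>x. g (z x)) = (\<lambda>x. S g (z x))"
  obtains l :: real where "\<And>g. g \<in> F \<Longrightarrow> S g = (\<lambda>x. of_real l * g x)"
proof (cases "\<forall>g\<in>F. S g = (\<lambda>_. 0)")
  case True
  then show ?thesis using that[of 0] by simp
next
  case False
  interpret S: compact_symmetric_operator m F S by (rule compact_symmetric)
  obtain l :: real and v where v_eigen: "v \<in> F" "v \<noteq> (\<lambda>_. 0)" "S v = (\<lambda>x. of_real l * v x)"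
    using False S.eigenvector_exists by metis
  let ?F' = "{g \<in> F. S g = (\<lambda>x. of_real l * g x)}"
  have "invariant_subspace ?F'"
    using S.eigenspace_closed minimal commute
    by (simp add: invariant_subspace_def minimal_invariant_subspace_def)
  moreover have "v \<in> ?F'" using v_eigen by simp
  with v_eigen(2) have "?F' \<noteq> {\<lambda>_. 0}" by auto
  ultimately have "?F' = F"
    using minimal by (simp add: minimal_invariant_subspace_def)
  then show ?thesis using that[of l] by auto
qed

text \<open>The real and imaginary parts of a translation, up to a factor: for \<open>c = 1\<close> and \<open>c = \<i>\<close>
  these symmetric operators determine the translation by \<open>z\<close>.\<close>

definition symmetrized_transl ::
    "complex \<Rightarrow> ('x \<Rightarrow> 'x) \<Rightarrow> ('x \<Rightarrow> 'x) \<Rightarrow> ('x \<Rightarrow> complex) \<Rightarrow> 'x \<Rightarrow> complex" where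
  "symmetrized_transl c z w g = (\<lambda>x. c * g (z x) + cnj c * g (w x))"

context
  fixes z w
  assumes z_in_Z: "z \<in> Z" and w_in_Z: "w \<in> Z" and inverse: "\<And>x. z (w x) = x" "\<And>x. w (z x) = x"
begin

lemma symmetrized_transl_symmetric:
  assumes "ccont f" "ccont g"
  shows "cinner (symmetrized_transl c z w f) g = cinner f (symmetrized_transl c z w g)"
proof -
  have cont: "ccont (\<lambda>x. b * h (y x))" if "y \<in> Z" "ccont h" for b y h
    using that by (rule continuous_on_mult_left[OF continuous_compose_Z])
  have "cinner (symmetrized_transl c z w f) g
      = c * cinner (\<lambda>x. f (z x)) g + cnj c * cinner (\<lambda>x. f (w x)) g"
    unfolding symmetrized_transl_def using z_in_Z w_in_Z assms
    by (simp add: cinner_add_left cont cinner_scale_left)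
  also have "\<dots> = c * cinner f (\<lambda>x. g (w x)) + cnj c * cinner f (\<lambda>x. g (z x))"
    using cinner_compose_Z[OF z_in_Z w_in_Z inverse(2) assms]
      cinner_compose_Z[OF w_in_Z z_in_Z inverse(1) assms] by simp
  also have "\<dots> = cinner f (symmetrized_transl c z w g)"
    unfolding symmetrized_transl_def using z_in_Z w_in_Z assms
    by (simp add: cinner_add_right cont cinner_scale_right)
  finally show ?thesis .
qed

lemma sqnorm_symmetrized_transl_le:
  assumes "ccont g"
  shows "sqnorm (symmetrized_transl c z w g) \<le> 4 * (cmod c)\<^sup>2 * sqnorm g"
proof -
  have "sqnorm (symmetrized_transl c z w g) \<le> 2 * sqnorm (\<lambda>x. c * g (z x))
    + 2 * sqnorm (\<lambda>x. cnj c * g (w x))"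
    unfolding symmetrized_transl_def
    using continuous_compose_Z[OF z_in_Z assms] continuous_compose_Z[OF w_in_Z assms]
    by (intro sqnorm_add_le continuous_on_mult_left)
  also have "\<dots> = 4 * (cmod c)\<^sup>2 * sqnorm g"
    using z_in_Z w_in_Z assms by (simp add: sqnorm_scale sqnorm_compose_Z)
  finally show ?thesis .
qed

lemma symmetrized_transl_compact_symmetric_operator:
  assumes invariant: "invariant_subspace F" and basis: "orthonormal_basis B F"
  shows "compact_symmetric_operator m F (symmetrized_transl c z w)"
proof unfold_locales
  let ?S = "symmetrized_transl c z w"
  show closed: "closed_subspace F" using invariant by (simp add: invariant_subspace_def)
  note cont = closed_subspace_continuous[OF closed]
  have F_Z: "(\<lambda>x. g (y x)) \<in> F" if "y \<in> Z" "g \<in> F" for y g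
    using invariant that unfolding invariant_subspace_def by blast
  show S_F: "?S g \<in> F" if "g \<in> F" for g
    unfolding symmetrized_transl_def
    using F_Z[OF z_in_Z that] F_Z[OF w_in_Z that]
    by (rule closed_subspace_add[OF closed closed_subspace_scale[OF closed]
      closed_subspace_scale[OF closed]])
  show "\<exists>C. \<forall>g\<in>F. sqnorm (?S g) \<le> C * sqnorm g"
    using sqnorm_symmetrized_transl_le[OF cont] by blast
  show "cinner (?S f) g = cinner f (?S g)" if "f \<in> F" "g \<in> F" for f g
    using symmetrized_transl_symmetric[OF cont[OF that(1)] cont[OF that(2)]] .
  show "\<exists>r p. strict_mono r \<and> uniform_limit UNIV (\<lambda>n. ?S (h (r n))) p sequentially"
    if h_bounded: "\<And>n::nat. h n \<in> F" "\<And>n. sqnorm (h n) \<le> 1" for h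
  proof -
    have "sqnorm (?S (h n)) \<le> 4 * (cmod c)\<^sup>2" for n
      using sqnorm_symmetrized_transl_le[OF cont[OF h_bounded(1)], of c n] h_bounded(2)[of n]
        mult_left_mono[of "sqnorm (h n)" 1 "4 * (cmod c)\<^sup>2"] by simp
    then obtain r p where "strict_mono r" "uniform_limit UNIV (\<lambda>n. ?S (h (r n))) p sequentially"
      by (rule orthonormal_basis_convergent_subsequence[OF basis S_F[OF h_bounded(1)]
        cont[OF S_F[OF h_bounded(1)]]])
    then show ?thesis by blast
  qed
qed (auto simp: symmetrized_transl_def algebra_simps)

end

lemma minimal_invariant_subspace_eigenfunction:
  assumes minimal: "minimal_invariant_subspace F" and basis: "orthonormal_basis B F"
    and g_in_F: "g \<in> F"
  shows "eigenfunction g"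
  unfolding eigenfunction_def
proof (intro conjI ballI)
  have inv: "invariant_subspace F"
    using minimal by (simp add: minimal_invariant_subspace_def)
  then show "ccont g"
    unfolding invariant_subspace_def using closed_subspace_continuous g_in_F by blast
  fix z assume z_in_Z: "z \<in> Z"
  obtain w where w_inverse: "w \<in> Z" "\<And>x. z (w x) = x" "\<And>x. w (z x) = x"
    using Z_inverse[OF z_in_Z] by blast
  have scalar: "\<exists>l::real. \<forall>x. c * g (z x) + cnj c * g (w x) = of_real l * g x" for c
  proof -
    have "compact_symmetric_operator m F (symmetrized_transl c z w)"
      by (rule symmetrized_transl_compact_symmetric_operator[OF z_in_Z w_inverse inv basis])
    moreover have "symmetrized_transl c z w (\<lambda>x. h (y x)) = (\<lambda>x. symmetrized_transl c z w h (y x))"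
      if "y \<in> Z" for y h
      using Z_commute[OF that z_in_Z] Z_commute[OF that w_inverse(1)]
      by (simp add: symmetrized_transl_def)
    ultimately obtain l :: real where "symmetrized_transl c z w g = (\<lambda>x. of_real l * g x)"
      using symmetric_operator_scalar[OF minimal] g_in_F by metis
    then show ?thesis by (auto simp: symmetrized_transl_def fun_eq_iff)
  qed
  obtain a b :: real where
    sum_eq: "\<And>x. g (z x) + g (w x) = of_real a * g x"
      and diff_eq: "\<And>x. \<i> * g (z x) - \<i> * g (w x) = of_real b * g x"
    using scalar[of 1] scalar[of \<i>] by auto
  have "g (z x) = (of_real a - \<i> * of_real b) / 2 * g x" for x
  proof -
    have "2 * g (z x) = (g (z x) + g (w x)) - \<i> * (\<i> * g (z x) - \<i> * g (w x))"
      by (simp add: algebra_simps)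
    then show ?thesis
      unfolding sum_eq diff_eq by (simp add: field_simps)
  qed
  then show "\<exists>c. \<forall>x. g (z x) = c * g x" by blast
qed

end

locale invariant_kernel =
  commuting_transformations m Z + symmetric_kernel m k
  for m :: "'x::t2_space measure" and Z k +
  assumes k_invariant: "z \<in> Z \<Longrightarrow> k (z x) (z y) = k x y"
begin

lemma kernel_op_compose_Z:
  assumes "z \<in> Z" "ccont g"
  shows "kernel_op (\<lambda>x. g (z x)) = (\<lambda>x. kernel_op g (z x))"
proof
  fix x
  have "kernel_op g (z x) = (\<integral>y. of_real (k (z x) (z y)) * g (z y) \<partial>m)"
    unfolding kernel_op_def using assms
    by (intro Z_measure_preserving[symmetric, of z "\<lambda>y. of_real (k (z x) y) * g y"]
      continuous_intros
        k_continuous_right)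
  then show "kernel_op (\<lambda>x. g (z x)) x = kernel_op g (z x)"
    using k_invariant[OF assms(1)] by (simp add: kernel_op_def)
qed

lemma eigenfunction_kernel_op:
  assumes eigen: "eigenfunction e"
  shows "eigenfunction (kernel_op e)"
  unfolding eigenfunction_def
proof (intro conjI ballI)
  show "ccont (kernel_op e)"
    by (rule kernel_op_continuous[OF eigenfunction_continuous[OF eigen]])
  fix z assume z_in_Z: "z \<in> Z"
  have "(\<lambda>x. kernel_op e (z x)) = kernel_op (\<lambda>x. eigenvalue e z * e x)"
    unfolding kernel_op_compose_Z[OF z_in_Z eigenfunction_continuous[OF eigen], symmetric]
      eigenfunction_apply[OF eigen z_in_Z] ..
  then show "\<exists>c. \<forall>x. kernel_op e (z x) = c * kernel_op e x"
    unfolding kernel_op_scale fun_eq_iff by blast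
qed

theorem eigenfunction_in_invariant_subspace:
  assumes invariant: "invariant_subspace V" and kernel: "\<And>g. g \<in> V \<Longrightarrow> kernel_op g \<in> V"
    and g_nonzero: "g \<in> V" "kernel_op g \<noteq> (\<lambda>_. 0)"
  obtains e where "e \<in> V" "e \<noteq> (\<lambda>_. 0)" "eigenfunction e"
proof -
  have closed: "closed_subspace V" using invariant by (simp add: invariant_subspace_def)
  interpret K: compact_symmetric_operator m V kernel_op
    by (rule kernel_op_compact_symmetric_operator[OF closed kernel])
  obtain a :: real and v where v_eigen: "a \<noteq> 0" "v \<in> V" "v \<noteq> (\<lambda>_. 0)"
    "kernel_op v = (\<lambda>x. of_real a * v x)"
    using K.eigenvector_exists[OF g_nonzero] .
  define E where "E = {g \<in> V. kernel_op g = (\<lambda>x. of_real a * g x)}"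
  have "invariant_subspace E"
    using invariant K.eigenspace_closed closed_subspace_continuous[OF closed]
    by (auto simp: E_def invariant_subspace_def kernel_op_compose_Z)
  moreover have "E \<noteq> {\<lambda>_. 0}" using v_eigen by (auto simp: E_def)
  moreover obtain n where "\<And>B. orthonormal B \<Longrightarrow> B \<subseteq> E \<Longrightarrow> card B \<le> n"
  proof -
    have "E \<subseteq> {g. kernel_op g = (\<lambda>x. of_real a * g x)}" by (auto simp: E_def)
    then show thesis
      using eigenspace_finite_dimensional[OF v_eigen(1)] that by (meson subset_trans)
  qed
  ultimately obtain F B where F_minimal: "F \<subseteq> E" "minimal_invariant_subspace F"
    "orthonormal_basis B F"
    using minimal_invariant_subspace_exists by blast
  then have "F \<noteq> {\<lambda>_. 0}" "(\<lambda>_. 0) \<in> F"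
    using closed_subspace_zero by (auto simp: minimal_invariant_subspace_def invariant_subspace_def)
  then obtain e where "e \<in> F" "e \<noteq> (\<lambda>_. 0)" by blast
  with F_minimal minimal_invariant_subspace_eigenfunction[OF F_minimal(2,3)] show thesis
    using that by (auto simp: E_def)
qed

lemma kernel_op_orthogonal_to_eigenfunctions:
  assumes g_orthogonal: "g \<in> orthogonal_complement {e. eigenfunction e}"
  shows "kernel_op g = (\<lambda>_. 0)"
proof (rule ccontr)
  let ?N = "orthogonal_complement {e. eigenfunction e}"
  assume nonzero: "kernel_op g \<noteq> (\<lambda>_. 0)"
  have "kernel_op h \<in> ?N" if "h \<in> ?N" for h
    using that kernel_op_symmetric[OF _ eigenfunction_continuous] eigenfunction_kernel_op
    by (auto simp: orthogonal_complement_def kernel_op_continuous)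
  then obtain e where e_eigen: "e \<in> ?N" "e \<noteq> (\<lambda>_. 0)" "eigenfunction e"
    using eigenfunction_in_invariant_subspace[OF invariant_subspace_eigenfunctions_complement _
      g_orthogonal nonzero] by blast
  then have "cinner e e = 0" by (simp add: orthogonal_complement_def)
  with sqnorm_pos[OF eigenfunction_continuous[OF e_eigen(3)] e_eigen(2)] show False
    by (simp add: cinner_self)
qed

theorem kernel_eq_of_eigenfunctions_eq:
  assumes same: "\<And>e. eigenfunction e \<Longrightarrow> e x = e y"
  shows "k x = k y"
proof -
  define b where "b = (\<lambda>z. complex_of_real (k x z - k y z))"
  have cont: "ccont b" unfolding b_def by (intro continuous_intros k_continuous_right)
  have cinner_b: "cinner g b = kernel_op g x - kernel_op g y" if "ccont g" for g
  proof -
    have "cinner g b = (\<integral>z. of_real (k x z) * g z - of_real (k y z) * g z \<partial>m)"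
      by (simp add: cinner_def b_def algebra_simps)
    then show ?thesis using kernel_op_integrable[OF that] by (simp add: kernel_op_def)
  qed
  have "cinner b e = 0" if "eigenfunction e" for e
    using cinner_b[OF eigenfunction_continuous[OF that]] same[OF eigenfunction_kernel_op[OF that]]
      cinner_commute[of b e] by simp
  with cont have "kernel_op b = (\<lambda>_. 0)"
    by (intro kernel_op_orthogonal_to_eigenfunctions) (simp add: orthogonal_complement_def)
  then have "sqnorm b = 0"
    using cinner_b[OF cont] by (simp add: cinner_self)
  then have "b = (\<lambda>_. 0)" by (intro sqnorm_le_0_imp_zero cont) simp
  then show ?thesis by (simp add: b_def fun_eq_iff)
qed

end

subsection \<open>Density of the span of the eigenfunctions\<close>

locale equicontinuous_transformations = commuting_transformations m Z
  for m :: "'x::t2_space measure" and Z +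
  assumes Z_equicontinuous: "\<And>f :: 'x \<Rightarrow> real. continuous_on UNIV f
    \<Longrightarrow> equicontinuous Z (\<lambda>z x. f (z x))"
begin

definition orbit_dist :: "('x \<Rightarrow> real) \<Rightarrow> 'x \<Rightarrow> 'x \<Rightarrow> real" where
  "orbit_dist f x y = (SUP z\<in>Z. dist (f (z x)) (f (z y)))"

context
  fixes f :: "'x \<Rightarrow> real"
  assumes f_continuous: "continuous_on UNIV f"
begin

lemma orbit_dist_upper:
  assumes "z \<in> Z"
  shows "dist (f (z x)) (f (z y)) \<le> orbit_dist f x y"
proof -
  obtain B where B_bound: "\<And>x. norm (f x) \<le> B"
    using continuous_on_UNIV_bounded[OF compact_UNIV f_continuous] by blast
  have "dist (f (z x)) (f (z y)) \<le> B + B" for z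
    using norm_triangle_ineq4[of "f (z x)" "f (z y)"] add_mono[OF B_bound B_bound, of "z x" "z y"]
    by (simp add: dist_norm)
  then have "bdd_above ((\<lambda>z. dist (f (z x)) (f (z y))) ` Z)"
    by (auto simp: bdd_above_def)
  then show ?thesis
    unfolding orbit_dist_def by (rule cSUP_upper[OF assms])
qed

lemma orbit_dist_least: "(\<And>z. z \<in> Z \<Longrightarrow> dist (f (z x)) (f (z y)) \<le> c) \<Longrightarrow> orbit_dist f x y \<le> c"
  unfolding orbit_dist_def using Z_id by (intro cSUP_least) auto

lemma dist_le_orbit_dist: "dist (f x) (f y) \<le> orbit_dist f x y"
  using orbit_dist_upper[OF Z_id] .

lemma orbit_dist_refl: "orbit_dist f x x = 0"
  using orbit_dist_least[of x x 0] dist_le_orbit_dist[of x x] by simp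

lemma orbit_dist_commute: "orbit_dist f x y = orbit_dist f y x"
  by (simp add: orbit_dist_def dist_commute)

lemma orbit_dist_triangle: "orbit_dist f x y \<le> orbit_dist f x z + orbit_dist f z y"
proof (rule orbit_dist_least)
  fix w assume "w \<in> Z"
  then show "dist (f (w x)) (f (w y)) \<le> orbit_dist f x z + orbit_dist f z y"
    using orbit_dist_upper[of w x z] orbit_dist_upper[of w z y]
      dist_triangle[of "f (w x)" "f (w y)" "f (w z)"]
    by linarith
qed

lemma orbit_dist_invariant:
  assumes w_in_Z: "w \<in> Z"
  shows "orbit_dist f (w x) (w y) = orbit_dist f x y"
proof -
  have contraction: "orbit_dist f (w x) (w y) \<le> orbit_dist f x y" if "w \<in> Z" for w x y
    using orbit_dist_upper[OF Z_comp[OF _ that]] by (intro orbit_dist_least) auto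
  obtain w' where "w' \<in> Z" "\<And>x. w' (w x) = x" using Z_inverse[OF w_in_Z] by blast
  with contraction[OF w_in_Z, of x y] contraction[of w' "w x" "w y"] show ?thesis by simp
qed

lemma eventually_orbit_dist_less:
  assumes "e > 0"
  shows "\<forall>\<^sub>F y in nhds x. orbit_dist f y x < e"
proof -
  have "\<forall>\<^sub>F y in nhds x. \<forall>z\<in>Z. dist (f (z y)) (f (z x)) < e / 2"
    using Z_equicontinuous[OF f_continuous] assms unfolding equicontinuous_def
    by (meson half_gt_zero)
  then show ?thesis
  proof eventually_elim
    case (elim y)
    then have "orbit_dist f y x \<le> e / 2" by (intro orbit_dist_least) (auto simp: less_imp_le)
    with assms show ?case by simp
  qed
qed

lemma orbit_dist_continuous: "continuous_on UNIV (\<lambda>p. orbit_dist f (fst p) (snd p))"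
  unfolding continuous_on_UNIV_iff_tendsto_nhds
proof (intro allI tendstoI)
  fix p :: "'x \<times> 'x" and e :: real assume "e > 0"
  then have "\<forall>\<^sub>F p' in nhds (fst p) \<times>\<^sub>F nhds (snd p).
      orbit_dist f (fst p') (fst p) < e / 2 \<and> orbit_dist f (snd p') (snd p) < e / 2"
    by (intro eventually_prodI eventually_orbit_dist_less) auto
  then have "\<forall>\<^sub>F p' in nhds p.
      orbit_dist f (fst p') (fst p) < e / 2 \<and> orbit_dist f (snd p') (snd p) < e / 2"
    by (simp flip: nhds_prod)
  then show "\<forall>\<^sub>F p' in nhds p.
      dist (orbit_dist f (fst p') (snd p')) (orbit_dist f (fst p) (snd p)) < e"
  proof eventually_elim
    case (elim p')
    obtain x y x' y' where p_eq: "p = (x, y)" "p' = (x', y')" by fastforce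
    with elim have "orbit_dist f x' x < e / 2" "orbit_dist f y' y < e / 2" by simp_all
    then show ?case
      using orbit_dist_triangle[of x' y' x] orbit_dist_triangle[of x y' y]
        orbit_dist_triangle[of x y x'] orbit_dist_triangle[of x' y y']
        orbit_dist_commute[of x x'] orbit_dist_commute[of y y']
      unfolding p_eq fst_conv snd_conv dist_real_def by linarith
  qed
qed

lemma orbit_dist_invariant_kernel: "invariant_kernel m Z (orbit_dist f)"
  by unfold_locales (use orbit_dist_continuous orbit_dist_commute orbit_dist_invariant in auto)

end

theorem eigenfunctions_separate_points:
  assumes "x \<noteq> y"
  obtains e where "eigenfunction e" "e x \<noteq> e y"
proof -
  have "\<exists>e. eigenfunction e \<and> e x \<noteq> e y"
  proof (rule ccontr)
    assume "\<not> ?thesis"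
    then have same: "e x = e y" if "eigenfunction e" for e using that by blast
    obtain f :: "'x \<Rightarrow> real" where f_separates: "continuous_on UNIV f" "f x \<noteq> f y"
      using continuous_real_separates_points[OF compact_UNIV assms] by blast
    interpret invariant_kernel m Z "orbit_dist f"
      by (rule orbit_dist_invariant_kernel[OF f_separates(1)])
    have "orbit_dist f x = orbit_dist f y"
      using same by (rule kernel_eq_of_eigenfunctions_eq)
    then have "orbit_dist f x y = 0"
      using orbit_dist_refl[OF f_separates(1), of y] by simp
    with dist_le_orbit_dist[OF f_separates(1), of x y] f_separates(2) show False by simp
  qed
  then show thesis using that by blast
qed

inductive_set eigenspan :: "('x \<Rightarrow> complex) set" where
  base: "eigenfunction e \<Longrightarrow> e \<in> eigenspan"
| add: "s \<in> eigenspan \<Longrightarrow> t \<in> eigenspan \<Longrightarrow> (\<lambda>x. s x + t x) \<in> eigenspan"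

lemma eigenspan_continuous: "s \<in> eigenspan \<Longrightarrow> ccont s"
  by (induction rule: eigenspan.induct) (auto intro: eigenfunction_continuous continuous_on_add)

lemma eigenspan_cnj: "s \<in> eigenspan \<Longrightarrow> (\<lambda>x. cnj (s x)) \<in> eigenspan"
proof (induction rule: eigenspan.induct)
  case (base e)
  then show ?case by (intro eigenspan.base eigenfunction_cnj)
next
  case (add s t)
  then show ?case using eigenspan.add[OF add.IH] by simp
qed

lemma eigenspan_mult: "s \<in> eigenspan \<Longrightarrow> t \<in> eigenspan \<Longrightarrow> (\<lambda>x. s x * t x) \<in> eigenspan"
proof (induction rule: eigenspan.induct)
  case (base e)
  from base(2) show ?case
  proof (induction rule: eigenspan.induct)
    case (base e')
    then show ?case using \<open>eigenfunction e\<close> by (intro eigenspan.base eigenfunction_mult)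
  next
    case (add s t)
    then show ?case using eigenspan.add[OF add.IH] by (simp add: distrib_left)
  qed
next
  case (add s s')
  from eigenspan.add[OF add.IH(1)[OF add.prems] add.IH(2)[OF add.prems]] show ?case
    by (simp add: distrib_right)
qed

lemma eigenspan_scale: "s \<in> eigenspan \<Longrightarrow> (\<lambda>x. c * s x) \<in> eigenspan"
  using eigenspan_mult[OF eigenspan.base[OF eigenfunction_const]] .

lemma Re_eigenspan_mult:
  assumes "s \<in> eigenspan" "t \<in> eigenspan"
  obtains r where "r \<in> eigenspan" "\<And>x. Re (s x) * Re (t x) = Re (r x)"
proof
  show "(\<lambda>x. (1/2) * (s x * t x + s x * cnj (t x))) \<in> eigenspan"
    using assms by (intro eigenspan_scale eigenspan.add eigenspan_mult eigenspan_cnj)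
qed simp

lemma Re_eigenspan_separates_points:
  assumes "x \<noteq> y"
  obtains s where "s \<in> eigenspan" "Re (s x) \<noteq> Re (s y)"
proof -
  obtain e where e_separates: "eigenfunction e" "e x \<noteq> e y"
    using eigenfunctions_separate_points[OF assms] by blast
  show thesis
  proof (cases "Re (e x) = Re (e y)")
    case False
    with e_separates(1) show ?thesis using that[of e] by (simp add: eigenspan.base)
  next
    case True
    with e_separates show ?thesis
      using that[of "\<lambda>x. -\<i> * e x"] eigenspan_scale[OF eigenspan.base[OF e_separates(1)], of "-\<i>"]
      by (simp add: complex_eq_iff)
  qed
qed

theorem Re_eigenspan_dense:
  fixes f :: "'x \<Rightarrow> real"
  assumes f_continuous: "continuous_on UNIV f" and "e > 0"
  obtains s where "s \<in> eigenspan" "\<And>x. \<bar>f x - Re (s x)\<bar> < e"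
proof -
  define A where "A = {\<lambda>x. Re (s x) | s. s \<in> eigenspan}"
  have in_A: "(\<lambda>x. Re (s x)) \<in> A" if "s \<in> eigenspan" for s using that by (auto simp: A_def)
  interpret function_ring_on A "UNIV :: 'x set"
  proof
    show "compact (UNIV :: 'x set)" by (rule compact_UNIV)
    show "continuous_on UNIV g" if "g \<in> A" for g
      using that eigenspan_continuous by (auto simp: A_def intro: continuous_on_Re)
    fix g h assume "g \<in> A" "h \<in> A"
    then obtain s t where st_repr: "g = (\<lambda>x. Re (s x))" "h = (\<lambda>x. Re (t x))" "s \<in> eigenspan"
      "t \<in> eigenspan"
      unfolding A_def by blast
    show "(\<lambda>x. g x + h x) \<in> A"
      using in_A[OF eigenspan.add[OF st_repr(3,4)]] by (simp add: st_repr)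
    obtain r where "r \<in> eigenspan" "\<And>x. Re (s x) * Re (t x) = Re (r x)"
      using Re_eigenspan_mult[OF st_repr(3,4)] by blast
    with in_A[of r] show "(\<lambda>x. g x * h x) \<in> A"
      by (simp add: st_repr(1,2))
  next
    show "(\<lambda>_. c) \<in> A" for c
      using in_A[OF eigenspan.base[OF eigenfunction_const[of "of_real c"]]] by simp
    show "\<exists>g\<in>A. g x \<noteq> g y" if neq: "x \<noteq> y" for x y
    proof -
      obtain s where "s \<in> eigenspan" "Re (s x) \<noteq> Re (s y)"
        using Re_eigenspan_separates_points[OF neq] by blast
      with in_A show ?thesis by (intro bexI[of _ "\<lambda>x. Re (s x)"])
    qed
  qed
  obtain g where "g \<in> A" "\<And>x. \<bar>f x - g x\<bar> < e"
    using Stone_Weierstrass_basic[OF f_continuous \<open>e > 0\<close>] by blast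
  then show thesis using that by (auto simp: A_def)
qed

end

subsection \<open>Topological groups and homogeneous spaces\<close>

locale top_group =
  fixes G :: "('g::t2_space, 'b) monoid_scheme" (structure)
  assumes topological_group: "topological_group G"
begin

sublocale group G
  using topological_group by (simp add: topological_group_def)

lemma carrier_UNIV [simp]: "carrier G = UNIV"
  using topological_group by (simp add: topological_group_def)

lemma continuous_mult:
  assumes "continuous_on S a" "continuous_on S b"
  shows "continuous_on S (\<lambda>x. a x \<otimes> b x)"
proof -
  have "continuous_on UNIV (\<lambda>p. fst p \<otimes> snd p)"
    using topological_group by (simp add: topological_group_def)
  from continuous_on_compose2[OF this continuous_on_Pair[OF assms]] show ?thesis by simp
qed

lemma continuous_inv: "continuous_on S a \<Longrightarrow> continuous_on S (\<lambda>x. inv (a x))"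
  using continuous_on_compose2[of UNIV "\<lambda>x. inv x" S a] topological_group
  by (simp add: topological_group_def)

lemma inv_cancel [simp]: "inv a \<otimes> (a \<otimes> h) = h" "a \<otimes> (inv a \<otimes> h) = h"
  by (simp_all flip: m_assoc)

definition character :: "('g \<Rightarrow> complex) \<Rightarrow> bool" where
  "character \<theta> \<longleftrightarrow> continuous_on UNIV \<theta> \<and> (\<forall>a b. \<theta> (a \<otimes> b) = \<theta> a * \<theta> b) \<and> (\<forall>a. cmod (\<theta> a) = 1)"

context
  fixes \<theta>
  assumes character: "character \<theta>"
begin

lemma character_continuous: "continuous_on UNIV \<theta>"
  using character by (simp add: character_def)

lemma character_mult: "\<theta> (a \<otimes> b) = \<theta> a * \<theta> b"
  using character by (simp add: character_def)

lemma norm_character: "cmod (\<theta> a) = 1"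
  using character by (simp add: character_def)

lemma character_one: "\<theta> \<one> = 1"
  using character_mult[of \<one> \<one>] norm_character[of \<one>] by auto

lemma character_nat_pow: "\<theta> (a [^] (n::nat)) = \<theta> a ^ n"
  by (induction n) (simp_all add: character_one character_mult mult.commute)

lemma character_trivial_near_one:
  assumes connected: "connected (UNIV :: 'g set)" and near: "\<forall>\<^sub>F h in nhds \<one>. \<theta> h = 1"
  shows "\<theta> g = 1"
proof -
  let ?S = "{h. \<theta> h = 1}"
  obtain V where V_nbhd: "open V" "\<one> \<in> V" "\<And>h. h \<in> V \<Longrightarrow> \<theta> h = 1"
    using near unfolding eventually_nhds by blast
  have "closed ?S"
    by (rule closed_Collect_eq[OF character_continuous continuous_on_const])
  moreover have "open ?S"
  proof (subst open_subopen, intro ballI)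
    fix h assume h_in_kernel: "h \<in> ?S"
    let ?hV = "(\<lambda>g. inv h \<otimes> g) -` V"
    have "open ?hV"
      using V_nbhd(1) by (intro open_vimage continuous_mult continuous_intros)
    moreover have "h \<in> ?hV" using V_nbhd(2) by simp
    moreover have "?hV \<subseteq> ?S"
    proof
      fix g assume "g \<in> ?hV"
      then have "\<theta> (inv h \<otimes> g) = 1" using V_nbhd(3) by simp
      with h_in_kernel show "g \<in> ?S" using character_mult[of h "inv h \<otimes> g"] by simp
    qed
    ultimately show "\<exists>T. open T \<and> h \<in> T \<and> T \<subseteq> ?S" by blast
  qed
  ultimately have "?S = {} \<or> ?S = UNIV"
    using connected connected_clopen[of "UNIV :: 'g set"] by auto
  with character_one show ?thesis by blast
qed

end

end

locale homogeneous_space = top_group G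
  for G :: "('g::t2_space, 'b) monoid_scheme" (structure) +
  fixes H :: "'g set" and q :: "'g \<Rightarrow> 'x::topological_space"
  assumes quotient_map: "coset_quotient_map G H q"
begin

abbreviation act :: "'g \<Rightarrow> 'x \<Rightarrow> 'x" where
  "act \<equiv> left_transl G q"

lemma q_eq_iff: "q g = q h \<longleftrightarrow> inv g \<otimes> h \<in> H"
  using quotient_map by (simp add: coset_quotient_map_def)

lemma surj_q: "surj q"
  using quotient_map by (simp add: coset_quotient_map_def)

lemma q_cases: obtains g where "x = q g"
  using surj_q by (metis surjD)

lemma open_iff_open_vimage_q: "open S \<longleftrightarrow> open (q -` S)"
  using quotient_map by (simp add: coset_quotient_map_def)

lemma q_SOME: "q (SOME g. q g = x) = x"
  by (rule someI_ex) (metis q_cases)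

lemma act_q [simp]: "act a (q g) = q (a \<otimes> g)"
proof -
  let ?r = "SOME h. q h = q g"
  have "inv ?r \<otimes> g \<in> H" using q_SOME[of "q g"] q_eq_iff by blast
  moreover have "inv (a \<otimes> ?r) \<otimes> (a \<otimes> g) = inv ?r \<otimes> g"
    by (simp add: inv_mult_group m_assoc)
  ultimately show ?thesis unfolding left_transl_def q_eq_iff by simp
qed

lemma act_act: "act a (act b x) = act (a \<otimes> b) x"
  by (rule q_cases[of x]) (simp add: m_assoc)

lemma act_one [simp]: "act \<one> x = x"
  by (rule q_cases[of x]) simp

lemma act_inv [simp]: "act a (act (inv a) x) = x" "act (inv a) (act a x) = x"
  by (simp_all add: act_act)

lemma act_funpow: "act a ^^ n = act (a [^] n)"
proof (induction n)
  case (Suc n)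
  have "a [^] n \<otimes> a = a \<otimes> a [^] n"
    using nat_pow_Suc2[of a n] by simp
  with Suc show ?case
    by (simp add: fun_eq_iff act_act)
qed (simp add: fun_eq_iff)

lemma q_continuous: "continuous_on UNIV q"
  by (simp add: continuous_on_open_vimage open_iff_open_vimage_q[symmetric])

lemma continuous_q: "continuous_on S a \<Longrightarrow> continuous_on S (\<lambda>x. q (a x))"
  by (rule continuous_on_compose2[OF q_continuous]) auto

lemma open_image_q:
  assumes "open S"
  shows "open (q ` S)"
proof -
  have "q -` (q ` S) = (\<Union>h\<in>H. (\<lambda>g. g \<otimes> h) -` S)"
  proof (intro equalityI subsetI)
    fix g assume "g \<in> q -` (q ` S)"
    then obtain s where s_in_S: "q g = q s" "s \<in> S" by auto
    then show "g \<in> (\<Union>h\<in>H. (\<lambda>g. g \<otimes> h) -` S)"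
      using q_eq_iff by (intro UN_I[of "inv g \<otimes> s"]) auto
  next
    fix g assume "g \<in> (\<Union>h\<in>H. (\<lambda>g. g \<otimes> h) -` S)"
    then obtain h where h_in_H: "h \<in> H" "g \<otimes> h \<in> S" by auto
    then have "q g = q (g \<otimes> h)" by (simp add: q_eq_iff)
    with h_in_H(2) show "g \<in> q -` (q ` S)" by (metis image_eqI vimageI)
  qed
  moreover have "open \<dots>"
    using assms by (intro open_UN ballI open_vimage continuous_mult continuous_intros)
  ultimately show ?thesis by (simp add: open_iff_open_vimage_q)
qed

lemma continuous_q_lift: "continuous_on UNIV (\<lambda>g. F (q g)) \<Longrightarrow> continuous_on UNIV F"
  by (rule continuous_on_open_surj_lift[OF surj_q open_image_q])

lemma continuous_q_prod_lift:
  assumes "continuous_on UNIV (\<lambda>p. F (q (fst p), q (snd p)))"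
  shows "continuous_on UNIV F"
proof (rule continuous_on_open_surj_lift[of "map_prod q q"])
  show "surj (map_prod q q)"
    using surj_q surj_q by (rule map_prod_surj)
  show "open (map_prod q q ` S)" if "open S" for S
    using that by (intro open_image_map_prod open_image_q)
  show "continuous_on UNIV (\<lambda>p. F (map_prod q q p))"
    using assms by (simp add: map_prod_def case_prod_beta)
qed

lemma act_jointly_continuous: "continuous_on UNIV (\<lambda>p. act (fst p) (snd p))"
proof (rule continuous_on_open_surj_lift[of "map_prod id q"])
  show "surj (map_prod id q)"
    using surj_id surj_q by (rule map_prod_surj)
  show "open (map_prod id q ` S)" if "open S" for S :: "('g \<times> 'g) set"
    using that by (intro open_image_map_prod open_image_q) simp_all
  show "continuous_on UNIV (\<lambda>p. act (fst (map_prod id q p)) (snd (map_prod id q p)))"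
    by (simp add: continuous_q continuous_mult continuous_on_fst continuous_on_snd continuous_on_id)
qed

lemma act_continuous: "continuous_on UNIV (act a)"
  using continuous_on_compose2[OF act_jointly_continuous, of UNIV "\<lambda>x. (a, x)"]
  by (simp add: continuous_on_Pair)

lemma continuous_compose_act: "continuous_on UNIV f \<Longrightarrow> continuous_on UNIV (\<lambda>x. f (act a x))"
  by (rule continuous_on_compose2[OF _ act_continuous]) auto

lemma eventually_nhds_eq_act:
  assumes "\<forall>\<^sub>F a in nhds \<one>. P a"
  shows "\<forall>\<^sub>F y in nhds x. \<exists>a. P a \<and> y = act a x"
proof -
  obtain W where W_nbhd: "open W" "\<one> \<in> W" "\<And>a. a \<in> W \<Longrightarrow> P a"
    using assms unfolding eventually_nhds by blast
  obtain g where x_eq: "x = q g" by (rule q_cases)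
  define V where "V = (\<lambda>h. h \<otimes> inv g) -` W"
  have V_nbhd: "open V" "g \<in> V"
    using W_nbhd(1,2) by (auto simp: V_def intro!: open_vimage continuous_mult continuous_intros)
  have "\<exists>a. P a \<and> q h = act a x" if "h \<in> V" for h
    using that W_nbhd(3) x_eq by (intro exI[of _ "h \<otimes> inv g"]) (auto simp: V_def m_assoc)
  with V_nbhd x_eq open_image_q[OF V_nbhd(1)] show ?thesis
    unfolding eventually_nhds by (intro exI[of _ "q ` V"]) auto
qed

context
  fixes m
  assumes haar: "haar_on_quotient G q m"
begin

lemma act_measurable: "act a \<in> measurable m borel"
proof -
  have "sets m = sets borel" using haar by (simp add: haar_on_quotient_def)
  then show ?thesis
    using borel_measurable_continuous_onI[OF act_continuous] measurable_cong_sets by blast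
qed

lemma distr_act: "distr m borel (act a) = m"
  using haar by (simp add: haar_on_quotient_def)

lemma integral_act:
  fixes f :: "'x \<Rightarrow> 'c::{banach,second_countable_topology}"
  assumes "continuous_on UNIV f"
  shows "(\<integral>x. f (act a x) \<partial>m) = (\<integral>x. f x \<partial>m)"
  using integral_distr[OF act_measurable borel_measurable_continuous_onI[OF assms]]
  by (simp add: distr_act)

lemma measure_act_vimage:
  assumes "open S"
  shows "measure m (act a -` S) = measure m S"
proof -
  have "sets m = sets borel" using haar by (simp add: haar_on_quotient_def)
  then have "space m = UNIV" by (simp add: sets_eq_imp_space_eq)
  then show ?thesis
    using measure_distr[OF act_measurable, of S a] assms by (simp add: distr_act)
qed

end

end

locale compact_homogeneous_space = homogeneous_space G H q
  for G :: "('g::t2_space, 'b) monoid_scheme" (structure)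
    and H :: "'g set" and q :: "'g \<Rightarrow> 'x::t2_space" +
  fixes m :: "'x measure"
  assumes compact_X: "compact (UNIV :: 'x set)"
    and haar: "haar_on_quotient G q m"
begin

sublocale compact_prob_space m
proof (rule compact_prob_space.intro)
  show "sets m = sets borel" "prob_space m"
    using haar unfolding haar_on_quotient_def by blast+
qed (rule compact_X)

lemmas integral_act = integral_act[OF haar]

lemma finite_cover_by_translates:
  assumes "open S" "S \<noteq> {}"
  obtains A where "finite A" "(\<Union>a\<in>A. act a -` S) = UNIV"
proof -
  obtain g0 where g0_in_S: "q g0 \<in> S" using assms(2) q_cases by (metis equals0I)
  have cover: "UNIV \<subseteq> (\<Union>a. act a -` S)"
  proof
    fix x :: 'x
    obtain g where "x = q g" by (rule q_cases)
    then have "act (g0 \<otimes> inv g) x \<in> S" using g0_in_S by (simp add: m_assoc)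
    then show "x \<in> (\<Union>a. act a -` S)" by blast
  qed
  obtain A where "finite A" "(UNIV :: 'x set) \<subseteq> (\<Union>a\<in>A. act a -` S)"
    by (rule compactE_image[OF compact_X _ cover])
      (use open_vimage[OF assms(1) act_continuous] in auto)
  then show thesis using that by blast
qed

sublocale full_support_space m
proof
  fix S :: "'x set" assume S_open: "open S" "S \<noteq> {}"
  obtain A where A_cover: "finite A" "(\<Union>a\<in>A. act a -` S) = UNIV"
    by (rule finite_cover_by_translates[OF S_open])
  have "act a -` S \<in> sets m" for a
    using open_vimage[OF S_open(1) act_continuous] sets_m by simp
  then have "1 \<le> (\<Sum>a\<in>A. measure m (act a -` S))"
    using A_cover(2)
      finite_measure.finite_measure_subadditive_finite[OF finite_m A_cover(1), of "\<lambda>a. act a -` S"]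
    by auto
  also have "\<dots> = real (card A) * measure m S"
    using measure_act_vimage[OF haar S_open(1)] by simp
  finally show "measure m S > 0"
    by (cases "measure m S = 0") (auto simp: zero_less_measure_iff)
qed

lemma uniform_limit_compose_act:
  fixes f :: "'x \<Rightarrow> 'c::metric_space"
  assumes "continuous_on UNIV f"
  shows "uniform_limit UNIV (\<lambda>a x. f (act a x)) f (nhds \<one>)"
proof -
  have "continuous_on UNIV (\<lambda>p. f (act (fst p) (snd p)))"
    by (rule continuous_on_compose2[OF assms act_jointly_continuous]) simp
  from continuous_imp_uniform_limit_nhds[OF compact_X this, of \<one>] show ?thesis by simp
qed

lemma equicontinuous_if_commutes_with_act:
  fixes f :: "'x \<Rightarrow> 'c::metric_space"
  assumes commute: "\<And>z a x. z \<in> Z \<Longrightarrow> z (act a x) = act a (z x)"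
    and f_continuous: "continuous_on UNIV f"
  shows "equicontinuous Z (\<lambda>z x. f (z x))"
  unfolding equicontinuous_def
proof (intro allI impI)
  fix x and e :: real assume "e > 0"
  with uniform_limit_compose_act[OF f_continuous]
    have "\<forall>\<^sub>F a in nhds \<one>. \<forall>y\<in>UNIV. dist (f (act a y)) (f y) < e"
    by (rule uniform_limitD)
  from eventually_nhds_eq_act[OF this, of x]
  show "\<forall>\<^sub>F y in nhds x. \<forall>z\<in>Z. dist (f (z y)) (f (z x)) < e"
    by eventually_elim (auto simp: commute)
qed

end

subsection \<open>Two-step nilmanifolds\<close>

locale two_step_nilmanifold = compact_homogeneous_space G \<Gamma> q m
  for G :: "('g::t2_space, 'b) monoid_scheme" (structure)
    and \<Gamma> :: "'g set" and q :: "'g \<Rightarrow> 'x::t2_space" and m +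
  assumes two_step: "lower_central G 2 = {\<one>}"
    and \<Gamma>_subgroup: "subgroup \<Gamma> G"
begin

definition commutator :: "'g \<Rightarrow> 'g \<Rightarrow> 'g" where
  "commutator a b = a \<otimes> b \<otimes> inv a \<otimes> inv b"

abbreviation G1 :: "'g set" where
  "G1 \<equiv> lower_central G 1"

definition G1_invariant :: "('x \<Rightarrow> 'c) \<Rightarrow> bool" where
  "G1_invariant f \<longleftrightarrow> (\<forall>z\<in>G1. \<forall>x. f (act z x) = f x)"

lemma G1_central:
  assumes "z \<in> G1"
  shows "z \<otimes> g = g \<otimes> z"
proof -
  have "g \<otimes> z \<otimes> inv g \<otimes> inv z \<in> lower_central G 2"
    using assms by (auto simp: numeral_2_eq_2 intro!: generate.incl)
  then have "g \<otimes> z \<otimes> inv g \<otimes> inv z = \<one>" using two_step by simp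
  then have "g \<otimes> z \<otimes> inv g = z"
    by (metis UNIV_I carrier_UNIV inv_closed inv_equality inv_inv m_closed)
  then show ?thesis by (metis UNIV_I carrier_UNIV inv_solve_right m_closed)
qed

lemma G1_eq_generate_commutators: "G1 = generate G {commutator a b | a b. True}"
  by (simp add: commutator_def)

lemma commutator_in_G1: "commutator a b \<in> G1"
  unfolding G1_eq_generate_commutators by (intro generate.incl) blast

lemma G1_subgroup: "subgroup G1 G"
  unfolding G1_eq_generate_commutators by (intro generate_is_subgroup) simp

lemmas G1_mult = subgroup.m_closed[OF G1_subgroup]
lemmas G1_inv = subgroup.m_inv_closed[OF G1_subgroup]
lemmas G1_one = subgroup.one_closed[OF G1_subgroup]

lemma mult_eq_commutator_mult: "a \<otimes> b = commutator a b \<otimes> (b \<otimes> a)"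
  by (simp add: commutator_def m_assoc)

lemma inv_commutator: "inv (commutator a b) = commutator b a"
  by (simp add: commutator_def inv_mult_group m_assoc)

lemma commutator_one_left: "commutator \<one> b = \<one>"
  by (simp add: commutator_def)

lemma commutator_mult_left: "commutator (a \<otimes> a') b = commutator a b \<otimes> commutator a' b"
proof -
  have "commutator (a \<otimes> a') b \<otimes> (b \<otimes> (a \<otimes> a')) = a \<otimes> (a' \<otimes> b)"
    using mult_eq_commutator_mult[of "a \<otimes> a'" b] by (simp add: m_assoc)
  also have "\<dots> = a \<otimes> (commutator a' b \<otimes> (b \<otimes> a'))"
    using mult_eq_commutator_mult[of a' b] by simp
  also have "\<dots> = commutator a' b \<otimes> ((a \<otimes> b) \<otimes> a')"
    using G1_central[OF commutator_in_G1[of a' b], of a] by (simp add: m_assoc[symmetric])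
  also have "a \<otimes> b = commutator a b \<otimes> (b \<otimes> a)" by (rule mult_eq_commutator_mult)
  also have "commutator a' b \<otimes> ((commutator a b \<otimes> (b \<otimes> a)) \<otimes> a')
      = (commutator a b \<otimes> commutator a' b) \<otimes> (b \<otimes> (a \<otimes> a'))"
    using G1_central[OF commutator_in_G1[of a' b], of "commutator a b"]
    by (simp add: m_assoc[symmetric])
  finally show ?thesis by simp
qed

lemma commutator_mult_right: "commutator b (a \<otimes> a') = commutator b a \<otimes> commutator b a'"
proof -
  have "commutator b (a \<otimes> a') = inv (commutator a b \<otimes> commutator a' b)"
    by (simp add: commutator_mult_left flip: inv_commutator[of "a \<otimes> a'" b])
  also have "\<dots> = commutator b a' \<otimes> commutator b a"
    by (simp add: inv_mult_group inv_commutator)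
  also have "\<dots> = commutator b a \<otimes> commutator b a'"
    by (rule G1_central[OF commutator_in_G1])
  finally show ?thesis .
qed

lemma continuous_commutator:
  "continuous_on S a \<Longrightarrow> continuous_on S b \<Longrightarrow> continuous_on S (\<lambda>x. commutator (a x) (b x))"
  unfolding commutator_def by (intro continuous_mult continuous_inv)

lemma act_G1_commute: "z \<in> G1 \<Longrightarrow> act z (act a x) = act a (act z x)"
  using G1_central[of z a] by (simp add: act_act)

lemma act_act_eq_commutator: "act a (act b x) = act (commutator a b) (act b (act a x))"
  unfolding act_act using mult_eq_commutator_mult[of a b] by (simp add: m_assoc)

lemma G1_invariantD: "G1_invariant f \<Longrightarrow> z \<in> G1 \<Longrightarrow> f (act z x) = f x"
  unfolding G1_invariant_def by blast

lemma G1_invariant_act_commute: "G1_invariant f \<Longrightarrow> f (act a (act b x)) = f (act b (act a x))"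
  unfolding act_act_eq_commutator[of a b] by (rule G1_invariantD[OF _ commutator_in_G1])

sublocale equicontinuous_transformations m "act ` G1"
proof unfold_locales
  fix z assume "z \<in> act ` G1"
  then obtain a where z_eq: "a \<in> G1" "z = act a" by blast
  show "continuous_on UNIV z" by (simp add: z_eq act_continuous)
  show "\<exists>w\<in>act ` G1. (\<forall>x. z (w x) = x) \<and> (\<forall>x. w (z x) = x)"
    using G1_inv[OF z_eq(1)] by (intro bexI[of _ "act (inv a)"]) (auto simp: z_eq)
  show "(\<integral>x. g (z x) \<partial>m) = (\<integral>x. g x \<partial>m)" if "ccont g" for g :: "'x \<Rightarrow> complex"
    unfolding z_eq(2) by (rule integral_act[OF that])
  fix w assume "w \<in> act ` G1"
  then obtain b where w_eq: "b \<in> G1" "w = act b" by blast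
  have "(\<lambda>x. z (w x)) = act (a \<otimes> b)" by (simp add: z_eq w_eq act_act)
  then show "(\<lambda>x. z (w x)) \<in> act ` G1" using G1_mult[OF z_eq(1) w_eq(1)] by simp
  show "z (w x) = w (z x)" for x unfolding z_eq(2) w_eq(2) by (rule act_G1_commute[OF z_eq(1)])
next
  have "act \<one> = (\<lambda>x. x)" by (rule ext) simp
  then show "(\<lambda>x. x) \<in> act ` G1" using G1_one by (metis image_eqI)
  show "equicontinuous (act ` G1) (\<lambda>z x. f (z x))" if "continuous_on UNIV f" for f :: "'x \<Rightarrow> real"
    using that by (rule equicontinuous_if_commutes_with_act[rotated]) (use act_G1_commute in auto)
qed

text \<open>Uniqueness of Haar measure on the torus factor, phrased for functions on the nilmanifold:
  the function \<open>K\<close> below is \<open>(g \<Gamma>, h \<Gamma>) \<mapsto> f (g h \<Gamma>)\<close>.\<close>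

lemma G1_invariant_integral_unique:
  fixes f :: "'x \<Rightarrow> complex"
  assumes n_compact_prob: "compact_prob_space n"
    and n_invariant: "\<And>a. (\<integral>x. f (act a x) \<partial>n) = (\<integral>x. f x \<partial>n)"
    and f_invariant: "ccont f" "G1_invariant f"
  shows "(\<integral>x. f x \<partial>n) = (\<integral>x. f x \<partial>m)"
proof -
  interpret n: compact_prob_space n by (rule n_compact_prob)
  have m_compact_prob: "compact_prob_space m" by unfold_locales
  define r where "r x = (SOME g. q g = x)" for x
  define K where "K p = f (act (r (fst p)) (snd p))" for p
  have q_r: "q (r x) = x" for x unfolding r_def by (rule q_SOME)
  have swap: "f (q (g \<otimes> h)) = f (q (h \<otimes> g))" for g h
    using G1_invariant_act_commute[OF f_invariant(2), of g h "q \<one>"] by simp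
  have K_q: "K (q g, q h) = f (q (g \<otimes> h))" for g h
  proof -
    have "K (q g, q h) = f (q (h \<otimes> r (q g)))" unfolding K_def by (simp add: swap)
    also have "\<dots> = f (act h (q (r (q g))))" by simp
    finally show ?thesis by (simp add: q_r swap)
  qed
  have K_sym: "K (x, y) = K (y, x)" for x y
    using K_q swap q_cases[of x] q_cases[of y] by metis
  have "continuous_on UNIV K"
    by (rule continuous_q_prod_lift)
      (auto simp: K_q intro!: continuous_on_compose2[OF f_invariant(1)] continuous_q
        continuous_mult continuous_intros)
  then have "(\<integral>x. \<integral>y. K (x, y) \<partial>n \<partial>m) = (\<integral>y. \<integral>x. K (x, y) \<partial>m \<partial>n)"
    by (rule continuous_Fubini[OF m_compact_prob n_compact_prob])
  moreover have "(\<integral>y. K (x, y) \<partial>n) = (\<integral>x. f x \<partial>n)" for x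
    unfolding K_def by (simp add: n_invariant)
  moreover have "(\<integral>x. K (x, y) \<partial>m) = (\<integral>x. f x \<partial>m)" for y
    unfolding K_sym[of _ y] unfolding K_def by (simp add: integral_act[OF f_invariant(1)])
  ultimately show ?thesis by simp
qed

context
  fixes q1 :: "'g \<Rightarrow> 'y::topological_space" and \<pi> :: "'x \<Rightarrow> 'y"
  assumes torus: "coset_quotient_map G (G1 <#> \<Gamma>) q1" and \<pi>_q: "\<And>g. \<pi> (q g) = q1 g"
begin

interpretation torus: homogeneous_space G "G1 <#> \<Gamma>" q1
  by unfold_locales (rule torus)

lemma torus_projection_continuous: "continuous_on UNIV \<pi>"
  by (rule continuous_q_lift) (simp add: \<pi>_q torus.q_continuous)

lemma torus_projection_act: "\<pi> (act a x) = torus.act a (\<pi> x)"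
  by (rule q_cases[of x]) (simp add: \<pi>_q)

lemma G1_invariant_eq_if_torus_projection_eq:
  assumes "G1_invariant f" "\<pi> x = \<pi> y"
  shows "f x = f y"
proof -
  obtain g h where xy_eq: "x = q g" "y = q h" using q_cases by metis
  then have "inv g \<otimes> h \<in> G1 <#> \<Gamma>"
    using assms(2) by (simp add: \<pi>_q torus.q_eq_iff)
  then obtain z \<gamma> where z_factor: "z \<in> G1" "\<gamma> \<in> \<Gamma>" "inv g \<otimes> h = z \<otimes> \<gamma>"
    unfolding set_mult_def by blast
  have "h = g \<otimes> (z \<otimes> \<gamma>)" by (simp flip: z_factor(3))
  also have "\<dots> = (z \<otimes> g) \<otimes> \<gamma>" using G1_central[OF z_factor(1), of g] by (simp flip: m_assoc)
  finally have "q (z \<otimes> g) = q h" using z_factor(2) by (simp add: q_eq_iff)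
  then have "y = act z x" using xy_eq by simp
  then show ?thesis using G1_invariantD[OF assms(1) z_factor(1)] by simp
qed

lemma G1_invariant_factors_through_torus:
  assumes f_invariant: "continuous_on UNIV f" "G1_invariant f"
  obtains F where "continuous_on UNIV F" "\<And>x. F (\<pi> x) = f x"
proof -
  define F where "F y = f (SOME x. \<pi> x = y)" for y
  have F_factor: "F (\<pi> x) = f x" for x
    unfolding F_def using someI[of "\<lambda>x'. \<pi> x' = \<pi> x" x]
    by (intro G1_invariant_eq_if_torus_projection_eq[OF f_invariant(2)]) simp
  have "continuous_on UNIV F"
    by (rule torus.continuous_q_lift)
      (auto simp: F_factor intro: continuous_on_compose2[OF f_invariant(1) q_continuous]
        simp flip: \<pi>_q)
  with F_factor show thesis using that by blast
qed

theorem integral_eq_of_projects_to_haar: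
  fixes f :: "'x \<Rightarrow> complex"
  assumes haar1: "haar_on_quotient G q1 m1"
    and \<mu>_projects: "compact_prob_space \<mu>" "distr \<mu> borel \<pi> = m1"
    and f_invariant: "ccont f" "G1_invariant f"
  shows "(\<integral>x. f x \<partial>\<mu>) = (\<integral>x. f x \<partial>m)"
proof (rule G1_invariant_integral_unique[OF \<mu>_projects(1) _ f_invariant])
  fix a
  obtain F where F_factor: "continuous_on UNIV F" "\<And>x. F (\<pi> x) = f x"
    using G1_invariant_factors_through_torus[OF f_invariant] by blast
  have \<pi>_measurable: "\<pi> \<in> measurable \<mu> borel"
    by (rule compact_prob_space.measurable_continuous[OF \<mu>_projects(1) torus_projection_continuous])
  have \<mu>_m1: "(\<integral>x. E (\<pi> x) \<partial>\<mu>) = (\<integral>y. E y \<partial>m1)" if "continuous_on UNIV E" for E :: "'y \<Rightarrow> complex"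
    unfolding \<mu>_projects(2)[symmetric]
    by (rule integral_distr[OF \<pi>_measurable borel_measurable_continuous_onI[OF that], symmetric])
  have "(\<integral>x. f (act a x) \<partial>\<mu>) = (\<integral>x. F (torus.act a (\<pi> x)) \<partial>\<mu>)"
    by (simp flip: F_factor(2) add: torus_projection_act)
  also have "\<dots> = (\<integral>y. F (torus.act a y) \<partial>m1)"
    by (rule \<mu>_m1[OF torus.continuous_compose_act[OF F_factor(1)]])
  also have "\<dots> = (\<integral>y. F y \<partial>m1)" by (rule torus.integral_act[OF haar1 F_factor(1)])
  also have "\<dots> = (\<integral>x. F (\<pi> x) \<partial>\<mu>)" by (rule \<mu>_m1[OF F_factor(1), symmetric])
  finally show "(\<integral>x. f (act a x) \<partial>\<mu>) = (\<integral>x. f x \<partial>\<mu>)" by (simp add: F_factor(2))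
qed

end

end

subsection \<open>Vertical characters\<close>

context two_step_nilmanifold
begin

definition vertical_char :: "('x \<Rightarrow> complex) \<Rightarrow> 'g \<Rightarrow> complex" where
  "vertical_char e z = eigenvalue e (act z)"

lemma cinner_compose_act:
  assumes "ccont f" "ccont g"
  shows "cinner (\<lambda>x. f (act a x)) (\<lambda>x. g (act a x)) = cinner f g"
  unfolding cinner_def using integral_act[of "\<lambda>x. f x * cnj (g x)" a] assms
  by (simp add: continuous_intros)

context
  fixes e :: "'x \<Rightarrow> complex"
  assumes eigen: "eigenfunction e"
begin

lemma eigenfunction_act: "z \<in> G1 \<Longrightarrow> e (act z x) = vertical_char e z * e x"
  unfolding vertical_char_def by (rule eigenfunction_apply[OF eigen imageI])

lemma eigenfunction_act_commutator:
  "e (act g (act h x)) = vertical_char e (commutator g h) * e (act h (act g x))"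
  by (subst act_act_eq_commutator) (rule eigenfunction_act[OF commutator_in_G1])

lemma cinner_act_eq_commutator:
  "cinner (\<lambda>x. e (act g x)) e
    = vertical_char e (commutator g h) * cinner (\<lambda>x. e (act h (act g x))) (\<lambda>x. e (act h x))"
proof -
  note cont = eigenfunction_continuous[OF eigen]
  have "cinner (\<lambda>x. e (act g x)) e = cinner (\<lambda>x. e (act g (act h x))) (\<lambda>x. e (act h x))"
    by (rule cinner_compose_act[OF continuous_compose_act[OF cont] cont, symmetric])
  then show ?thesis
    unfolding eigenfunction_act_commutator[of g h] cinner_scale_left .
qed

lemma eventually_cinner_act_close:
  assumes "r > 0"
  shows "\<forall>\<^sub>F h in nhds \<one>. \<forall>g. dist (cinner (\<lambda>x. e (act h (act g x))) (\<lambda>x. e (act h x)))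
    (cinner (\<lambda>x. e (act g x)) e) \<le> r"
proof -
  note cont = eigenfunction_continuous[OF eigen]
  obtain B where B_bound: "B > 0" "\<And>x. cmod (e x) \<le> B"
    using continuous_on_UNIV_bounded[OF compact_UNIV cont] by blast
  have "r / (2 * B) > 0" using assms B_bound(1) by simp
  with uniform_limit_compose_act[OF cont]
  have "\<forall>\<^sub>F h in nhds \<one>. \<forall>x\<in>UNIV. dist (e (act h x)) (e x) < r / (2 * B)"
    by (rule uniform_limitD)
  then show ?thesis
  proof eventually_elim
    case (elim h)
    have "dist (cinner (\<lambda>x. e (act h (act g x))) (\<lambda>x. e (act h x))) (cinner (\<lambda>x. e (act g x)) e)
        \<le> 2 * B * (r / (2 * B))" for g
      using elim B_bound(2)
      by (intro dist_cinner_le cont continuous_compose_act[of "\<lambda>x. e (act h x)"]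
        continuous_compose_act)
        (auto simp: less_imp_le)
    with B_bound(1) show ?case by simp
  qed
qed

context
  assumes nonzero: "e \<noteq> (\<lambda>_. 0)"
begin

lemma norm_vertical_char: "z \<in> G1 \<Longrightarrow> cmod (vertical_char e z) = 1"
  unfolding vertical_char_def by (rule norm_eigenvalue[OF eigen nonzero imageI])

lemma vertical_char_eq_quotient:
  obtains x where "\<And>z. z \<in> G1 \<Longrightarrow> vertical_char e z = e (act z x) / e x"
proof -
  obtain x where "e x \<noteq> 0" using nonzero by auto
  then show thesis using that[of x] by (simp only: eigenfunction_act) simp
qed

lemma vertical_char_mult:
  assumes "z \<in> G1" "w \<in> G1"
  shows "vertical_char e (z \<otimes> w) = vertical_char e z * vertical_char e w"
proof -
  obtain x where x_nonzero: "e x \<noteq> 0" using nonzero by auto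
  have "vertical_char e (z \<otimes> w) * e x = e (act z (act w x))"
    using eigenfunction_act[OF G1_mult[OF assms]] by (simp add: act_act)
  also have "\<dots> = vertical_char e z * vertical_char e w * e x"
    using assms by (simp only: eigenfunction_act mult.assoc)
  finally show ?thesis using x_nonzero by simp
qed

lemma continuous_vertical_char:
  assumes "continuous_on UNIV \<phi>" "\<And>a. \<phi> a \<in> G1"
  shows "continuous_on UNIV (\<lambda>a. vertical_char e (\<phi> a))"
proof -
  obtain x where char_eq: "\<And>z. z \<in> G1 \<Longrightarrow> vertical_char e z = e (act z x) / e x"
    using vertical_char_eq_quotient by blast
  obtain g where x_eq: "x = q g" by (rule q_cases)
  have "continuous_on UNIV (\<lambda>a. e (q (\<phi> a \<otimes> g)))"
    using assms(1)
    by (intro continuous_on_compose2[OF eigenfunction_continuous[OF eigen]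
      continuous_q[OF continuous_mult]])
      (auto intro: continuous_on_const)
  then have "continuous_on UNIV (\<lambda>a. e (act (\<phi> a) x) * inverse (e x))"
    unfolding x_eq act_q by (rule continuous_on_mult_right)
  then show ?thesis by (simp add: char_eq[OF assms(2)] divide_inverse)
qed

lemma vertical_char_\<Gamma>:
  assumes "z \<in> G1" "z \<in> \<Gamma>"
  shows "vertical_char e z = 1"
proof -
  obtain x where x_nonzero: "e x \<noteq> 0" using nonzero by auto
  obtain g where x_eq: "x = q g" by (rule q_cases)
  have "inv z \<in> \<Gamma>" by (rule subgroup.m_inv_closed[OF \<Gamma>_subgroup assms(2)])
  then have "q (g \<otimes> z) = q g"
    by (simp add: q_eq_iff inv_mult_group m_assoc)
  then have "act z x = x" using x_eq G1_central[OF assms(1)] by simp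
  then show ?thesis using eigenfunction_act[OF assms(1), of x] x_nonzero by simp
qed

lemma character_commutator_left: "character (\<lambda>g. vertical_char e (commutator g h))"
  unfolding character_def commutator_mult_left
  by (intro conjI allI vertical_char_mult norm_vertical_char commutator_in_G1
      continuous_vertical_char continuous_commutator continuous_on_id continuous_on_const)

lemma character_commutator_right: "character (\<lambda>g. vertical_char e (commutator h g))"
  unfolding character_def commutator_mult_right
  by (intro conjI allI vertical_char_mult norm_vertical_char commutator_in_G1
      continuous_vertical_char continuous_commutator continuous_on_id continuous_on_const)

lemma vertical_char_one: "vertical_char e \<one> = 1"
  using character_one[OF character_commutator_left] by (simp add: commutator_one_left)

lemma vertical_char_trivial_if_trivial_on_commutators:
  assumes trivial: "\<And>a b. vertical_char e (commutator a b) = 1" and "z \<in> G1"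
  shows "vertical_char e z = 1"
proof -
  have "z \<in> generate G {commutator a b | a b. True}"
    using assms(2) unfolding G1_eq_generate_commutators .
  then show ?thesis
  proof (induction rule: generate.induct)
    case (eng z w)
    then have "z \<in> G1" "w \<in> G1" unfolding G1_eq_generate_commutators by auto
    with eng.IH show ?case by (simp only: vertical_char_mult) simp
  qed (auto simp: vertical_char_one trivial inv_commutator)
qed

end

end

end

subsection \<open>Mixing in the vertical direction\<close>

lemma top_transitive_invariant_const:
  fixes f :: "'x::topological_space \<Rightarrow> 'b::t2_space"
  assumes "top_transitive T" and f_invariant: "continuous_on UNIV f" "\<And>x. f (T x) = f x"
  shows "f x = f y"
proof -
  obtain x0 where x0_dense: "closure {(T ^^ n) x0 | n. True} = UNIV"
    using assms(1) unfolding top_transitive_def by blast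
  have "f ((T ^^ n) x0) = f x0" for n
    by (induction n) (simp_all add: f_invariant(2))
  then have "{(T ^^ n) x0 | n. True} \<subseteq> {x. f x = f x0}" by auto
  moreover have "closed {x. f x = f x0}"
    by (rule closed_Collect_eq[OF f_invariant(1) continuous_on_const])
  ultimately have "closure {(T ^^ n) x0 | n. True} \<subseteq> {x. f x = f x0}"
    by (rule closure_minimal)
  then have "f x = f x0" "f y = f x0"
    unfolding x0_dense by blast+
  then show ?thesis by simp
qed

lemma connected_arc_contains_roots_of_minus_one:
  fixes S :: "complex set"
  assumes S_arc: "connected S" "S \<subseteq> sphere 0 1" "S \<subseteq> - \<real>\<^sub>\<le>\<^sub>0" and w_in_S: "1 \<in> S" "w \<in> S" "w \<noteq> 1"
  shows "\<forall>\<^sub>F n in sequentially. \<exists>z\<in>S. z ^ n = -1"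
proof -
  have polar: "z = cis (Arg z)" if "z \<in> S" for z
  proof -
    have "cmod z = 1" using that S_arc(2) by auto
    moreover from this have "z \<noteq> 0" by auto
    ultimately show ?thesis using cis_Arg[of z] by (simp add: sgn_eq)
  qed
  have "continuous_on S Arg"
    using S_arc(3) by (intro continuous_at_imp_continuous_on ballI continuous_at_Arg) auto
  then have convex: "convex (Arg ` S)"
    using connected_continuous_image S_arc(1) connected_convex_1 by blast
  have zero: "0 \<in> Arg ` S" using w_in_S(1) by (intro image_eqI[of _ _ 1]) auto
  define a where "a = Arg w"
  have a_in_Arg: "a \<in> Arg ` S" "a \<noteq> 0"
    using w_in_S polar[OF w_in_S(2)] by (auto simp: a_def)
  have "\<exists>z\<in>S. z ^ n = -1" if n_large: "n > 0" "pi / \<bar>a\<bar> \<le> real n" for n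
  proof -
    define s where "s = pi / (real n * \<bar>a\<bar>)"
    have s_unit: "0 \<le> s" "s \<le> 1" using n_large a_in_Arg(2) by (auto simp: s_def field_simps)
    then have "s * a \<in> Arg ` S"
      using convexD_alt[OF convex zero a_in_Arg(1)] by simp
    then obtain z where z_root: "z \<in> S" "Arg z = s * a" by auto
    have "z ^ n = cis (real n * (s * a))"
      using polar[OF z_root(1)] Complex.DeMoivre[of "Arg z" n] z_root(2) by simp
    also have "real n * (s * a) = sgn a * pi"
      using n_large(1) a_in_Arg(2) by (simp add: s_def sgn_if field_simps)
    also have "cis (sgn a * pi) = -1" using a_in_Arg(2) by (simp add: sgn_if complex_eq_iff)
    finally show ?thesis using z_root(1) by blast
  qed
  moreover have "\<forall>\<^sub>F n in sequentially. 0 < n \<and> pi / \<bar>a\<bar> \<le> real n"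
    using filterlim_real_sequentially
    by (intro eventually_conj eventually_gt_at_top) (simp add: filterlim_at_top)
  ultimately show ?thesis by (auto elim: eventually_mono)
qed

locale nilsystem = two_step_nilmanifold G \<Gamma> q m
  for G :: "('g::t2_space, 'b) monoid_scheme" (structure)
    and \<Gamma> :: "'g set" and q :: "'g \<Rightarrow> 'x::t2_space" and m +
  fixes u :: 'g
  assumes connected_G: "connected (UNIV :: 'g set)"
    and locally_connected_G: "\<And>W. open W \<Longrightarrow> \<one> \<in> W \<Longrightarrow> \<exists>V\<subseteq>W. open V \<and> connected V \<and> \<one> \<in> V"
    and transitive: "top_transitive (act u)"
begin

lemma character_trivial:
  assumes character: "character \<beta>" and trivial_on_\<Gamma>: "\<And>\<gamma>. \<gamma> \<in> \<Gamma> \<Longrightarrow> \<beta> \<gamma> = 1" and trivial_u: "\<beta> u = 1"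
  shows "\<beta> g = 1"
proof -
  define b where "b x = \<beta> (SOME g. q g = x)" for x
  have b_q: "b (q g) = \<beta> g" for g
  proof -
    let ?r = "SOME h. q h = q g"
    have "\<beta> (inv ?r \<otimes> g) = 1" using trivial_on_\<Gamma> q_SOME[of "q g"] q_eq_iff by blast
    then show ?thesis
      using character_mult[OF character, of ?r "inv ?r \<otimes> g"] by (simp add: b_def)
  qed
  have "continuous_on UNIV b"
    by (rule continuous_q_lift) (simp add: b_q character_continuous[OF character])
  moreover have "b (act u x) = b x" for x
    by (rule q_cases[of x]) (simp add: b_q character_mult[OF character] trivial_u)
  ultimately have "b (q g) = b (q \<one>)"
    by (rule top_transitive_invariant_const[OF transitive])
  then show ?thesis by (simp add: b_q character_one[OF character])
qed

lemma eventually_character_root_of_minus_one: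
  assumes nontrivial: "character \<theta>" "\<theta> h \<noteq> 1" and near: "\<forall>\<^sub>F h in nhds \<one>. P h"
  shows "\<forall>\<^sub>F n in sequentially. \<exists>h. P h \<and> \<theta> h ^ n = -1"
proof -
  obtain W where W_nbhd: "open W" "\<one> \<in> W" "\<And>h. h \<in> W \<Longrightarrow> P h"
    using near unfolding eventually_nhds by blast
  have "open (W \<inter> \<theta> -` (- \<real>\<^sub>\<le>\<^sub>0))" "\<one> \<in> W \<inter> \<theta> -` (- \<real>\<^sub>\<le>\<^sub>0)"
    using W_nbhd(1,2) character_continuous[OF nontrivial(1)] character_one[OF nontrivial(1)]
    by (auto intro!: open_Int open_vimage simp: open_Compl)
  then obtain V where V_nbhd: "V \<subseteq> W \<inter> \<theta> -` (- \<real>\<^sub>\<le>\<^sub>0)" "open V" "connected V" "\<one> \<in> V"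
    using locally_connected_G by blast
  have "\<exists>h\<in>V. \<theta> h \<noteq> 1"
    using character_trivial_near_one[OF nontrivial(1) connected_G] nontrivial(2) V_nbhd(2,4)
    unfolding eventually_nhds by blast
  then obtain h0 where "h0 \<in> V" "\<theta> h0 \<noteq> 1" by blast
  moreover have "connected (\<theta> ` V)"
    using continuous_on_subset[OF character_continuous[OF nontrivial(1)]] V_nbhd(3)
    by (blast intro: connected_continuous_image)
  moreover have "1 \<in> \<theta> ` V" using V_nbhd(4) character_one[OF nontrivial(1)] by (metis image_eqI)
  moreover have "\<theta> ` V \<subseteq> sphere 0 1" using norm_character[OF nontrivial(1)] by auto
  moreover have "\<theta> ` V \<subseteq> - \<real>\<^sub>\<le>\<^sub>0" using V_nbhd(1) by auto
  ultimately have "\<forall>\<^sub>F n in sequentially. \<exists>z\<in>\<theta> ` V. z ^ n = -1"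
    by (intro connected_arc_contains_roots_of_minus_one) auto
  then show ?thesis
    by eventually_elim (use V_nbhd(1) W_nbhd(3) in blast)
qed

context
  fixes e :: "'x \<Rightarrow> complex"
  assumes eigen: "eigenfunction e" and nonzero: "e \<noteq> (\<lambda>_. 0)"
begin

lemma vertical_char_trivial:
  assumes trivial_u: "\<And>h. vertical_char e (commutator u h) = 1" and z_in_G1: "z \<in> G1"
  shows "vertical_char e z = 1"
proof (rule vertical_char_trivial_if_trivial_on_commutators[OF eigen nonzero _ z_in_G1])
  note left = character_commutator_left[OF eigen nonzero]
  have trivial_on_\<Gamma>: "vertical_char e (commutator g \<gamma>') = 1" if \<gamma>'_in_\<Gamma>: "\<gamma>' \<in> \<Gamma>" for g \<gamma>'
  proof (rule character_trivial[OF left _ trivial_u])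
    fix \<gamma> assume "\<gamma> \<in> \<Gamma>"
    then have "commutator \<gamma> \<gamma>' \<in> \<Gamma>"
      unfolding commutator_def using \<gamma>'_in_\<Gamma>
      by (intro subgroup.m_closed[OF \<Gamma>_subgroup] subgroup.m_inv_closed[OF \<Gamma>_subgroup])
    then show "vertical_char e (commutator \<gamma> \<gamma>') = 1"
      by (rule vertical_char_\<Gamma>[OF eigen nonzero commutator_in_G1])
  qed
  show "vertical_char e (commutator a b) = 1" for a b
  proof (rule character_trivial[OF left _ trivial_u])
    fix \<gamma> assume "\<gamma> \<in> \<Gamma>"
    then have "vertical_char e (commutator b \<gamma>) = 1" by (rule trivial_on_\<Gamma>)
    moreover have "commutator \<gamma> b \<otimes> commutator b \<gamma> = \<one>"
      by (simp flip: inv_commutator[of b \<gamma>])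
    ultimately show "vertical_char e (commutator \<gamma> b) = 1"
      using vertical_char_mult[OF eigen nonzero commutator_in_G1 commutator_in_G1, of \<gamma> b b \<gamma>]
        vertical_char_one[OF eigen nonzero] by simp
  qed
qed

theorem correlations_tendsto_zero:
  assumes z_nontrivial: "z \<in> G1" "vertical_char e z \<noteq> 1"
  shows "(\<lambda>n. cinner (\<lambda>x. e (act (u [^] (n::nat)) x)) e) \<longlonglongrightarrow> 0"
proof (rule tendstoI)
  fix r :: real assume "r > 0"
  obtain h1 where h1_nontrivial: "vertical_char e (commutator u h1) \<noteq> 1"
    using vertical_char_trivial z_nontrivial by blast
  have "\<forall>\<^sub>F n in sequentially. \<exists>h. (\<forall>g. dist (cinner (\<lambda>x. e (act h (act g x))) (\<lambda>x. e (act h x)))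
      (cinner (\<lambda>x. e (act g x)) e) \<le> r) \<and> vertical_char e (commutator u h) ^ n = -1"
    by (rule eventually_character_root_of_minus_one[OF character_commutator_right[OF eigen nonzero]
          h1_nontrivial eventually_cinner_act_close[OF eigen \<open>r > 0\<close>]])
  then show "\<forall>\<^sub>F n in sequentially. dist (cinner (\<lambda>x. e (act (u [^] n) x)) e) 0 < r"
  proof eventually_elim
    case (elim n)
    let ?J = "cinner (\<lambda>x. e (act (u [^] n) x)) e"
    obtain h where close: "dist (cinner (\<lambda>x. e (act h (act (u [^] n) x))) (\<lambda>x. e (act h x))) ?J \<le> r"
      and root: "vertical_char e (commutator u h) ^ n = -1"
      using elim by blast
    have "vertical_char e (commutator (u [^] n) h) = -1"
      using character_nat_pow[OF character_commutator_left[OF eigen nonzero]] root by simp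
    then have "cinner (\<lambda>x. e (act h (act (u [^] n) x))) (\<lambda>x. e (act h x)) = - ?J"
      using cinner_act_eq_commutator[OF eigen, of "u [^] n" h] by simp
    with close have "2 * cmod ?J \<le> r"
      by (simp add: dist_norm norm_minus_commute flip: mult_2)
    with \<open>r > 0\<close> show ?case by simp
  qed
qed

end

subsection \<open>Convergence of push-forwards\<close>

context
  fixes \<mu> :: "'x measure"
  assumes \<mu>_compact_prob: "compact_prob_space \<mu>"
    and \<mu>_eq_haar: "\<And>f :: 'x \<Rightarrow> complex. ccont f \<Longrightarrow> G1_invariant f \<Longrightarrow> (\<integral>x. f x \<partial>\<mu>) = (\<integral>x. f x \<partial>m)"
begin

interpretation \<mu>: compact_prob_space \<mu> by (rule \<mu>_compact_prob)

lemma norm_integral_le_sqnorm: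
  assumes v_continuous: "ccont v" and inv: "G1_invariant (\<lambda>x. cmod (v x))"
  shows "(cmod (\<integral>x. v x \<partial>\<mu>))\<^sup>2 \<le> sqnorm v"
proof -
  have "G1_invariant (\<lambda>x. complex_of_real (cmod (v x)))"
    using inv unfolding G1_invariant_def of_real_eq_iff .
  then have "complex_of_real (\<integral>x. cmod (v x) \<partial>\<mu>) = of_real (\<integral>x. cmod (v x) \<partial>m)"
    unfolding integral_complex_of_real[symmetric] using v_continuous
    by (intro \<mu>_eq_haar continuous_intros)
  then have "cmod (\<integral>x. v x \<partial>\<mu>) \<le> (\<integral>x. cmod (v x) \<partial>m)"
    using integral_norm_bound[of \<mu> v] by simp
  also have "\<dots> \<le> sqrt (sqnorm v)" by (rule norm_integral_le_sqrt_sqnorm_of_norm[OF v_continuous])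
  finally have "(cmod (\<integral>x. v x \<partial>\<mu>))\<^sup>2 \<le> (sqrt (sqnorm v))\<^sup>2" by (intro power_mono) auto
  then show ?thesis by simp
qed

lemma nontrivial_eigenfunction_limit:
  assumes eigen: "eigenfunction e" "e \<noteq> (\<lambda>_. 0)" and z_nontrivial: "z \<in> G1" "vertical_char e z \<noteq> 1"
  shows "(\<lambda>n. \<integral>x. e (act (u [^] (n::nat)) x) \<partial>\<mu>) \<longlonglongrightarrow> 0"
proof -
  define E where "E n = (\<lambda>x. e (act (u [^] n) x))" for n :: nat
  have E_continuous: "ccont (E n)" for n
    unfolding E_def by (rule continuous_compose_act[OF eigenfunction_continuous[OF eigen(1)]])
  have stationary: "cinner (E i) (E j) = cinner (E (i - j)) e" if "j \<le> i" for i j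
  proof -
    have "u [^] i = u [^] (i - j) \<otimes> u [^] j" using that by (simp add: nat_pow_mult)
    then show ?thesis
      using cinner_compose_act[OF E_continuous eigenfunction_continuous[OF eigen(1)],
          of "i - j" "u [^] j"]
      by (simp add: E_def act_act)
  qed
  have bounded: "(cmod (\<Sum>i\<in>I. c i * (\<integral>x. E i x \<partial>\<mu>)))\<^sup>2 \<le> sqnorm (\<lambda>x. \<Sum>i\<in>I. c i * E i x)"
    if "finite I" for I c
  proof -
    have "(\<Sum>i\<in>I. c i * E i (act w x)) = vertical_char e w * (\<Sum>i\<in>I. c i * E i x)"
      if w_in_G1: "w \<in> G1" for w x
      unfolding E_def act_G1_commute[OF w_in_G1, symmetric] eigenfunction_act[OF eigen(1) w_in_G1]
        sum_distrib_left
      by (simp add: mult.left_commute)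
    then have "cmod (\<Sum>i\<in>I. c i * E i (act w x)) = cmod (\<Sum>i\<in>I. c i * E i x)"
      if w_in_G1: "w \<in> G1" for w x
      by (simp only: w_in_G1 norm_mult norm_vertical_char[OF eigen w_in_G1] mult_1_left)
    then have "G1_invariant (\<lambda>x. cmod (\<Sum>i\<in>I. c i * E i x))"
      unfolding G1_invariant_def by blast
    moreover have "(\<integral>x. (\<Sum>i\<in>I. c i * E i x) \<partial>\<mu>) = (\<Sum>i\<in>I. c i * (\<integral>x. E i x \<partial>\<mu>))"
      using \<mu>.integrable_continuous[OF E_continuous] by (simp add: Bochner_Integration.integral_sum)
    ultimately show ?thesis
      using norm_integral_le_sqnorm[of "\<lambda>x. \<Sum>i\<in>I. c i * E i x"] E_continuous
      by (simp add: continuous_intros)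
  qed
  have "(\<lambda>n. cinner (E n) e) \<longlonglongrightarrow> 0"
    unfolding E_def by (rule correlations_tendsto_zero[OF eigen z_nontrivial])
  from bounded_functional_tendsto_zero[OF E_continuous stationary this bounded] show ?thesis
    by (simp add: E_def)
qed

lemma eigenfunction_limit:
  assumes eigen: "eigenfunction e"
  shows "(\<lambda>n. \<integral>x. e (act (u [^] (n::nat)) x) \<partial>\<mu>) \<longlonglongrightarrow> (\<integral>x. e x \<partial>m)"
proof (cases "G1_invariant e")
  case True
  note cont = eigenfunction_continuous[OF eigen]
  have "(\<integral>x. e (act g x) \<partial>\<mu>) = (\<integral>x. e x \<partial>m)" for g
  proof -
    have "G1_invariant (\<lambda>x. e (act g x))"
      unfolding G1_invariant_def
      by (simp add: G1_invariantD[OF True] flip: act_G1_commute del: lower_central.simps)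
    then show ?thesis
      using \<mu>_eq_haar[OF continuous_compose_act[OF cont]] integral_act[OF cont] by simp
  qed
  then show ?thesis by simp
next
  case False
  then obtain z x where z_moves: "z \<in> G1" "e (act z x) \<noteq> e x" unfolding G1_invariant_def by blast
  then have "vertical_char e z \<noteq> 1" "e \<noteq> (\<lambda>_. 0)"
    using eigenfunction_act[OF eigen z_moves(1), of x] by auto
  moreover have "(\<integral>x. e x \<partial>m) = vertical_char e z * (\<integral>x. e x \<partial>m)"
    using integral_act[OF eigenfunction_continuous[OF eigen], of z]
    unfolding eigenfunction_act[OF eigen z_moves(1)] by simp
  ultimately show ?thesis
    using nontrivial_eigenfunction_limit[OF eigen _ z_moves(1)] by simp
qed

lemma eigenspan_limit:
  "s \<in> eigenspan \<Longrightarrow> (\<lambda>n. \<integral>x. s (act (u [^] (n::nat)) x) \<partial>\<mu>) \<longlonglongrightarrow> (\<integral>x. s x \<partial>m)"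
proof (induction rule: eigenspan.induct)
  case (base e)
  then show ?case by (rule eigenfunction_limit)
next
  case (add s t)
  note cont = eigenspan_continuous[OF add.hyps(1)] eigenspan_continuous[OF add.hyps(2)]
  from tendsto_add[OF add.IH] show ?case
    using cont by (simp add: \<mu>.integrable_continuous integrable_continuous continuous_compose_act)
qed

theorem continuous_limit:
  fixes f :: "'x \<Rightarrow> real"
  assumes f_continuous: "continuous_on UNIV f"
  shows "(\<lambda>n. \<integral>x. f ((act u ^^ n) x) \<partial>\<mu>) \<longlonglongrightarrow> (\<integral>x. f x \<partial>m)"
  unfolding act_funpow
proof (rule tendsto_uniform_approximation)
  fix r :: real assume "r > 0"
  then obtain s where s_approx: "s \<in> eigenspan" "\<And>x. \<bar>f x - Re (s x)\<bar> < r"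
    using Re_eigenspan_dense[OF f_continuous] by blast
  note cont = eigenspan_continuous[OF s_approx(1)]
  have Re_cont: "continuous_on UNIV (\<lambda>x. Re (s x))" using cont by (rule continuous_on_Re)
  have close: "dist (f x) (Re (s x)) \<le> r" for x
    using s_approx(2)[of x] by (simp add: dist_real_def)
  have "(\<lambda>n. \<integral>x. Re (s (act (u [^] n) x)) \<partial>\<mu>) \<longlonglongrightarrow> (\<integral>x. Re (s x) \<partial>m)"
    using tendsto_Re[OF eigenspan_limit[OF s_approx(1)]] cont
    by (simp add: \<mu>.integrable_continuous integrable_continuous continuous_compose_act)
  moreover have "dist (\<integral>x. f (act (u [^] n) x) \<partial>\<mu>) (\<integral>x. Re (s (act (u [^] n) x)) \<partial>\<mu>) \<le> r" for n
    by (intro \<mu>.dist_integral_le \<mu>.integrable_continuous continuous_compose_act f_continuous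
      Re_cont close)
  moreover have "dist (\<integral>x. f x \<partial>m) (\<integral>x. Re (s x) \<partial>m) \<le> r"
    by (intro dist_integral_le integrable_continuous f_continuous Re_cont close)
  ultimately show "\<exists>b l'. b \<longlonglongrightarrow> l' \<and> (\<forall>n. dist (\<integral>x. f (act (u [^] n) x) \<partial>\<mu>) (b n) \<le> r)
      \<and> dist (\<integral>x. f x \<partial>m) l' \<le> r"
    by blast
qed

end

end

lemma locally_euclidean_connected_nbhd:
  fixes x :: "'g::topological_space" and V0 :: "'e::euclidean_space set"
  assumes chart: "open U0" "x \<in> U0" "open V0" "U0 homeomorphic V0" and W_nbhd: "open W" "x \<in> W"
  shows "\<exists>V\<subseteq>W. open V \<and> connected V \<and> x \<in> V"
proof -
  obtain f g where homeo: "homeomorphism U0 V0 f g" using chart(4) by (auto simp: homeomorphic_def)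
  have homeo_facts: "f ` U0 = V0" "continuous_on V0 g" "g ` V0 = U0" "\<And>y. y \<in> U0 \<Longrightarrow> g (f y) = y"
    "\<And>y. y \<in> V0 \<Longrightarrow> f (g y) = y" "continuous_on U0 f"
    using homeo by (auto simp: homeomorphism_def)
  have "open (V0 \<inter> g -` W)"
    using homeo_facts(2) W_nbhd(1) chart(3) continuous_on_open_vimage by (metis Int_commute)
  moreover have "f x \<in> V0 \<inter> g -` W" using homeo_facts chart(2) W_nbhd(2) by auto
  ultimately obtain r where r_ball: "r > 0" "ball (f x) r \<subseteq> V0 \<inter> g -` W"
    using open_contains_ball by blast
  define V where "V = U0 \<inter> f -` ball (f x) r"
  have "open V" unfolding V_def
    using homeo_facts(6) chart(1) continuous_on_open_vimage by (metis Int_commute open_ball)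
  moreover have V_eq: "V = g ` ball (f x) r"
    unfolding V_def using r_ball(2) homeo_facts
    by (auto simp: image_iff) (metis IntD1 subsetD mem_ball)+
  then have "connected V"
    using connected_continuous_image[OF continuous_on_subset[OF homeo_facts(2)],
      of "ball (f x) r"] r_ball(2) by auto
  moreover have "x \<in> V" using chart(2) r_ball(1) by (simp add: V_def)
  moreover have "V \<subseteq> W" unfolding V_eq using r_ball(2) by auto
  ultimately show ?thesis by blast
qed

lemma lie_group_connected_nbhd:
  fixes G :: "('g::t2_space, 'b) monoid_scheme" and E :: "'e::euclidean_space itself"
    and W :: "'g set"
  assumes "lie_group G E" "open W" "x \<in> W"
  shows "\<exists>V\<subseteq>W. open V \<and> connected V \<and> x \<in> V"
proof -
  obtain U and V :: "'e set" where "open U" "x \<in> U" "open V" "U homeomorphic V"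
    using assms(1) unfolding lie_group_def by blast
  from locally_euclidean_connected_nbhd[OF this assms(2,3)] show ?thesis .
qed

theorem theorem1p3:
  fixes G :: "('g::t2_space) monoid"
    and E :: "'e::euclidean_space itself"
    and \<Gamma> :: "'g set"
    and q :: "'g \<Rightarrow> 'x::t2_space"
    and q1 :: "'g \<Rightarrow> 'y::topological_space"
    and \<pi> :: "'x \<Rightarrow> 'y"
    and u :: 'g
    and T :: "'x \<Rightarrow> 'x"
    and m :: "'x measure" and m1 :: "'y measure" and \<mu> :: "'x measure"
    and f :: "'x \<Rightarrow> real"
  assumes lie: "lie_group G E"
    and conn: "connected (UNIV :: 'g set)"
    and two_step: "lower_central G 2 = {\<one>\<^bsub>G\<^esub>}"
    and sub: "subgroup \<Gamma> G"
    and discrete: "\<forall>\<gamma>\<in>\<Gamma>. \<exists>U. open U \<and> U \<inter> \<Gamma> = {\<gamma>}"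
    and X: "coset_quotient_map G \<Gamma> q"
    and cocompact: "compact (UNIV :: 'x set)"
    and X1: "coset_quotient_map G (lower_central G 1 <#>\<^bsub>G\<^esub> \<Gamma>) q1"
    and proj: "\<forall>g. \<pi> (q g) = q1 g"
    and haar: "haar_on_quotient G q m"
    and haar1: "haar_on_quotient G q1 m1"
    and T_def: "\<forall>g. T (q g) = q (u \<otimes>\<^bsub>G\<^esub> g)"
    and trans: "top_transitive T"
    and mu_sets: "sets \<mu> = sets borel" and mu_prob: "prob_space \<mu>"
    and mu_proj: "distr \<mu> borel \<pi> = m1"
    and f_cont: "continuous_on UNIV f"
  shows "(\<lambda>n. \<integral>x. f ((T ^^ n) x) \<partial>\<mu>) \<longlonglongrightarrow> (\<integral>x. f x \<partial>m)"
proof -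
  have "topological_group G" using lie by (simp add: lie_group_def)
  then interpret two_step_nilmanifold G \<Gamma> q m
    by (intro two_step_nilmanifold.intro two_step_nilmanifold_axioms.intro
        compact_homogeneous_space.intro compact_homogeneous_space_axioms.intro
        homogeneous_space.intro homogeneous_space_axioms.intro top_group.intro
        X cocompact haar two_step sub)
  have T_eq_act: "T = act u"
  proof
    show "T x = act u x" for x by (rule q_cases[of x]) (simp add: T_def)
  qed
  interpret nilsystem G \<Gamma> q m u
    by unfold_locales (use conn trans T_eq_act lie_group_connected_nbhd[OF lie] in auto)
  have \<mu>_compact_prob: "compact_prob_space \<mu>"
    by (intro compact_prob_space.intro cocompact mu_sets mu_prob)
  have "(\<integral>x. h x \<partial>\<mu>) = (\<integral>x. h x \<partial>m)" if "ccont h" "G1_invariant h" for h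
    using proj by (intro integral_eq_of_projects_to_haar[OF X1 _ haar1 \<mu>_compact_prob mu_proj
      that]) simp
  then show ?thesis
    unfolding T_eq_act by (rule continuous_limit[OF \<mu>_compact_prob _ f_cont])
qed

end
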